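(* Let $S$ be a smooth $n$-dimensional manifold which is a symmetric space, and let $X_1,\dots,X_m$ be smooth vector fields on $S$ satisfying $\mathrm{LTS}\{X_1,\dots,X_m\}(x)=T_xS$ for all $x\in S$. Then for every $x\in S$, the reachable set $R_x$ of the system $\dot x=\sum_{i=1}^m u_iX_i(x)$ from $x$ is a neighbourhood of $x$ in $S$.
   Context: A symmetric space is a manifold $S$ with a smooth product $(a,b)\mapsto a\cdot b$ satisfying $a\cdot a=a$, $a\cdot(a\cdot b)=b$, $a\cdot(b\cdot c)=(a\cdot b)\cdot(a\cdot c)$, and such that every $a$ has a neighbourhood $U$ with $a\cdot b=b\Rightarrow b=a$ for $b\in U$. $[X,Y]=XY-YX$ is the Lie bracket of vector fields. $\mathrm{LTS}\{X_1,\dots,X_m\}=\bigcup_{p\ge1}\Theta^p$, where $\Theta^1=\mathrm{span}\{X_1,\dots,X_m\}$ and $\Theta^{p+1}=\Theta^p+\mathrm{span}\{[[A,B],C]: A,C\in\Theta^1,\ B\in\Theta^p\}$; and $\mathrm{LTS}\{X_1,\dots,X_m\}(x)=\{X(x):X\in\mathrm{LTS}\{X_1,\dots,X_m\}\}$. The reachable set $R_x$ is the set of all points $y\in S$ such that for some $t_f\ge0$ and some control $u\in L^2([0,t_f],\mathbb{R}^m)$ the solution of $\dot x(t)=\sum_i u_i(t)X_i(x(t))$, $x(0)=x$, is defined on $[0,t_f]$ and satisfies $x(t_f)=y$. *)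

theory Defs
  imports "HOL-Analysis.Analysis"
begin

definition higher_dir :: "'b::real_normed_vector list \<Rightarrow> ('b \<Rightarrow> 'c::real_normed_vector) \<Rightarrow> 'b \<Rightarrow> 'c" where
  "higher_dir vs f = foldr (\<lambda>v g x. frechet_derivative g (at x) v) vs f"

text \<open>C-infinity on an open set U: all iterated directional derivatives exist and are
  Frechet differentiable on U.\<close>
definition smooth_on :: "'b::euclidean_space set \<Rightarrow> ('b \<Rightarrow> 'c::real_normed_vector) \<Rightarrow> bool" where
  "smooth_on U f \<longleftrightarrow> (\<forall>vs. higher_dir vs f differentiable_on U)"

definition smooth_atlas :: "('a::topological_space set \<times> ('a \<Rightarrow> real^'n)) set \<Rightarrow> bool" where
  "smooth_atlas A \<longleftrightarrow>
     (\<forall>(U,\<phi>)\<in>A. open U \<and> open (\<phi> ` U) \<and> (\<exists>\<psi>. homeomorphism U (\<phi> ` U) \<phi> \<psi>)) \<and>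
     (\<Union>(fst ` A) = UNIV) \<and>
     (\<forall>(U,\<phi>)\<in>A. \<forall>(V,\<psi>)\<in>A. smooth_on (\<phi> ` (U \<inter> V)) (\<psi> \<circ> inv_into U \<phi>))"

definition smooth_manifold :: "('a::topological_space set \<times> ('a \<Rightarrow> real^'n)) set \<Rightarrow> bool" where
  "smooth_manifold A \<longleftrightarrow>
     (\<forall>x y::'a. x \<noteq> y \<longrightarrow> (\<exists>U V. open U \<and> open V \<and> x \<in> U \<and> y \<in> V \<and> U \<inter> V = {})) \<and>
     (\<exists>B::'a set set. countable B \<and> topological_basis B) \<and>
     smooth_atlas A"

definition smooth_funs :: "('a::topological_space set \<times> ('a \<Rightarrow> real^'n)) set \<Rightarrow> ('a \<Rightarrow> real) set" where
  "smooth_funs A = {f. \<forall>(U,\<phi>)\<in>A. smooth_on (\<phi> ` U) (f \<circ> inv_into U \<phi>)}"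

definition smooth_binop :: "('a::topological_space set \<times> ('a \<Rightarrow> real^'n)) set \<Rightarrow> ('a \<Rightarrow> 'a \<Rightarrow> 'a) \<Rightarrow> bool" where
  "smooth_binop A m \<longleftrightarrow>
     continuous_on UNIV (\<lambda>(a,b). m a b) \<and>
     (\<forall>(U,\<phi>)\<in>A. \<forall>(U',\<phi>')\<in>A. \<forall>(V,\<psi>)\<in>A.
        smooth_on ((\<lambda>(a,b). (\<phi> a, \<phi>' b)) ` ((U \<times> U') \<inter> (\<lambda>(a,b). m a b) -` V))
                  (\<lambda>(p,q). \<psi> (m (inv_into U \<phi> p) (inv_into U' \<phi>' q))))"

definition symmetric_space :: "('a::topological_space set \<times> ('a \<Rightarrow> real^'n)) set \<Rightarrow> ('a \<Rightarrow> 'a \<Rightarrow> 'a) \<Rightarrow> bool" where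
  "symmetric_space A m \<longleftrightarrow>
     smooth_manifold A \<and> smooth_binop A m \<and>
     (\<forall>a. m a a = a) \<and>
     (\<forall>a b. m a (m a b) = b) \<and>
     (\<forall>a b c. m a (m b c) = m (m a b) (m a c)) \<and>
     (\<forall>a. \<exists>U. open U \<and> a \<in> U \<and> (\<forall>b\<in>U. m a b = b \<longrightarrow> b = a))"

type_synonym 'a vfield = "('a \<Rightarrow> real) \<Rightarrow> ('a \<Rightarrow> real)"

definition smooth_vector_field :: "('a::topological_space set \<times> ('a \<Rightarrow> real^'n)) set \<Rightarrow> 'a vfield \<Rightarrow> bool" where
  "smooth_vector_field A X \<longleftrightarrow>
     (\<forall>f\<in>smooth_funs A. X f \<in> smooth_funs A) \<and>
     (\<forall>f\<in>smooth_funs A. \<forall>g\<in>smooth_funs A. X (\<lambda>x. f x + g x) = (\<lambda>x. X f x + X g x)) \<and>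
     (\<forall>f\<in>smooth_funs A. \<forall>c::real. X (\<lambda>x. c * f x) = (\<lambda>x. c * X f x)) \<and>
     (\<forall>f\<in>smooth_funs A. \<forall>g\<in>smooth_funs A. X (\<lambda>x. f x * g x) = (\<lambda>x. f x * X g x + g x * X f x))"

definition tangent_space :: "('a::topological_space set \<times> ('a \<Rightarrow> real^'n)) set \<Rightarrow> 'a \<Rightarrow> (('a \<Rightarrow> real) \<Rightarrow> real) set" where
  "tangent_space A x = {v. v \<in> extensional (smooth_funs A) \<and>
     (\<forall>f\<in>smooth_funs A. \<forall>g\<in>smooth_funs A. v (\<lambda>y. f y + g y) = v f + v g) \<and>
     (\<forall>f\<in>smooth_funs A. \<forall>c::real. v (\<lambda>y. c * f y) = c * v f) \<and>
     (\<forall>f\<in>smooth_funs A. \<forall>g\<in>smooth_funs A. v (\<lambda>y. f y * g y) = f x * v g + g x * v f)}"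

definition lie_bracket :: "'a vfield \<Rightarrow> 'a vfield \<Rightarrow> 'a vfield" where
  "lie_bracket X Y = (\<lambda>f x. X (Y f) x - Y (X f) x)"

inductive_set opspan :: "'a vfield set \<Rightarrow> 'a vfield set" for G where
  zero: "(\<lambda>f x. 0) \<in> opspan G"
| gen: "X \<in> G \<Longrightarrow> X \<in> opspan G"
| add: "X \<in> opspan G \<Longrightarrow> Y \<in> opspan G \<Longrightarrow> (\<lambda>f x. X f x + Y f x) \<in> opspan G"
| scale: "X \<in> opspan G \<Longrightarrow> (\<lambda>f x. c * X f x) \<in> opspan G"

text \<open>Theta^p (index p >= 1) and the Lie triple system LTS{X_1,...,X_m}.\<close>
fun Theta :: "('m \<Rightarrow> 'a vfield) \<Rightarrow> nat \<Rightarrow> 'a vfield set" where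
  "Theta X 0 = {}"
| "Theta X (Suc 0) = opspan (range X)"
| "Theta X (Suc (Suc p)) =
     {(\<lambda>f x. P f x + Q f x) | P Q. P \<in> Theta X (Suc p) \<and>
        Q \<in> opspan {lie_bracket (lie_bracket A B) C | A B C.
                      A \<in> Theta X (Suc 0) \<and> B \<in> Theta X (Suc p) \<and> C \<in> Theta X (Suc 0)}}"

definition LTS :: "('m \<Rightarrow> 'a vfield) \<Rightarrow> 'a vfield set" where
  "LTS X = (\<Union>p\<in>{1..}. Theta X p)"

definition LTS_at :: "('a::topological_space set \<times> ('a \<Rightarrow> real^'n)) set \<Rightarrow> ('m \<Rightarrow> 'a vfield) \<Rightarrow> 'a \<Rightarrow> (('a \<Rightarrow> real) \<Rightarrow> real) set" where
  "LTS_at A X x = {restrict (\<lambda>f. Y f x) (smooth_funs A) | Y. Y \<in> LTS X}"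

text \<open>gamma is a solution on [0,tf] of dx/dt = sum_i u_i(t) X_i(x(t)) with gamma(0) = x:
  gamma is continuous and, for every smooth f, f(gamma t) = f(x) + integral_0^t sum_i u_i(s) (X_i f)(gamma s) ds
  (the Caratheodory/integral form of the ODE in the derivation picture).\<close>
definition is_solution :: "('a::topological_space set \<times> ('a \<Rightarrow> real^'n)) set \<Rightarrow> ('m::finite \<Rightarrow> 'a vfield)
    \<Rightarrow> (real \<Rightarrow> real^'m) \<Rightarrow> real \<Rightarrow> 'a \<Rightarrow> (real \<Rightarrow> 'a) \<Rightarrow> bool" where
  "is_solution A X u tf x \<gamma> \<longleftrightarrow>
     \<gamma> 0 = x \<and> continuous_on {0..tf} \<gamma> \<and>
     (\<forall>f\<in>smooth_funs A. \<forall>t\<in>{0..tf}.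
        ((\<lambda>s. \<Sum>i\<in>UNIV. u s $ i * X i f (\<gamma> s)) has_integral (f (\<gamma> t) - f x)) {0..t})"

definition L2_control :: "real \<Rightarrow> (real \<Rightarrow> real^'m::finite) \<Rightarrow> bool" where
  "L2_control tf u \<longleftrightarrow> (\<forall>i. (\<lambda>t. u t $ i) measurable_on {0..tf} \<and> (\<lambda>t. (u t $ i)^2) integrable_on {0..tf})"

definition reachable_set :: "('a::topological_space set \<times> ('a \<Rightarrow> real^'n)) set \<Rightarrow> ('m::finite \<Rightarrow> 'a vfield) \<Rightarrow> 'a \<Rightarrow> 'a set" where
  "reachable_set A X x = {y. \<exists>tf u \<gamma>. tf \<ge> 0 \<and> L2_control tf u \<and> is_solution A X u tf x \<gamma> \<and> \<gamma> tf = y}"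

end

theory Submission
  imports Defs "HOL-Computational_Algebra.Formal_Power_Series"
begin

text \<open>This is an instance of the Chow--Rashevskii theorem.  Differentiating \<open>f\<close> along a flow line of \<open>X\<^sub>i\<close> gives
  \<open>X\<^sub>i f\<close>, so by Taylor's theorem \<open>f\<close> composed with a product of flows \<open>exp (\<plusminus> t X\<^sub>i)\<close> has an asymptotic expansion in
  \<open>t\<close>, locally uniform in the starting point, whose coefficients are read off from the product of the corresponding
  exponentials in the ring of noncommutative power series.  An iterated group commutator of flows therefore moves a
  point \<open>y\<close> by \<open>t\<^sup>k Z(y) + O(t\<^sup>k\<^sup>+\<^sup>1)\<close>, where \<open>Z\<close> is an iterated Lie bracket of order \<open>k\<close>.  After the substitution
  \<open>s = t\<^sup>k\<close>, composing such motions for brackets \<open>Z\<^sub>1, \<dots>, Z\<^sub>n\<close> forming a basis of the tangent space gives a continuous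
  map from a neighbourhood of \<open>0\<close> in \<open>\<real>\<^sup>n\<close> into the reachable set, differentiable at \<open>0\<close> with invertible
  derivative; by Brouwer's theorem (in the form of Sussmann's open mapping lemma) its image is a neighbourhood of \<open>x\<close>.
  Only continuity of the flows in the starting point is needed, not their smoothness.\<close>

section \<open>Smooth functions on open sets\<close>

text \<open>Vector fields and tangent vectors are derivations of the algebra of globally smooth
  functions, so the differential equation of a flow has to be recovered first: bump functions extend
  chart coordinates to global functions, and Hadamard's lemma expresses X f at p through the values
  of X on these. Uniformity in the starting point matters because in a composite motion the later
  flow starts at a point that itself moves with t. Left-normed brackets, which grow by one generator
  at a time, are enough to span the Lie triple system, and a group commutator of a word with a
  single exponential produces exactly such a step. A leading term of even degree k cannot change
  direction with the sign of t, so each bracket B is realised by two words, with leading parts B and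
  -B, used for positive and negative s. Since t is then a k-th root of |s|, smoothness in s is lost;
  what survives is continuity near 0 and a derivative at 0, which is why a topological open mapping
  lemma takes the place of the inverse function theorem.\<close>

primrec kdiff :: "nat \<Rightarrow> 'b::euclidean_space set \<Rightarrow> ('b \<Rightarrow> 'c::real_normed_vector) \<Rightarrow> bool" where
  "kdiff 0 U f \<longleftrightarrow> f differentiable_on U"
| "kdiff (Suc k) U f \<longleftrightarrow> f differentiable_on U \<and> (\<forall>v. kdiff k U (\<lambda>x. frechet_derivative f (at x) v))"

lemma higher_dir_snoc:
  "higher_dir (vs @ [v]) f = higher_dir vs (\<lambda>x. frechet_derivative f (at x) v)"
  by (simp add: higher_dir_def)

text \<open>\<open>higher_dir\<close> folds from the right, so the derivative in the direction of
  the last vector is taken first, and peeling it off turns the claim for \<open>f\<close> into one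
  for a directional derivative of \<open>f\<close>. Bounding the order by \<open>k\<close> opens
  smoothness to induction with \<open>f\<close> arbitrary.\<close>

lemma kdiff_iff_higher_dir:
  "kdiff k U f \<longleftrightarrow> (\<forall>vs. length vs \<le> k \<longrightarrow> higher_dir vs f differentiable_on U)"
proof (induction k arbitrary: f)
  case 0
  then show ?case by (simp add: higher_dir_def)
next
  case (Suc k)
  show ?case
  proof
    assume *: "kdiff (Suc k) U f"
    show "\<forall>vs. length vs \<le> Suc k \<longrightarrow> higher_dir vs f differentiable_on U"
    proof (intro allI impI)
      fix vs :: "'a list" assume "length vs \<le> Suc k"
      then show "higher_dir vs f differentiable_on U"
        using * by (cases vs rule: rev_cases) (auto simp: higher_dir_snoc Suc.IH, simp add: higher_dir_def)
    qed
  next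
    assume *: "\<forall>vs. length vs \<le> Suc k \<longrightarrow> higher_dir vs f differentiable_on U"
    have "f differentiable_on U" using *[rule_format, of "[]"] by (simp add: higher_dir_def)
    moreover have "kdiff k U (\<lambda>x. frechet_derivative f (at x) v)" for v
      unfolding Suc.IH using *[rule_format, of "_ @ [v]"] by (simp add: higher_dir_snoc)
    ultimately show "kdiff (Suc k) U f" by simp
  qed
qed

lemma smooth_on_iff_kdiff: "smooth_on U f \<longleftrightarrow> (\<forall>k. kdiff k U f)"
  unfolding smooth_on_def kdiff_iff_higher_dir by auto

lemma kdiff_differentiable_on: "kdiff k U f \<Longrightarrow> f differentiable_on U"
  by (cases k) auto

lemma kdiff_Suc_imp: "kdiff (Suc k) U f \<Longrightarrow> kdiff k U f"
  by (simp add: kdiff_iff_higher_dir)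

lemma kdiff_has_derivative:
  "kdiff k U f \<Longrightarrow> open U \<Longrightarrow> x \<in> U \<Longrightarrow> (f has_derivative frechet_derivative f (at x)) (at x)"
  using kdiff_differentiable_on differentiable_on_eq_differentiable_at frechet_derivative_works by blast

lemma frechet_derivative_eqI: "(f has_derivative f') (at x) \<Longrightarrow> frechet_derivative f (at x) = f'"
  by (metis frechet_derivative_at)

lemma kdiff_cong:
  assumes "open U" "kdiff k U f" "\<And>x. x \<in> U \<Longrightarrow> g x = f x"
  shows "kdiff k U g"
  using assms(2,3)
proof (induction k arbitrary: f g)
  case (Suc k)
  have der: "(g has_derivative frechet_derivative f (at x)) (at x)" if "x \<in> U" for x
    using has_derivative_transform_within_open[OF kdiff_has_derivative[OF Suc.prems(1) assms(1) that] assms(1) that]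
      Suc.prems(2) by simp
  have "kdiff k U (\<lambda>x. frechet_derivative g (at x) v)" for v
  proof (rule Suc.IH)
    show "kdiff k U (\<lambda>x. frechet_derivative f (at x) v)" using Suc.prems(1) by simp
    show "frechet_derivative g (at x) v = frechet_derivative f (at x) v" if "x \<in> U" for x
      using frechet_derivative_eqI[OF der[OF that]] by simp
  qed
  moreover have "g differentiable_on U"
    by (rule differentiable_at_imp_differentiable_on) (use der differentiable_def in blast)
  ultimately show ?case by simp
next
  case 0
  then have "(g has_derivative frechet_derivative f (at x)) (at x)" if "x \<in> U" for x
    using has_derivative_transform_within_open[OF kdiff_has_derivative[OF 0(1) assms(1) that] assms(1) that]
    by simp
  then have "g differentiable_on U"
    by (intro differentiable_at_imp_differentiable_on) (use differentiable_def in blast)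
  then show ?case by simp
qed

text \<open>\<open>frechet_derivative\<close> is a choice term that says nothing where no derivative
  exists. This rule accepts an explicit formula valid on \<open>U\<close> only; the inductions for
  products, compositions, flat functions and ray integrals all run through it.\<close>

lemma kdiff_derivI:
  assumes "open U" "\<And>x. x \<in> U \<Longrightarrow> (f has_derivative f' x) (at x)"
    and "\<And>v. kdiff k U (\<lambda>x. f' x v)"
  shows "kdiff (Suc k) U f"
proof -
  have "f differentiable_on U"
    by (rule differentiable_at_imp_differentiable_on) (use assms(2) differentiable_def in blast)
  moreover have "kdiff k U (\<lambda>x. frechet_derivative f (at x) v)" for v
    by (rule kdiff_cong[OF assms(1) assms(3)[of v]]) (metis frechet_derivative_eqI[OF assms(2)])
  ultimately show ?thesis by simp
qed

lemma kdiff_subset: "kdiff k U f \<Longrightarrow> V \<subseteq> U \<Longrightarrow> kdiff k V f"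
  by (induction k arbitrary: f) (auto intro: differentiable_on_subset)

lemma kdiff_local:
  assumes "\<And>x. x \<in> U \<Longrightarrow> \<exists>V. open V \<and> x \<in> V \<and> kdiff k V f"
  shows "kdiff k U f"
  using assms
proof (induction k arbitrary: f)
  case 0
  then show ?case
    by (simp, intro differentiable_at_imp_differentiable_on) (metis differentiable_on_eq_differentiable_at)
next
  case (Suc k)
  have "f differentiable_on U"
    by (rule differentiable_at_imp_differentiable_on)
      (metis Suc.prems kdiff_differentiable_on differentiable_on_eq_differentiable_at)
  moreover have "kdiff k U (\<lambda>x. frechet_derivative f (at x) v)" for v
    by (rule Suc.IH) (use Suc.prems in \<open>metis kdiff.simps(2)\<close>)
  ultimately show ?case by simp
qed

lemma kdiff_const: "open U \<Longrightarrow> kdiff k U (\<lambda>x. c)"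
proof (induction k arbitrary: c)
  case (Suc k)
  then show ?case by (intro kdiff_derivI[where f' = "\<lambda>_ _. 0"]) auto
qed auto

lemma kdiff_bounded_linear: "open U \<Longrightarrow> bounded_linear L \<Longrightarrow> kdiff k U L"
proof (cases k)
  case (Suc j)
  assume "open U" "bounded_linear L"
  then show ?thesis unfolding Suc
    by (intro kdiff_derivI[where f' = "\<lambda>_. L"]) (auto intro: bounded_linear_imp_has_derivative kdiff_const)
qed (auto simp: bounded_linear_imp_differentiable_on)

lemma kdiff_bounded_linear_compose:
  assumes "bounded_linear L" "open U" "kdiff k U f"
  shows "kdiff k U (\<lambda>x. L (f x))"
  using assms(3)
proof (induction k arbitrary: f)
  case 0
  then show ?case
    using bounded_linear.has_derivative[OF assms(1)] by (fastforce simp: differentiable_on_def differentiable_def)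
next
  case (Suc k)
  show ?case
    by (rule kdiff_derivI[OF assms(2)])
      (use bounded_linear.has_derivative[OF assms(1) kdiff_has_derivative[OF Suc.prems assms(2)]] Suc in auto)
qed

lemma kdiff_add:
  assumes "open U" "kdiff k U f" "kdiff k U g"
  shows "kdiff k U (\<lambda>x. f x + g x)"
  using assms(2,3)
proof (induction k arbitrary: f g)
  case (Suc k)
  show ?case
    by (rule kdiff_derivI[OF assms(1)])
      (use has_derivative_add[OF Suc.prems[THEN kdiff_has_derivative, OF assms(1) _ ]] Suc in auto)
qed (auto intro: derivative_intros)

lemma kdiff_sum:
  assumes "open U" "\<And>i. i \<in> I \<Longrightarrow> kdiff k U (f i)"
  shows "kdiff k U (\<lambda>x. \<Sum>i\<in>I. f i x)"
  using assms(2)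
  by (induction I rule: infinite_finite_induct) (auto intro: kdiff_const kdiff_add assms(1))

lemma kdiff_scaleR:
  fixes f :: "'b::euclidean_space \<Rightarrow> real"
  assumes "open U" "kdiff k U f" "kdiff k U g"
  shows "kdiff k U (\<lambda>x. f x *\<^sub>R g x)"
  using assms(2,3)
proof (induction k arbitrary: f g)
  case (Suc k)
  show ?case
  proof (rule kdiff_derivI[OF assms(1)])
    show "((\<lambda>x. f x *\<^sub>R g x) has_derivative
        (\<lambda>v. f x *\<^sub>R frechet_derivative g (at x) v + frechet_derivative f (at x) v *\<^sub>R g x)) (at x)"
      if "x \<in> U" for x
      using has_derivative_scaleR[OF Suc.prems[THEN kdiff_has_derivative, OF assms(1) that ]] .
    show "kdiff k U (\<lambda>x. f x *\<^sub>R frechet_derivative g (at x) v + frechet_derivative f (at x) v *\<^sub>R g x)" for v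
      using Suc.prems by (intro kdiff_add Suc.IH assms(1)) (auto dest: kdiff_Suc_imp simp del: kdiff.simps(2), auto)
  qed
qed (auto simp: differentiable_on_def intro: differentiable_scaleR)

text \<open>Expanding over the basis turns a derivative in a moving direction into scalar functions
  times derivatives in fixed directions, the only kind that \<open>kdiff\<close> speaks about; this
  is what lets the induction for the chain rule close.\<close>

lemma has_derivative_componentwise_sum:
  fixes v :: "'b::euclidean_space"
  assumes "(f has_derivative f') (at x)"
  shows "f' v = (\<Sum>b\<in>Basis. (v \<bullet> b) *\<^sub>R f' b)"
proof -
  interpret bounded_linear f' using assms by (rule has_derivative_bounded_linear)
  have "f' v = f' (\<Sum>b\<in>Basis. (v \<bullet> b) *\<^sub>R b)" by (simp add: euclidean_representation)
  then show ?thesis by (simp add: sum scaleR)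
qed

lemma kdiff_compose:
  fixes g :: "'b::euclidean_space \<Rightarrow> 'c::euclidean_space"
  assumes "open U" "open V" "kdiff k V f" "kdiff k U g" "g ` U \<subseteq> V"
  shows "kdiff k U (\<lambda>x. f (g x))"
  using assms(3,4)
proof (induction k arbitrary: f)
  case 0
  have "(\<lambda>x. f (g x)) differentiable (at x)" if x: "x \<in> U" for x
  proof -
    have "g x \<in> V" using assms(5) x by auto
    then show ?thesis
      using has_derivative_compose[OF kdiff_has_derivative[OF 0(2) assms(1) x] kdiff_has_derivative[OF 0(1) assms(2)]]
      unfolding differentiable_def by blast
  qed
  then show ?case by (simp add: differentiable_at_imp_differentiable_on)
next
  case (Suc k)
  have gV: "g x \<in> V" if "x \<in> U" for x using assms(5) that by auto
  show ?case
  proof (rule kdiff_derivI[OF assms(1)])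
    fix x assume x: "x \<in> U"
    have df: "(f has_derivative frechet_derivative f (at (g x))) (at (g x))"
      using kdiff_has_derivative[OF Suc.prems(1) assms(2) gV[OF x]] .
    show "((\<lambda>x. f (g x)) has_derivative
      (\<lambda>v. \<Sum>b\<in>Basis. (frechet_derivative g (at x) v \<bullet> b) *\<^sub>R frechet_derivative f (at (g x)) b)) (at x)"
      by (rule has_derivative_eq_rhs[OF has_derivative_compose[OF kdiff_has_derivative[OF Suc.prems(2) assms(1) x] df]])
        (rule ext, rule has_derivative_componentwise_sum[OF df])
  next
    fix v
    show "kdiff k U (\<lambda>x. \<Sum>b\<in>Basis. (frechet_derivative g (at x) v \<bullet> b) *\<^sub>R frechet_derivative f (at (g x)) b)"
    proof (intro kdiff_sum kdiff_scaleR assms(1))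
      fix b :: 'c
      show "kdiff k U (\<lambda>x. frechet_derivative g (at x) v \<bullet> b)"
        using Suc.prems(2) by (intro kdiff_bounded_linear_compose[OF bounded_linear_inner_left assms(1)]) auto
      show "kdiff k U (\<lambda>x. frechet_derivative f (at (g x)) b)"
        using Suc.prems kdiff_Suc_imp[OF Suc.prems(2)] by (intro Suc.IH) auto
    qed
  qed
qed

lemma smooth_on_has_derivative:
  "smooth_on U f \<Longrightarrow> open U \<Longrightarrow> x \<in> U \<Longrightarrow> (f has_derivative frechet_derivative f (at x)) (at x)"
  unfolding smooth_on_iff_kdiff using kdiff_has_derivative by blast

lemma smooth_on_continuous_on: "smooth_on U f \<Longrightarrow> continuous_on U f"
  unfolding smooth_on_iff_kdiff by (meson differentiable_imp_continuous_on kdiff.simps(1))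

lemma smooth_on_frechet_derivative:
  "smooth_on U f \<Longrightarrow> smooth_on U (\<lambda>x. frechet_derivative f (at x) v)"
  unfolding smooth_on_iff_kdiff using kdiff.simps(2) by blast

lemma smooth_on_cong:
  "open U \<Longrightarrow> smooth_on U f \<Longrightarrow> (\<And>x. x \<in> U \<Longrightarrow> g x = f x) \<Longrightarrow> smooth_on U g"
  unfolding smooth_on_iff_kdiff using kdiff_cong by blast

lemma smooth_on_subset: "smooth_on U f \<Longrightarrow> V \<subseteq> U \<Longrightarrow> smooth_on V f"
  unfolding smooth_on_iff_kdiff using kdiff_subset by blast

lemma smooth_on_local:
  "(\<And>x. x \<in> U \<Longrightarrow> \<exists>V. open V \<and> x \<in> V \<and> smooth_on V f) \<Longrightarrow> smooth_on U f"
  unfolding smooth_on_iff_kdiff using kdiff_local by meson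

lemma smooth_on_const: "open U \<Longrightarrow> smooth_on U (\<lambda>x. c)"
  unfolding smooth_on_iff_kdiff using kdiff_const by blast

lemma smooth_on_bounded_linear: "open U \<Longrightarrow> bounded_linear L \<Longrightarrow> smooth_on U L"
  unfolding smooth_on_iff_kdiff using kdiff_bounded_linear by blast

lemma smooth_on_add:
  "open U \<Longrightarrow> smooth_on U f \<Longrightarrow> smooth_on U g \<Longrightarrow> smooth_on U (\<lambda>x. f x + g x)"
  unfolding smooth_on_iff_kdiff using kdiff_add by blast

lemma smooth_on_sum:
  "open U \<Longrightarrow> (\<And>i. i \<in> I \<Longrightarrow> smooth_on U (f i)) \<Longrightarrow> smooth_on U (\<lambda>x. \<Sum>i\<in>I. f i x)"
  unfolding smooth_on_iff_kdiff by (intro allI kdiff_sum) simp_all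

lemma smooth_on_mult:
  fixes f g :: "'b::euclidean_space \<Rightarrow> real"
  shows "open U \<Longrightarrow> smooth_on U f \<Longrightarrow> smooth_on U g \<Longrightarrow> smooth_on U (\<lambda>x. f x * g x)"
  unfolding smooth_on_iff_kdiff using kdiff_scaleR[of U _ f g] by simp

lemma smooth_on_diff:
  fixes f g :: "'b::euclidean_space \<Rightarrow> real"
  assumes "open U" "smooth_on U f" "smooth_on U g"
  shows "smooth_on U (\<lambda>x. f x - g x)"
  using smooth_on_add[OF assms(1,2) smooth_on_mult[OF assms(1) smooth_on_const[OF assms(1), of "-1"] assms(3)]]
  by simp

lemma smooth_on_compose:
  fixes g :: "'b::euclidean_space \<Rightarrow> 'c::euclidean_space"
  assumes "open U" "open V" "smooth_on V f" "smooth_on U g" "g ` U \<subseteq> V"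
  shows "smooth_on U (\<lambda>x. f (g x))"
  using assms kdiff_compose[OF assms(1,2) _ _ assms(5)] unfolding smooth_on_iff_kdiff by blast

section \<open>Flat functions and bump functions\<close>

definition flat :: "real poly \<Rightarrow> real \<Rightarrow> real" where
  "flat p t = (if t > 0 then poly p (1 / t) * exp (- 1 / t) else 0)"

lemma poly_times_exp_minus_tendsto_0: "((\<lambda>y. poly p y * exp (- y)) \<longlongrightarrow> (0::real)) at_top"
proof -
  have "((\<lambda>y. \<Sum>i\<le>degree p. coeff p i * (y ^ i / exp y)) \<longlongrightarrow> (\<Sum>i\<le>degree p. coeff p i * 0)) at_top"
    by (intro tendsto_intros tendsto_power_div_exp_0)
  then show ?thesis
    by (simp add: poly_altdef sum_divide_distrib exp_minus field_simps)
qed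

text \<open>With y = 1/t, the t-derivative of p(y) exp(-y) is y^2 (p(y) - p'(y)) exp(-y), and
  \<open>[:0, 0, 1:]\<close> is the polynomial y^2. The family is thus closed under differentiation,
  and one induction on the order, with \<open>p\<close> arbitrary, gives smoothness.\<close>

lemma flat_has_derivative:
  "(flat p has_real_derivative flat ((p - pderiv p) * [:0, 0, 1:]) t) (at t)"
proof (cases t "0::real" rule: linorder_cases)
  case less
  have "((\<lambda>_. 0) has_real_derivative 0) (at t)" by simp
  then have "(flat p has_real_derivative 0) (at t)"
    by (rule has_field_derivative_transform_within_open[where S = "{..<0}"]) (use less in \<open>auto simp: flat_def\<close>)
  then show ?thesis using less by (simp add: flat_def)
next
  case greater
  have "((\<lambda>t. poly p (1 / t) * exp (- 1 / t)) has_real_derivative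
      poly ((p - pderiv p) * [:0, 0, 1:]) (1 / t) * exp (- 1 / t)) (at t)"
    using greater
    by (auto intro!: derivative_eq_intros DERIV_chain2[OF poly_DERIV] simp: field_simps power2_eq_square)
  then have "(flat p has_real_derivative poly ((p - pderiv p) * [:0, 0, 1:]) (1 / t) * exp (- 1 / t)) (at t)"
    by (rule has_field_derivative_transform_within_open[where S = "{0<..}"]) (use greater in \<open>auto simp: flat_def\<close>)
  then show ?thesis using greater by (simp add: flat_def)
next
  case equal
  \<comment> \<open>For t > 0 the difference quotient at 0 is again a polynomial in 1/t times
    exp(-1/t), the polynomial being \<open>p\<close> times the variable, so it tends to 0.\<close>
  have "((\<lambda>t. flat p t / t) \<longlongrightarrow> 0) (at_right 0)"
  proof (rule Lim_transform_eventually)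
    show "((\<lambda>t. poly (p * [:0, 1:]) (inverse t) * exp (- inverse t)) \<longlongrightarrow> 0) (at_right 0)"
      using filterlim_compose[OF poly_times_exp_minus_tendsto_0 filterlim_inverse_at_top_right] .
    show "\<forall>\<^sub>F t in at_right 0. poly (p * [:0, 1:]) (inverse t) * exp (- inverse t) = flat p t / t"
      unfolding eventually_at_right_field by (intro exI[of _ 1]) (auto simp: flat_def field_simps)
  qed
  moreover have "((\<lambda>t. flat p t / t) \<longlongrightarrow> 0) (at_left 0)"
  proof (rule Lim_transform_eventually[OF tendsto_const])
    show "\<forall>\<^sub>F t in at_left 0. 0 = flat p t / t"
      unfolding eventually_at_left_field by (intro exI[of _ "-1"]) (auto simp: flat_def)
  qed
  ultimately have "((\<lambda>t. flat p t / t) \<longlongrightarrow> 0) (at 0)"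
    by (simp add: filterlim_split_at)
  then show ?thesis
    using equal by (simp add: has_field_derivative_iff flat_def)
qed

lemma smooth_on_flat: "smooth_on UNIV (flat p)"
proof -
  have "kdiff k UNIV (flat p)" for k
  proof (induction k arbitrary: p)
    case 0
    then show ?case
      using flat_has_derivative[THEN has_field_derivative_imp_has_derivative]
      by (simp add: differentiable_on_def differentiable_def) blast
  next
    case (Suc k)
    show ?case
      by (rule kdiff_derivI[OF open_UNIV flat_has_derivative[THEN has_field_derivative_imp_has_derivative]])
        (intro kdiff_bounded_linear_compose[OF bounded_linear_mult_left] Suc open_UNIV)
  qed
  then show ?thesis by (simp add: smooth_on_iff_kdiff)
qed

text \<open>Feeding the flat function into itself produces a smooth step without any division of
  functions: the inner value \<open>flat 1 t\<close> vanishes for \<open>t \<le> 0\<close> and is at least \<open>exp (-1)\<close> for \<open>t \<ge> 1\<close>.\<close>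

lemma smooth_step_exists:
  obtains \<sigma> :: "real \<Rightarrow> real" where "smooth_on UNIV \<sigma>" "\<And>t. t \<le> 0 \<Longrightarrow> \<sigma> t = 1" "\<And>t. t \<ge> 1 \<Longrightarrow> \<sigma> t = 0"
proof
  let ?\<sigma> = "\<lambda>t. flat [:1 / flat 1 (exp (-1)):] (exp (-1) - flat 1 t)"
  show "smooth_on UNIV ?\<sigma>"
    by (intro smooth_on_compose[OF _ _ smooth_on_flat] smooth_on_diff smooth_on_const smooth_on_flat) auto
  show "?\<sigma> t = 1" if "t \<le> 0" for t using that by (simp add: flat_def)
  show "?\<sigma> t = 0" if "t \<ge> 1" for t using that by (simp add: flat_def field_simps)
qed

lemma bump_exists:
  fixes q0 :: "'b::euclidean_space"
  assumes "0 < r"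
  obtains \<beta> :: "'b \<Rightarrow> real" where "smooth_on UNIV \<beta>"
    "\<And>q. dist q0 q \<le> r / 2 \<Longrightarrow> \<beta> q = 1" "\<And>q. dist q0 q \<ge> r \<Longrightarrow> \<beta> q = 0"
proof -
  obtain \<sigma> :: "real \<Rightarrow> real" where \<sigma>: "smooth_on UNIV \<sigma>" "\<And>t. t \<le> 0 \<Longrightarrow> \<sigma> t = 1" "\<And>t. t \<ge> 1 \<Longrightarrow> \<sigma> t = 0"
    using smooth_step_exists by blast
  \<comment> \<open>The squared distance, spelled out as a sum of products so that the closure rules
    yield its smoothness; the distance itself is not smooth at \<open>q0\<close>.\<close>
  define N where "N q = (\<Sum>b\<in>Basis. (q \<bullet> b - q0 \<bullet> b) * (q \<bullet> b - q0 \<bullet> b))" for q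
  have N: "N q = (dist q0 q)\<^sup>2" for q
    unfolding N_def dist_norm power2_norm_eq_inner
    by (subst euclidean_inner) (simp add: inner_diff_left algebra_simps)
  \<comment> \<open>The affine rescaling sends r^2/4 to 0 and r^2 to 1, the two thresholds of
    \<sigma>.\<close>
  define \<beta> where "\<beta> q = \<sigma> ((4 / (3 * r\<^sup>2)) * (N q - r\<^sup>2 / 4))" for q
  show ?thesis
  proof
    have "smooth_on UNIV N"
      unfolding N_def
      by (intro smooth_on_sum smooth_on_mult smooth_on_diff smooth_on_const open_UNIV
          smooth_on_bounded_linear bounded_linear_inner_left)
    then show "smooth_on UNIV \<beta>"
      unfolding \<beta>_def
      by (intro smooth_on_compose[OF _ _ \<sigma>(1)] smooth_on_mult smooth_on_diff smooth_on_const) auto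
    show "\<beta> q = 1" if "dist q0 q \<le> r / 2" for q
    proof -
      have "(dist q0 q)\<^sup>2 \<le> (r / 2)\<^sup>2" using that by (intro power_mono) auto
      then show ?thesis
        unfolding \<beta>_def N by (intro \<sigma>(2) mult_nonneg_nonpos) (auto simp: power_divide)
    qed
    show "\<beta> q = 0" if "dist q0 q \<ge> r" for q
    proof -
      have "r\<^sup>2 \<le> (dist q0 q)\<^sup>2" using that assms by (intro power_mono) auto
      then have "4 / (3 * r\<^sup>2) * (3 / 4 * r\<^sup>2) \<le> 4 / (3 * r\<^sup>2) * ((dist q0 q)\<^sup>2 - r\<^sup>2 / 4)"
        by (intro mult_left_mono) auto
      then show ?thesis
        unfolding \<beta>_def N using assms by (intro \<sigma>(3)) (simp add: field_simps)
    qed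
  qed
qed

section \<open>Integrals along rays and Hadamard's lemma\<close>

definition ray_integral :: "'b::euclidean_space \<Rightarrow> nat \<Rightarrow> ('b \<Rightarrow> real) \<Rightarrow> 'b \<Rightarrow> real" where
  "ray_integral q0 k H q = integral (cbox 0 1) (\<lambda>t. t ^ k * H (q0 + t *\<^sub>R (q - q0)))"

lemma ray_in_ball:
  assumes "q \<in> ball q0 r" "t \<in> cbox 0 (1::real)"
  shows "q0 + t *\<^sub>R (q - q0) \<in> ball (q0::'b::euclidean_space) r"
proof -
  have "q0 + t *\<^sub>R (q - q0) = (1 - t) *\<^sub>R q0 + t *\<^sub>R q" by (simp add: algebra_simps)
  moreover have "q0 \<in> ball q0 r" using assms(1) by (metis centre_in_ball dist_self le_less_trans mem_ball zero_le_dist)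
  ultimately show ?thesis
    using convexD[OF convex_ball, of q0 q0 r q "1 - t" t] assms by auto
qed

lemma continuous_on_ray:
  fixes q0 :: "'b::euclidean_space"
  assumes "continuous_on (ball q0 r) H"
  shows "continuous_on (ball q0 r \<times> cbox 0 (1::real)) (\<lambda>z. H (q0 + snd z *\<^sub>R (fst z - q0)))"
proof (rule continuous_on_compose2[OF assms])
  show "continuous_on (ball q0 r \<times> cbox 0 (1::real)) (\<lambda>z. q0 + snd z *\<^sub>R (fst z - q0))"
    by (intro continuous_intros)
  show "(\<lambda>z. q0 + snd z *\<^sub>R (fst z - q0)) ` (ball q0 r \<times> cbox 0 1) \<subseteq> ball q0 r"
    using ray_in_ball by fastforce
qed

lemma ray_integrable:
  fixes H :: "'b::euclidean_space \<Rightarrow> real"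
  assumes "continuous_on (ball q0 r) H" "q \<in> ball q0 r"
  shows "(\<lambda>t. t ^ k * H (q0 + t *\<^sub>R (q - q0))) integrable_on cbox 0 1"
  by (intro integrable_continuous continuous_intros continuous_on_compose2[OF assms(1)])
    (use ray_in_ball[OF assms(2)] in auto)

text \<open>Differentiation under the integral sign releases one factor t from the inner argument,
  which the weight \<open>t ^ k\<close> absorbs; so the family of ray integrals is closed under
  differentiation. \<open>leibniz_rule\<close> works with derivatives as bounded linear functions,
  hence \<open>Blinfun\<close>, which is meaningful only where \<open>H\<close> is
  differentiable.\<close>

lemma ray_integral_has_derivative:
  fixes H :: "'b::euclidean_space \<Rightarrow> real"
  assumes H: "smooth_on (ball q0 r) H" and q: "q \<in> ball q0 r"
  shows "(ray_integral q0 k H has_derivative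
    (\<lambda>v. ray_integral q0 (Suc k) (\<lambda>x. frechet_derivative H (at x) v) q)) (at q)"
proof -
  define fx where "fx x t = t ^ Suc k *\<^sub>R Blinfun (frechet_derivative H (at (q0 + t *\<^sub>R (x - q0))))" for x t
  have der: "(H has_derivative frechet_derivative H (at (q0 + t *\<^sub>R (x - q0)))) (at (q0 + t *\<^sub>R (x - q0)))"
    if "x \<in> ball q0 r" "t \<in> cbox 0 1" for x t
    using smooth_on_has_derivative[OF H open_ball ray_in_ball[OF that]] .
  have fx: "blinfun_apply (fx x t) = (\<lambda>v. t ^ Suc k * frechet_derivative H (at (q0 + t *\<^sub>R (x - q0))) v)"
    if "x \<in> ball q0 r" "t \<in> cbox 0 1" for x t
    unfolding fx_def
    by (rule ext) (simp add: blinfun.scaleR_left bounded_linear_Blinfun_apply has_derivative_bounded_linear[OF der[OF that]])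
  have cont: "continuous_on (ball q0 r \<times> cbox 0 1) (\<lambda>z. fx (fst z) (snd z))"
  proof (rule continuous_on_blinfun_componentwise)
    fix i :: 'b assume "i \<in> Basis"
    have "continuous_on (ball q0 r \<times> cbox 0 1)
        (\<lambda>z. snd z ^ Suc k * frechet_derivative H (at (q0 + snd z *\<^sub>R (fst z - q0))) i)"
      by (intro continuous_intros continuous_on_ray[of q0 r "\<lambda>x. frechet_derivative H (at x) i"]
          smooth_on_continuous_on smooth_on_frechet_derivative H)
    then show "continuous_on (ball q0 r \<times> cbox 0 1) (\<lambda>z. blinfun_apply (fx (fst z) (snd z)) i)"
      by (rule continuous_on_eq) (auto simp: fx)
  qed
  have cont1: "continuous_on (cbox 0 1) (fx q)"
  proof -
    have "continuous_on (cbox 0 1) (\<lambda>t. (q, t))" by (intro continuous_intros)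
    from continuous_on_compose2[OF cont this] q show ?thesis by (simp add: image_subset_iff)
  qed
  have "((\<lambda>x. integral (cbox 0 1) (\<lambda>t. t ^ k * H (q0 + t *\<^sub>R (x - q0)))) has_derivative
      blinfun_apply (integral (cbox 0 1) (fx q))) (at q within ball q0 r)"
  proof (rule leibniz_rule)
    fix x t assume xt: "x \<in> ball q0 r" "t \<in> cbox 0 (1::real)"
    interpret bounded_linear "frechet_derivative H (at (q0 + t *\<^sub>R (x - q0)))"
      using has_derivative_bounded_linear[OF der[OF xt]] .
    have "((\<lambda>x. t ^ k * H (q0 + t *\<^sub>R (x - q0))) has_derivative
        (\<lambda>v. t ^ k * frechet_derivative H (at (q0 + t *\<^sub>R (x - q0))) (t *\<^sub>R v))) (at x)"
      by (intro has_derivative_mult_right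
          has_derivative_compose[where f = "\<lambda>x. q0 + t *\<^sub>R (x - q0)", OF _ der[OF xt]])
        (auto intro!: derivative_eq_intros)
    then show "((\<lambda>x. t ^ k * H (q0 + t *\<^sub>R (x - q0))) has_derivative blinfun_apply (fx x t)) (at x within ball q0 r)"
      unfolding fx[OF xt] by - (rule has_derivative_at_withinI, simp only: scaleR real_scaleR_def power_Suc mult_ac)
  next
    show "(\<lambda>t. t ^ k * H (q0 + t *\<^sub>R (x - q0))) integrable_on cbox 0 1" if "x \<in> ball q0 r" for x
      by (rule ray_integrable[OF smooth_on_continuous_on[OF H] that])
  qed (use cont q in \<open>auto simp: split_def\<close>)
  then have h1: "(ray_integral q0 k H has_derivative blinfun_apply (integral (cbox 0 1) (fx q))) (at q)"
    unfolding ray_integral_def[abs_def] using q by (simp add: at_within_open[OF _ open_ball])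
  have h2: "blinfun_apply (integral (cbox 0 1) (fx q)) v
      = ray_integral q0 (Suc k) (\<lambda>x. frechet_derivative H (at x) v) q" for v
  proof -
    have "blinfun_apply (integral (cbox 0 1) (fx q)) v = integral (cbox 0 1) (\<lambda>t. blinfun_apply (fx q t) v)"
      using integral_linear[OF integrable_continuous[OF cont1], of "\<lambda>L. blinfun_apply L v"]
      by (simp add: o_def bounded_linear_intros)
    also have "\<dots> = integral (cbox 0 1) (\<lambda>t. t ^ Suc k * frechet_derivative H (at (q0 + t *\<^sub>R (q - q0))) v)"
      by (rule integral_cong) (simp only: fx[OF q])
    finally show ?thesis by (simp add: ray_integral_def)
  qed
  show ?thesis by (rule has_derivative_eq_rhs[OF h1]) (rule ext, rule h2)
qed

lemma smooth_on_ray_integral: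
  fixes H :: "'b::euclidean_space \<Rightarrow> real"
  assumes "smooth_on (ball q0 r) H"
  shows "smooth_on (ball q0 r) (ray_integral q0 k H)"
proof -
  have "kdiff j (ball q0 r) (ray_integral q0 k H)" for j
    using assms
  proof (induction j arbitrary: k H)
    case 0
    have "ray_integral q0 k H differentiable_on ball q0 r"
      by (rule differentiable_at_imp_differentiable_on)
        (use ray_integral_has_derivative[OF 0] differentiable_def in blast)
    then show ?case by simp
  next
    case (Suc j)
    show ?case
      by (rule kdiff_derivI[OF open_ball ray_integral_has_derivative[OF Suc.prems]])
        (auto intro: Suc.IH smooth_on_frechet_derivative[OF Suc.prems])
  qed
  then show ?thesis by (simp add: smooth_on_iff_kdiff)
qed

text \<open>Integrate the derivative of \<open>F\<close> along the segment from \<open>q0\<close> to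
  \<open>q\<close>. Then \<open>G l\<close> is the mean of the l-th partial derivative over that
  segment, which makes it smooth at \<open>q0\<close> as well.\<close>

lemma Hadamard:
  fixes F :: "real^'n \<Rightarrow> real"
  assumes F: "smooth_on (ball q0 r) F" and r: "0 < r"
  obtains G where "\<And>l. smooth_on (ball q0 r) (G l)"
    "\<And>q. q \<in> ball q0 r \<Longrightarrow> F q = F q0 + (\<Sum>l\<in>UNIV. (q $ l - q0 $ l) * G l q)"
    "\<And>l. G l q0 = frechet_derivative F (at q0) (axis l 1)"
proof -
  define G where "G l = ray_integral q0 0 (\<lambda>x. frechet_derivative F (at x) (axis l 1))" for l
  show ?thesis
  proof
    show "smooth_on (ball q0 r) (G l)" for l
      unfolding G_def by (intro smooth_on_ray_integral smooth_on_frechet_derivative F)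
    show "G l q0 = frechet_derivative F (at q0) (axis l 1)" for l
      by (simp add: G_def ray_integral_def)
    fix q assume q: "q \<in> ball q0 r"
    have der: "(F has_derivative frechet_derivative F (at (q0 + t *\<^sub>R (q - q0)))) (at (q0 + t *\<^sub>R (q - q0)))"
      if "t \<in> cbox 0 1" for t
      using smooth_on_has_derivative[OF F open_ball ray_in_ball[OF q that]] .
    have "((\<lambda>t. frechet_derivative F (at (q0 + t *\<^sub>R (q - q0))) (q - q0)) has_integral
        F (q0 + 1 *\<^sub>R (q - q0)) - F (q0 + 0 *\<^sub>R (q - q0))) {0..1}"
    proof (rule fundamental_theorem_of_calculus)
      fix t :: real assume t: "t \<in> {0..1}"
      then have t': "t \<in> cbox 0 1" by simp
      interpret bounded_linear "frechet_derivative F (at (q0 + t *\<^sub>R (q - q0)))"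
        using has_derivative_bounded_linear[OF der[OF t']] .
      have "((\<lambda>t. F (q0 + t *\<^sub>R (q - q0))) has_derivative
        (\<lambda>s. frechet_derivative F (at (q0 + t *\<^sub>R (q - q0))) (s *\<^sub>R (q - q0)))) (at t)"
        by (rule has_derivative_compose[where f = "\<lambda>t. q0 + t *\<^sub>R (q - q0)", OF _ der[OF t']])
          (auto intro!: derivative_eq_intros)
      then show "((\<lambda>t. F (q0 + t *\<^sub>R (q - q0))) has_vector_derivative
          frechet_derivative F (at (q0 + t *\<^sub>R (q - q0))) (q - q0)) (at t within {0..1})"
        unfolding has_vector_derivative_def by - (rule has_derivative_at_withinI, simp only: scaleR)
    qed simp
    then have "F q - F q0 = integral {0..1} (\<lambda>t. frechet_derivative F (at (q0 + t *\<^sub>R (q - q0))) (q - q0))"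
      by (simp add: integral_unique)
    also have "\<dots> = integral {0..1} (\<lambda>t. \<Sum>l\<in>UNIV. (q $ l - q0 $ l) *
        (t ^ 0 * frechet_derivative F (at (q0 + t *\<^sub>R (q - q0))) (axis l 1)))"
    proof (rule integral_cong)
      fix t :: real assume "t \<in> {0..1}"
      then have t': "t \<in> cbox 0 1" by simp
      interpret bounded_linear "frechet_derivative F (at (q0 + t *\<^sub>R (q - q0)))"
        using has_derivative_bounded_linear[OF der[OF t']] .
      have "q - q0 = (\<Sum>l\<in>UNIV. (q $ l - q0 $ l) *\<^sub>R axis l 1)"
        by (subst basis_expansion[symmetric, of "q - q0"]) (simp add: scalar_mult_eq_scaleR)
      from arg_cong[OF this, of "frechet_derivative F (at (q0 + t *\<^sub>R (q - q0)))"]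
      show "frechet_derivative F (at (q0 + t *\<^sub>R (q - q0))) (q - q0) =
        (\<Sum>l\<in>UNIV. (q $ l - q0 $ l) * (t ^ 0 * frechet_derivative F (at (q0 + t *\<^sub>R (q - q0))) (axis l 1)))"
        by (simp only: sum scaleR real_scaleR_def power_0 mult_1)
    qed
    also have "\<dots> = (\<Sum>l\<in>UNIV. (q $ l - q0 $ l) * G l q)"
    proof (subst integral_sum)
      show "(\<lambda>t. (q $ l - q0 $ l) * (t ^ 0 * frechet_derivative F (at (q0 + t *\<^sub>R (q - q0))) (axis l 1)))
          integrable_on {0..1}" for l
        using integrable_on_cmult_left[OF ray_integrable[OF smooth_on_continuous_on[OF
              smooth_on_frechet_derivative[OF F]] q, of 0 "axis l 1"], of "q $ l - q0 $ l"]
        by (simp add: cbox_interval)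
    qed (auto simp: G_def ray_integral_def cbox_interval)
    finally show "F q = F q0 + (\<Sum>l\<in>UNIV. (q $ l - q0 $ l) * G l q)" by simp
  qed
qed

section \<open>Smooth functions and derivations on a manifold\<close>

locale manifold_atlas =
  fixes A :: "('a::topological_space set \<times> ('a \<Rightarrow> real^'n)) set"
  assumes smooth_manifold: "smooth_manifold A"
begin

lemma
  assumes "(U, \<phi>) \<in> A"
  shows chart_open: "open U"
    and chart_open_image: "open (\<phi> ` U)"
    and chart_homeomorphism: "homeomorphism U (\<phi> ` U) \<phi> (inv_into U \<phi>)"
proof -
  have "open U \<and> open (\<phi> ` U) \<and> (\<exists>\<psi>. homeomorphism U (\<phi> ` U) \<phi> \<psi>)"
    using smooth_manifold assms unfolding smooth_manifold_def smooth_atlas_def by blast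
  then obtain \<psi> where *: "open U" "open (\<phi> ` U)" "homeomorphism U (\<phi> ` U) \<phi> \<psi>" by blast
  then have "inj_on \<phi> U" by (metis homeomorphism_apply1 inj_onI)
  \<comment> \<open>The atlas grants some inverse, while smoothness is stated with
    \<open>inv_into\<close>; by injectivity the two agree on the chart image.\<close>
  then have "homeomorphism U (\<phi> ` U) \<phi> (inv_into U \<phi>)"
    by (intro homeomorphism_cong[OF *(3)]) (auto simp: homeomorphism_apply1[OF *(3)])
  with * show "open U" "open (\<phi> ` U)" "homeomorphism U (\<phi> ` U) \<phi> (inv_into U \<phi>)" by auto
qed

lemma
  assumes "(U, \<phi>) \<in> A"
  shows chart_continuous_on: "continuous_on U \<phi>"
    and chart_inv_continuous_on: "continuous_on (\<phi> ` U) (inv_into U \<phi>)"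
    and chart_inv: "p \<in> U \<Longrightarrow> inv_into U \<phi> (\<phi> p) = p"
    and chart_inj_on: "inj_on \<phi> U"
  using chart_homeomorphism[OF assms] by (auto simp: homeomorphism_def intro: inj_on_inverseI)

lemma chart_open_map:
  assumes "(U, \<phi>) \<in> A" "open Q"
  shows "open (\<phi> ` (U \<inter> Q))"
proof -
  have "openin (top_of_set (\<phi> ` U)) (\<phi> ` (U \<inter> Q))"
    using homeomorphism_imp_open_map[OF chart_homeomorphism[OF assms(1)]] assms(2) by auto
  then show ?thesis
    using chart_open_image[OF assms(1)] openin_open_trans by blast
qed

lemma chart_open_vimage: "(U, \<phi>) \<in> A \<Longrightarrow> open Q \<Longrightarrow> open (U \<inter> \<phi> -` Q)"
  using continuous_open_preimage[OF chart_continuous_on chart_open] by blast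

lemma chart_at: obtains U \<phi> where "(U, \<phi>) \<in> A" "p \<in> U"
proof -
  have "p \<in> \<Union>(fst ` A)"
    using smooth_manifold by (simp add: smooth_manifold_def smooth_atlas_def)
  then show ?thesis using that by auto
qed

lemma transition_smooth:
  "(U, \<phi>) \<in> A \<Longrightarrow> (V, \<psi>) \<in> A \<Longrightarrow> smooth_on (\<phi> ` (U \<inter> V)) (\<lambda>q. \<psi> (inv_into U \<phi> q))"
  using smooth_manifold unfolding smooth_manifold_def smooth_atlas_def o_def by blast

text \<open>The Hausdorff property is a clause of \<open>smooth_manifold\<close> and not a type
  class of \<open>'a\<close>, so the fact is obtained from abstract topology, applied to
  \<open>euclidean\<close>.\<close>

lemma compact_imp_closed_manifold:
  assumes "compact (K :: 'a set)" shows "closed K"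
proof -
  have "Hausdorff_space (euclidean :: 'a topology)"
    using smooth_manifold unfolding smooth_manifold_def Hausdorff_space_def by (auto simp: disjnt_def)
  then show ?thesis
    using compactin_imp_closedin[of "euclidean :: 'a topology" K] assms by simp
qed

lemma smooth_fun_on_chart:
  "f \<in> smooth_funs A \<Longrightarrow> (U, \<phi>) \<in> A \<Longrightarrow> smooth_on (\<phi> ` U) (\<lambda>q. f (inv_into U \<phi> q))"
  unfolding smooth_funs_def o_def by blast

lemma smooth_funsI:
  "(\<And>U \<phi>. (U, \<phi>) \<in> A \<Longrightarrow> smooth_on (\<phi> ` U) (\<lambda>q. f (inv_into U \<phi> q))) \<Longrightarrow> f \<in> smooth_funs A"
  unfolding smooth_funs_def o_def by blast

lemma smooth_funs_const: "(\<lambda>x. c) \<in> smooth_funs A"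
  by (intro smooth_funsI smooth_on_const chart_open_image)

lemma smooth_funs_add: "f \<in> smooth_funs A \<Longrightarrow> g \<in> smooth_funs A \<Longrightarrow> (\<lambda>x. f x + g x) \<in> smooth_funs A"
  by (rule smooth_funsI, rule smooth_on_add[OF chart_open_image]) (assumption | rule smooth_fun_on_chart)+

lemma smooth_funs_mult: "f \<in> smooth_funs A \<Longrightarrow> g \<in> smooth_funs A \<Longrightarrow> (\<lambda>x. f x * g x) \<in> smooth_funs A"
  by (rule smooth_funsI, rule smooth_on_mult[OF chart_open_image]) (assumption | rule smooth_fun_on_chart)+

lemma smooth_funs_diff: "f \<in> smooth_funs A \<Longrightarrow> g \<in> smooth_funs A \<Longrightarrow> (\<lambda>x. f x - g x) \<in> smooth_funs A"
  by (rule smooth_funsI, rule smooth_on_diff[OF chart_open_image]) (assumption | rule smooth_fun_on_chart)+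

lemma smooth_funs_scale: "f \<in> smooth_funs A \<Longrightarrow> (\<lambda>x. c * f x) \<in> smooth_funs A"
  by (intro smooth_funs_mult smooth_funs_const)

lemma smooth_funs_sum: "(\<And>i. i \<in> I \<Longrightarrow> f i \<in> smooth_funs A) \<Longrightarrow> (\<lambda>x. \<Sum>i\<in>I. f i x) \<in> smooth_funs A"
  by (rule smooth_funsI, rule smooth_on_sum[OF chart_open_image])
    (assumption | rule smooth_fun_on_chart | simp)+

lemma smooth_funs_continuous_on:
  assumes "f \<in> smooth_funs A" shows "continuous_on UNIV f"
proof -
  have "continuous_on (\<Union>(fst ` A)) f"
  proof (rule continuous_on_open_Union)
    fix U assume "U \<in> fst ` A"
    then obtain \<phi> where U: "(U, \<phi>) \<in> A" by auto
    show "open U" by (rule chart_open[OF U])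
    have "continuous_on U (\<lambda>y. f (inv_into U \<phi> (\<phi> y)))"
      using continuous_on_compose2[OF smooth_on_continuous_on[OF smooth_fun_on_chart[OF assms U]]
          chart_continuous_on[OF U]] by blast
    then show "continuous_on U f"
      by (rule continuous_on_eq) (simp add: chart_inv[OF U])
  qed
  moreover have "\<Union>(fst ` A) = UNIV"
    using smooth_manifold by (simp add: smooth_manifold_def smooth_atlas_def)
  ultimately show ?thesis by simp
qed

text \<open>Multiply \<open>G\<close> by a bump of radius r/2, equal to 1 up to r/4, and continue by
  0. The support lies in \<open>K\<close>, which is compact and hence, by the Hausdorff axiom,
  closed. So every point has a neighbourhood inside the chart region, where the product formula
  holds, or one in the complement of \<open>K\<close>, where the function is 0.\<close>

lemma smooth_extension:
  fixes G :: "real^'n \<Rightarrow> real"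
  assumes U: "(U, \<phi>) \<in> A" and r: "0 < r" "ball q0 r \<subseteq> \<phi> ` U" and G: "smooth_on (ball q0 r) G"
  obtains F where "F \<in> smooth_funs A" "\<And>p. p \<in> U \<Longrightarrow> dist q0 (\<phi> p) \<le> r / 4 \<Longrightarrow> F p = G (\<phi> p)"
    "\<And>p. \<not> (p \<in> U \<and> \<phi> p \<in> ball q0 r) \<Longrightarrow> F p = 0"
proof -
  obtain \<beta> :: "real^'n \<Rightarrow> real" where \<beta>: "smooth_on UNIV \<beta>"
    "\<And>q. dist q0 q \<le> r / 2 / 2 \<Longrightarrow> \<beta> q = 1" "\<And>q. dist q0 q \<ge> r / 2 \<Longrightarrow> \<beta> q = 0"
    using bump_exists[of "r / 2" q0] r(1) by auto
  define F where "F p = (if p \<in> U then \<beta> (\<phi> p) * G (\<phi> p) else 0)" for p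
  define K where "K = inv_into U \<phi> ` cball q0 (r / 2)"
  have sub: "cball q0 (r / 2) \<subseteq> \<phi> ` U" using r by auto
  have "compact K"
    unfolding K_def
    by (intro compact_continuous_image continuous_on_subset[OF chart_inv_continuous_on[OF U] sub] compact_cball)
  then have "closed K" by (rule compact_imp_closed_manifold)
  have F0: "F p = 0" if "p \<notin> K" for p
  proof (cases "p \<in> U")
    case True
    then have "\<phi> p \<notin> cball q0 (r / 2)"
      using that chart_inv[OF U True] unfolding K_def by (metis imageI)
    then show ?thesis using \<beta>(3) by (simp add: F_def)
  qed (simp add: F_def)
  have "F \<in> smooth_funs A"
  proof (rule smooth_funsI, rule smooth_on_local)
    fix V \<psi> q
    assume V: "(V, \<psi>) \<in> A" and "q \<in> \<psi> ` V"
    then obtain p where p: "p \<in> V" "q = \<psi> p" by auto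
    show "\<exists>W. open W \<and> q \<in> W \<and> smooth_on W (\<lambda>q. F (inv_into V \<psi> q))"
    proof (cases "p \<in> U \<and> \<phi> p \<in> ball q0 r")
      case True
      let ?W = "\<psi> ` (V \<inter> (U \<inter> \<phi> -` ball q0 r))"
      have "open ?W" by (intro chart_open_map V chart_open_vimage U open_ball)
      moreover have "q \<in> ?W" using p True by auto
      moreover have "smooth_on ?W (\<lambda>q. F (inv_into V \<psi> q))"
      proof (rule smooth_on_cong[OF \<open>open ?W\<close>])
        show "smooth_on ?W (\<lambda>q. \<beta> (\<phi> (inv_into V \<psi> q)) * G (\<phi> (inv_into V \<psi> q)))"
        proof (intro smooth_on_mult \<open>open ?W\<close>)
          have t: "smooth_on ?W (\<lambda>q. \<phi> (inv_into V \<psi> q))"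
            by (rule smooth_on_subset[OF transition_smooth[OF V U]]) auto
          show "smooth_on ?W (\<lambda>q. \<beta> (\<phi> (inv_into V \<psi> q)))"
            by (rule smooth_on_compose[OF \<open>open ?W\<close> open_UNIV \<beta>(1) t]) auto
          show "smooth_on ?W (\<lambda>q. G (\<phi> (inv_into V \<psi> q)))"
            by (rule smooth_on_compose[OF \<open>open ?W\<close> open_ball G t]) (auto simp: chart_inv[OF V])
        qed
      qed (auto simp: F_def chart_inv[OF V])
      ultimately show ?thesis by blast
    next
      case False
      have "p \<notin> K"
      proof
        assume "p \<in> K"
        then obtain z where z: "z \<in> cball q0 (r / 2)" "p = inv_into U \<phi> z" unfolding K_def by auto
        then have "z \<in> \<phi> ` U" using sub by auto
        then have "p \<in> U" "\<phi> p = z" using z by (auto simp: inv_into_into f_inv_into_f)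
        with z(1) r(1) False show False by auto
      qed
      let ?W = "\<psi> ` (V \<inter> - K)"
      have "open ?W" by (intro chart_open_map V) (use \<open>closed K\<close> in auto)
      moreover have "q \<in> ?W" using p \<open>p \<notin> K\<close> by auto
      moreover have "smooth_on ?W (\<lambda>q. F (inv_into V \<psi> q))"
        by (rule smooth_on_cong[OF \<open>open ?W\<close> smooth_on_const[OF \<open>open ?W\<close>, of 0]])
          (auto simp: chart_inv[OF V] F0)
      ultimately show ?thesis by blast
    qed
  qed
  moreover have "F p = G (\<phi> p)" if "p \<in> U" "dist q0 (\<phi> p) \<le> r / 4" for p
    using that \<beta>(2) by (simp add: F_def)
  moreover have "F p = 0" if "\<not> (p \<in> U \<and> \<phi> p \<in> ball q0 r)" for p
    using that \<beta>(3)[of "\<phi> p"] r(1) by (auto simp: F_def)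
  ultimately show ?thesis using that by blast
qed

end

section \<open>Locality of derivations and their form in coordinates\<close>

context manifold_atlas
begin

context
  fixes X :: "'a vfield"
  assumes X: "smooth_vector_field A X"
begin

lemma vector_field_smooth: "f \<in> smooth_funs A \<Longrightarrow> X f \<in> smooth_funs A"
  using X by (simp add: smooth_vector_field_def)

lemma vector_field_add:
  "f \<in> smooth_funs A \<Longrightarrow> g \<in> smooth_funs A \<Longrightarrow> X (\<lambda>x. f x + g x) = (\<lambda>x. X f x + X g x)"
  using X by (simp add: smooth_vector_field_def)

lemma vector_field_scale: "f \<in> smooth_funs A \<Longrightarrow> X (\<lambda>x. c * f x) = (\<lambda>x. c * X f x)"
  using X by (simp add: smooth_vector_field_def)

lemma vector_field_mult:
  "f \<in> smooth_funs A \<Longrightarrow> g \<in> smooth_funs A \<Longrightarrow> X (\<lambda>x. f x * g x) = (\<lambda>x. f x * X g x + g x * X f x)"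
  using X by (simp add: smooth_vector_field_def)

lemma vector_field_const: "X (\<lambda>x. c) = (\<lambda>x. 0)"
proof -
  have "X (\<lambda>x. 1) = (\<lambda>x. X (\<lambda>x. 1) x + X (\<lambda>x. 1) x)"
    using vector_field_mult[OF smooth_funs_const smooth_funs_const, of 1 1] by simp
  then have "X (\<lambda>x. 1) p = 0" for p by (simp add: fun_eq_iff)
  then show ?thesis
    using vector_field_scale[OF smooth_funs_const, of c 1] by simp
qed

lemma vector_field_diff:
  assumes "f \<in> smooth_funs A" "g \<in> smooth_funs A"
  shows "X (\<lambda>x. f x - g x) = (\<lambda>x. X f x - X g x)"
  using vector_field_add[OF assms(1) smooth_funs_scale[OF assms(2)], of "-1"]
    vector_field_scale[OF assms(2), of "-1"] by simp

lemma vector_field_sum: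
  assumes "\<And>i. i \<in> I \<Longrightarrow> f i \<in> smooth_funs A"
  shows "X (\<lambda>x. \<Sum>i\<in>I. f i x) = (\<lambda>x. \<Sum>i\<in>I. X (f i) x)"
  using assms
proof (induction I rule: infinite_finite_induct)
  case (insert i I)
  then show ?case
    using vector_field_add[of "f i" "\<lambda>x. \<Sum>i\<in>I. f i x"] smooth_funs_sum[of I f] by simp
qed (simp_all add: vector_field_const)

text \<open>For a bump b at p that vanishes off \<open>W\<close>, the product b (f - g) is
  identically 0. The product rule at p leaves X (f - g) p = 0, because b is 1 and f - g is 0
  there.\<close>

lemma vector_field_local:
  assumes fg: "f \<in> smooth_funs A" "g \<in> smooth_funs A" and W: "open W" "p \<in> W" "\<And>y. y \<in> W \<Longrightarrow> f y = g y"
  shows "X f p = X g p"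
proof -
  obtain U \<phi> where U: "(U, \<phi>) \<in> A" "p \<in> U" using chart_at .
  obtain r where r: "0 < r" "ball (\<phi> p) r \<subseteq> \<phi> ` (U \<inter> W)"
    using chart_open_map[OF U(1) W(1)] U(2) W(2) by (meson IntI image_eqI openE)
  then have rU: "ball (\<phi> p) r \<subseteq> \<phi> ` U" by auto
  obtain b where b: "b \<in> smooth_funs A" "\<And>y. y \<in> U \<Longrightarrow> dist (\<phi> p) (\<phi> y) \<le> r / 4 \<Longrightarrow> b y = 1"
    "\<And>y. \<not> (y \<in> U \<and> \<phi> y \<in> ball (\<phi> p) r) \<Longrightarrow> b y = 0"
    by (rule smooth_extension[OF U(1) r(1) rU smooth_on_const[OF open_ball, where c = 1]])
      (rule that, assumption, blast, blast)
  have d: "(\<lambda>x. f x - g x) \<in> smooth_funs A" by (rule smooth_funs_diff[OF fg])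
  have bd: "(\<lambda>y. b y * (f y - g y)) = (\<lambda>y. 0)"
  proof
    fix y
    show "b y * (f y - g y) = 0"
    proof (cases "y \<in> U \<and> \<phi> y \<in> ball (\<phi> p) r")
      case True
      then have "\<phi> y \<in> \<phi> ` (U \<inter> W)" using r by auto
      then have "y \<in> W" using True chart_inj_on[OF U(1)] by (auto dest: inj_onD)
      then show ?thesis using W(3) by simp
    qed (use b(3) in auto)
  qed
  have "X (\<lambda>x. 0) = (\<lambda>x. b x * X (\<lambda>x. f x - g x) x + (f x - g x) * X b x)"
    using vector_field_mult[OF b(1) d] unfolding bd .
  from fun_cong[OF this, of p] show ?thesis
    using b(2)[OF U(2)] r(1) W(2,3) by (simp add: vector_field_const vector_field_diff[OF fg])
qed

text \<open>Near p, Hadamard's lemma gives f = f p + sum over l of (c l - c l p) E l. The terms with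
  X (E l) drop out because their factors vanish at p, and E l p is the l-th partial derivative.
  Since X acts on globally smooth functions, the factors are replaced by global extensions
  \<open>E l\<close> and the chart coordinates by \<open>c l\<close>; locality makes this
  harmless.\<close>

lemma vector_field_in_chart:
  assumes U: "(U, \<phi>) \<in> A" "p \<in> U" and f: "f \<in> smooth_funs A"
    and c: "\<And>l. c l \<in> smooth_funs A" and W: "open W" "p \<in> W" "W \<subseteq> U" "\<And>l y. y \<in> W \<Longrightarrow> c l y = \<phi> y $ l"
  shows "X f p = (\<Sum>l\<in>UNIV. frechet_derivative (\<lambda>q. f (inv_into U \<phi> q)) (at (\<phi> p)) (axis l 1) * X (c l) p)"
proof -
  define F where "F q = f (inv_into U \<phi> q)" for q
  obtain r where r: "0 < r" "ball (\<phi> p) r \<subseteq> \<phi> ` (U \<inter> W)"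
    using chart_open_map[OF U(1) W(1)] U(2) W(2) by (meson IntI image_eqI openE)
  then have rU: "ball (\<phi> p) r \<subseteq> \<phi> ` U" by auto
  have "smooth_on (ball (\<phi> p) r) F"
    unfolding F_def by (rule smooth_on_subset[OF smooth_fun_on_chart[OF f U(1)] rU])
  then obtain G where G: "\<And>l. smooth_on (ball (\<phi> p) r) (G l)"
    "\<And>q. q \<in> ball (\<phi> p) r \<Longrightarrow> F q = F (\<phi> p) + (\<Sum>l\<in>UNIV. (q $ l - \<phi> p $ l) * G l q)"
    "\<And>l. G l (\<phi> p) = frechet_derivative F (at (\<phi> p)) (axis l 1)"
    using Hadamard[OF _ r(1)] by blast
  have "\<exists>E. E \<in> smooth_funs A \<and> (\<forall>y\<in>U. dist (\<phi> p) (\<phi> y) \<le> r / 4 \<longrightarrow> E y = G l (\<phi> y))" for l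
    using smooth_extension[OF U(1) r(1) rU G(1)] by metis
  then obtain E where E: "\<And>l. E l \<in> smooth_funs A"
    "\<And>l y. y \<in> U \<Longrightarrow> dist (\<phi> p) (\<phi> y) \<le> r / 4 \<Longrightarrow> E l y = G l (\<phi> y)"
    by metis
  define H where "H x = f p + (\<Sum>l\<in>UNIV. (c l x - \<phi> p $ l) * E l x)" for x
  have cd: "(\<lambda>x. c l x - \<phi> p $ l) \<in> smooth_funs A" for l
    by (intro smooth_funs_diff c smooth_funs_const)
  have prod: "(\<lambda>x. (c l x - \<phi> p $ l) * E l x) \<in> smooth_funs A" for l
    by (intro smooth_funs_mult cd E)
  then have sum: "(\<lambda>x. \<Sum>l\<in>UNIV. (c l x - \<phi> p $ l) * E l x) \<in> smooth_funs A"
    by (intro smooth_funs_sum)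
  have H: "H \<in> smooth_funs A"
    unfolding H_def by (intro smooth_funs_add smooth_funs_const sum)
  have "X f p = X H p"
  proof (rule vector_field_local[OF f H])
    show "open (W \<inter> (U \<inter> \<phi> -` ball (\<phi> p) (r / 4)))"
      by (intro open_Int W chart_open_vimage U open_ball)
    show "p \<in> W \<inter> (U \<inter> \<phi> -` ball (\<phi> p) (r / 4))" using W U r by auto
    fix y assume y: "y \<in> W \<inter> (U \<inter> \<phi> -` ball (\<phi> p) (r / 4))"
    then have "\<phi> y \<in> ball (\<phi> p) r" using r(1) by auto
    from G(2)[OF this] y show "f y = H y"
      using chart_inv[OF U(1)] U(2) by (simp add: F_def H_def E(2) W(4))
  qed
  also have "X H p = (\<Sum>l\<in>UNIV. X (\<lambda>x. (c l x - \<phi> p $ l) * E l x) p)"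
    unfolding H_def vector_field_add[OF smooth_funs_const sum] vector_field_sum[OF prod] vector_field_const by simp
  also have "\<dots> = (\<Sum>l\<in>UNIV. frechet_derivative F (at (\<phi> p)) (axis l 1) * X (c l) p)"
    using E(2)[OF U(2)] r(1)
    by (simp add: vector_field_mult[OF cd E(1)] vector_field_diff[OF c smooth_funs_const] vector_field_const W G(3))
  finally show ?thesis unfolding F_def .
qed

end

text \<open>The rank hypothesis is applied to these vectors: it makes each coordinate derivative at
  a point the value of a field in the Lie triple system.\<close>

lemma coordinate_derivation_in_tangent_space:
  assumes U: "(U, \<phi>) \<in> A" "p \<in> U"
  shows "restrict (\<lambda>f. frechet_derivative (\<lambda>q. f (inv_into U \<phi> q)) (at (\<phi> p)) v) (smooth_funs A) \<in> tangent_space A p"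
proof -
  have der: "((\<lambda>q. f (inv_into U \<phi> q)) has_derivative
      frechet_derivative (\<lambda>q. f (inv_into U \<phi> q)) (at (\<phi> p))) (at (\<phi> p))" if "f \<in> smooth_funs A" for f
    using smooth_on_has_derivative[OF smooth_fun_on_chart[OF that U(1)] chart_open_image[OF U(1)]] U(2) by blast
  show ?thesis
    unfolding tangent_space_def
    by (auto simp: smooth_funs_add smooth_funs_mult smooth_funs_scale chart_inv[OF U]
        frechet_derivative_eqI[OF has_derivative_add[OF der der]] frechet_derivative_eqI[OF has_derivative_mult[OF der der]]
        frechet_derivative_eqI[OF has_derivative_mult_right[OF der]])
qed

end

section \<open>Local flows\<close>

text \<open>Picard's contraction with the starting point as a variable of the unknown: the fixed
  point lives in the complete space of bounded continuous functions of (t, y), so joint continuity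
  comes with existence. The unknown is the displacement \<Phi> (t, y) - y with time clamped to
  [-h, h]; unlike \<Phi> it is bounded, by h M.\<close>

lemma bounded_lipschitz_flow:
  fixes V :: "'b::euclidean_space \<Rightarrow> 'b"
  assumes lip: "\<And>x y. norm (V x - V y) \<le> L * norm (x - y)" and bd: "\<And>x. norm (V x) \<le> M"
  obtains h and \<Phi> :: "real \<times> 'b \<Rightarrow> 'b" where "0 < h" "continuous_on UNIV \<Phi>" "\<And>y. \<Phi> (0, y) = y"
    "\<And>t y. \<bar>t\<bar> < h \<Longrightarrow> ((\<lambda>s. \<Phi> (s, y)) has_vector_derivative V (\<Phi> (t, y))) (at t)"
proof -
  \<comment> \<open>Chosen so that h |L| is at most 1/2, the contraction factor below.\<close>
  define h where "h = 1 / (2 * (\<bar>L\<bar> + 1))"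
  have h: "0 < h" "h * \<bar>L\<bar> \<le> 1 / 2" by (auto simp: h_def field_simps)
  have lip': "norm (V x - V y) \<le> \<bar>L\<bar> * norm (x - y)" for x y
    using lip[of x y] by (smt (verit) mult_right_mono norm_ge_zero)
  have contV: "continuous_on S V" for S
  proof (rule lipschitz_on_continuous_on)
    show "\<bar>L\<bar>-lipschitz_on S V" using lip' by (intro lipschitz_onI) (auto simp: dist_norm)
  qed
  define c where "c t = max (- h) (min h t)" for t :: real
  have c: "\<bar>c t\<bar> \<le> h" for t using h by (auto simp: c_def)
  have contc: "continuous_on S c" for S unfolding c_def by (intro continuous_intros)
  \<comment> \<open>A substitution writes the integral from 0 to t as t times an integral over
    [0, 1]. This treats both signs of t alike and leaves a parameter integral over a fixed
    domain.\<close>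
  define I where "I G z = integral (cbox 0 1) (\<lambda>\<sigma>. V (snd z + apply_bcontfun G (\<sigma> * c (fst z), snd z)))"
    for G :: "(real \<times> 'b) \<Rightarrow>\<^sub>C 'b" and z
  have contG: "continuous_on S (\<lambda>x. apply_bcontfun G (f x))" if "continuous_on S f"
    for G :: "(real \<times> 'b) \<Rightarrow>\<^sub>C 'b" and f :: "'z::topological_space \<Rightarrow> real \<times> 'b" and S
    by (rule continuous_on_compose2[OF continuous_on_apply_bcontfun that]) auto
  have contc2: "continuous_on S (\<lambda>x. c (f x))" if "continuous_on S f"
    for f :: "'z::topological_space \<Rightarrow> real" and S
    by (rule continuous_on_compose2[OF contc[of UNIV] that]) auto
  have cont1: "continuous_on S (\<lambda>z. V (snd (fst z) + apply_bcontfun G (snd z * c (fst (fst z)), snd (fst z))))"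
    for G and S :: "((real \<times> 'b) \<times> real) set"
    by (intro continuous_on_compose2[OF contV[of UNIV]] continuous_intros contG contc2) auto
  have cont2: "continuous_on {0..1} (\<lambda>\<sigma>. V (snd z + apply_bcontfun G (\<sigma> * c (fst z), snd z)))" for G z
    by (intro continuous_on_compose2[OF contV[of UNIV]] continuous_intros contG) auto
  have contI: "continuous_on UNIV (I G)" for G
    unfolding I_def using cont1[of "UNIV \<times> cbox 0 1" G]
    by (intro integral_continuous_on_param) (simp add: split_def)
  have normI: "norm (I G z) \<le> M" for G z
    using integral_bound[OF zero_le_one cont2[of z G], of M] bd by (simp add: I_def cbox_interval)
  have M: "0 \<le> M" using bd[of 0] by (meson norm_ge_zero order_trans)
  have bc: "(\<lambda>z. c (fst z) *\<^sub>R I G z) \<in> bcontfun" for G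
  proof (rule bcontfun_normI)
    show "continuous_on UNIV (\<lambda>z. c (fst z) *\<^sub>R I G z)"
      by (intro continuous_intros contc2 contI)
    show "norm (c (fst z) *\<^sub>R I G z) \<le> h * M" for z
      using mult_mono[OF c[of "fst z"] normI[of G z]] h by simp
  qed
  define T where "T G = Bcontfun (\<lambda>z. c (fst z) *\<^sub>R I G z)" for G
  have T: "apply_bcontfun (T G) z = c (fst z) *\<^sub>R I G z" for G z
    unfolding T_def by (simp add: Bcontfun_inverse[OF bc])
  have "dist (T G) (T G') \<le> 1 / 2 * dist G G'" for G G'
  proof (rule dist_bound)
    fix z
    have "norm (I G z - I G' z) \<le> \<bar>L\<bar> * dist G G' * (1 - 0)"
    proof -
      have "I G z - I G' z = integral {0..1} (\<lambda>\<sigma>. V (snd z + apply_bcontfun G (\<sigma> * c (fst z), snd z)) -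
          V (snd z + apply_bcontfun G' (\<sigma> * c (fst z), snd z)))"
        unfolding I_def cbox_interval
        by (rule integral_diff[symmetric]) (intro integrable_continuous_interval cont2)+
      also have "norm \<dots> \<le> \<bar>L\<bar> * dist G G' * (1 - 0)"
      proof (rule integral_bound)
        show "norm (V (snd z + apply_bcontfun G (\<sigma> * c (fst z), snd z)) -
            V (snd z + apply_bcontfun G' (\<sigma> * c (fst z), snd z))) \<le> \<bar>L\<bar> * dist G G'" for \<sigma>
        proof -
          have "norm (V (snd z + apply_bcontfun G (\<sigma> * c (fst z), snd z)) -
              V (snd z + apply_bcontfun G' (\<sigma> * c (fst z), snd z)))
            \<le> \<bar>L\<bar> * dist (apply_bcontfun G (\<sigma> * c (fst z), snd z)) (apply_bcontfun G' (\<sigma> * c (fst z), snd z))"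
            using lip'[of "snd z + apply_bcontfun G (\<sigma> * c (fst z), snd z)"
                "snd z + apply_bcontfun G' (\<sigma> * c (fst z), snd z)"] by (simp add: dist_norm)
          also have "\<dots> \<le> \<bar>L\<bar> * dist G G'" by (intro mult_left_mono dist_bounded) auto
          finally show ?thesis .
        qed
      qed (auto intro: continuous_on_diff cont2)
      finally show ?thesis .
    qed
    then have "norm (c (fst z) *\<^sub>R (I G z - I G' z)) \<le> h * (\<bar>L\<bar> * dist G G')"
      using mult_mono[OF c[of "fst z"]] h by simp
    also have "\<dots> \<le> 1 / 2 * dist G G'" using mult_right_mono[OF h(2), of "dist G G'"] by (simp add: mult.assoc)
    finally show "dist (apply_bcontfun (T G) z) (apply_bcontfun (T G') z) \<le> 1 / 2 * dist G G'"
      by (simp add: T dist_norm scaleR_right_diff_distrib)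
  qed
  then obtain G where "T G = G"
    using banach_fix_type[of "1/2" T] by auto
  then have G: "apply_bcontfun G z = c (fst z) *\<^sub>R I G z" for z using T[of G z] by simp
  define \<Phi> where "\<Phi> z = snd z + apply_bcontfun G z" for z
  show ?thesis
  proof
    show "0 < h" by fact
    show cont\<Phi>: "continuous_on UNIV \<Phi>" unfolding \<Phi>_def by (intro continuous_intros contG)
    show "\<Phi> (0, y) = y" for y using h by (simp add: \<Phi>_def G c_def)
    fix t :: real and y :: 'b assume t: "\<bar>t\<bar> < h"
    define v where "v s = V (\<Phi> (s, y))" for s
    have contv: "continuous_on {- h..h} v"
      unfolding v_def
      by (intro continuous_on_compose2[OF contV[of UNIV]] continuous_on_compose2[OF cont\<Phi>] continuous_intros) auto
    obtain W where W: "\<And>s. s \<in> {- h..h} \<Longrightarrow> (W has_vector_derivative v s) (at s within {- h..h})"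
      using antiderivative_continuous[OF contv] by blast
    \<comment> \<open>Undoing the substitution: with W an antiderivative of v, the fixed-point
      equation becomes an explicit formula that can be differentiated in s.\<close>
    have \<Phi>W: "\<Phi> (s, y) = y + (W s - W 0)" if s: "s \<in> {- h..h}" for s
    proof -
      have int: "((\<lambda>\<sigma>. s *\<^sub>R v (\<sigma> * s)) has_integral W (1 * s) - W (0 * s)) {0..1}"
      proof (rule fundamental_theorem_of_calculus)
        fix \<sigma> :: real assume \<sigma>: "\<sigma> \<in> {0..1}"
        have sub: "(\<lambda>\<sigma>. \<sigma> * s) ` {0..1} \<subseteq> {- h..h}"
        proof clarify
          fix u :: real assume "u \<in> {0..1}"
          then have "\<bar>u * s\<bar> \<le> 1 * h" unfolding abs_mult using s by (intro mult_mono) auto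
          then show "u * s \<in> {- h..h}" by auto
        qed
        have "((\<lambda>\<sigma>. \<sigma> * s) has_vector_derivative s) (at \<sigma> within {0..1})"
          by (auto intro!: derivative_eq_intros simp: has_real_derivative_iff_has_vector_derivative[symmetric])
        from vector_diff_chain_within[OF this has_vector_derivative_within_subset[OF W sub]]
        show "((\<lambda>\<sigma>. W (\<sigma> * s)) has_vector_derivative s *\<^sub>R v (\<sigma> * s)) (at \<sigma> within {0..1})"
          using subsetD[OF sub imageI[OF \<sigma>]] by (simp add: o_def)
      qed simp
      have "s *\<^sub>R integral {0..1} (\<lambda>\<sigma>. v (\<sigma> * s)) = W s - W 0"
        using integral_unique[OF int] by simp
      moreover have "c s = s" using s by (simp add: c_def)
      moreover from this have "I G (s, y) = integral {0..1} (\<lambda>\<sigma>. v (\<sigma> * s))"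
        by (simp add: I_def v_def \<Phi>_def)
      ultimately show ?thesis
        using G[of "(s, y)"] by (simp add: \<Phi>_def)
    qed
    have "((\<lambda>s. y + (W s - W 0)) has_vector_derivative v t) (at t within {- h..h})"
      using W[of t] abs_less_iff[of t h] t by (auto intro!: derivative_eq_intros)
    then have "((\<lambda>s. y + (W s - W 0)) has_vector_derivative v t) (at t)"
      using t at_within_Icc_at[of "- h" t h] by (simp add: abs_less_iff)
    then have "((\<lambda>s. \<Phi> (s, y)) has_vector_derivative v t) (at t)"
      by (rule has_vector_derivative_transform_within_open[where S = "{- h<..<h}"])
        (use t \<Phi>W in auto)
    then show "((\<lambda>s. \<Phi> (s, y)) has_vector_derivative V (\<Phi> (t, y))) (at t)" by (simp add: v_def)
  qed
qed

lemma smooth_on_imp_lipschitz_cball: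
  fixes V :: "'b::euclidean_space \<Rightarrow> 'c::real_normed_vector"
  assumes V: "smooth_on S V" and S: "open S" "cball q r \<subseteq> S"
  obtains L where "\<And>x y. x \<in> cball q r \<Longrightarrow> y \<in> cball q r \<Longrightarrow> norm (V x - V y) \<le> L * norm (x - y)"
proof -
  have "\<exists>K. \<forall>x\<in>cball q r. norm (frechet_derivative V (at x) b) \<le> K" for b
  proof -
    have "compact ((\<lambda>x. frechet_derivative V (at x) b) ` cball q r)"
      by (intro compact_continuous_image continuous_on_subset[OF smooth_on_continuous_on S(2)]
          smooth_on_frechet_derivative V compact_cball)
    from compact_imp_bounded[OF this] show ?thesis by (auto simp: bounded_iff)
  qed
  then obtain K where K: "\<And>x b. x \<in> cball q r \<Longrightarrow> norm (frechet_derivative V (at x) b) \<le> K b" by metis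
  have der: "(V has_derivative frechet_derivative V (at x)) (at x)" if "x \<in> cball q r" for x
    using smooth_on_has_derivative[OF V S(1)] S(2) that by blast
  show ?thesis
  proof
    fix x y assume xy: "x \<in> cball q r" "y \<in> cball q r"
    show "norm (V x - V y) \<le> (\<Sum>b\<in>Basis. K b) * norm (x - y)"
    proof (rule differentiable_bound[OF convex_cball _ _ xy(1,2)])
      fix z assume z: "z \<in> cball q r"
      show "(V has_derivative frechet_derivative V (at z)) (at z within cball q r)"
        using der[OF z] by (rule has_derivative_at_withinI)
      show "onorm (frechet_derivative V (at z)) \<le> (\<Sum>b\<in>Basis. K b)"
      proof (rule onorm_le)
        fix v
        have "norm (frechet_derivative V (at z) v) = norm (\<Sum>b\<in>Basis. (v \<bullet> b) *\<^sub>R frechet_derivative V (at z) b)"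
          by (rule arg_cong[OF has_derivative_componentwise_sum[OF der[OF z]]])
        also have "\<dots> \<le> (\<Sum>b\<in>Basis. norm v * K b)"
        proof (intro order_trans[OF norm_sum] sum_mono)
          fix b :: 'b assume "b \<in> Basis"
          then show "norm ((v \<bullet> b) *\<^sub>R frechet_derivative V (at z) b) \<le> norm v * K b"
            using K[OF z] by (auto intro!: mult_mono Basis_le_norm)
        qed
        finally show "norm (frechet_derivative V (at z) v) \<le> (\<Sum>b\<in>Basis. K b) * norm v"
          by (simp add: sum_distrib_left mult.commute)
      qed
    qed
  qed
qed

text \<open>Composing \<open>V\<close> with the nearest-point projection onto the ball, which is
  1-Lipschitz by convexity, makes the field globally bounded and Lipschitz and leaves it unchanged
  on the ball. Continuity of \<Phi> at (0, q) keeps short trajectories inside the ball, where both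
  fields agree.\<close>

lemma local_flow:
  fixes V :: "'b::euclidean_space \<Rightarrow> 'b"
  assumes V: "smooth_on S V" and S: "open S" "cball q r \<subseteq> S" and r: "0 < r"
  obtains h \<delta> and \<Phi> :: "real \<times> 'b \<Rightarrow> 'b" where "0 < h" "0 < \<delta>" "continuous_on UNIV \<Phi>" "\<And>y. \<Phi> (0, y) = y"
    "\<And>t y. \<bar>t\<bar> < h \<Longrightarrow> y \<in> ball q \<delta> \<Longrightarrow> \<Phi> (t, y) \<in> ball q r"
    "\<And>t y. \<bar>t\<bar> < h \<Longrightarrow> y \<in> ball q \<delta> \<Longrightarrow> ((\<lambda>s. \<Phi> (s, y)) has_vector_derivative V (\<Phi> (t, y))) (at t)"
proof -
  obtain L where L: "\<And>x y. x \<in> cball q r \<Longrightarrow> y \<in> cball q r \<Longrightarrow> norm (V x - V y) \<le> L * norm (x - y)"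
    using smooth_on_imp_lipschitz_cball[OF V S] by blast
  let ?c = "closest_point (cball q r)"
  have c: "?c x \<in> cball q r" for x using r by (intro closest_point_in_set) auto
  have "compact (V ` cball q r)"
    by (intro compact_continuous_image continuous_on_subset[OF smooth_on_continuous_on[OF V] S(2)] compact_cball)
  from compact_imp_bounded[OF this] obtain M where M: "\<And>x. x \<in> cball q r \<Longrightarrow> norm (V x) \<le> M"
    unfolding bounded_iff by blast
  have lip: "norm (V (?c x) - V (?c y)) \<le> \<bar>L\<bar> * norm (x - y)" for x y
  proof -
    have "norm (V (?c x) - V (?c y)) \<le> L * norm (?c x - ?c y)" by (intro L c)
    also have "\<dots> \<le> \<bar>L\<bar> * norm (?c x - ?c y)" by (intro mult_right_mono) auto
    also have "\<dots> \<le> \<bar>L\<bar> * norm (x - y)"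
      using closest_point_lipschitz[of "cball q r" x y] r by (intro mult_left_mono) (auto simp: dist_norm)
    finally show ?thesis .
  qed
  obtain h0 and \<Phi> :: "real \<times> 'b \<Rightarrow> 'b" where \<Phi>: "0 < h0" "continuous_on UNIV \<Phi>" "\<And>y. \<Phi> (0, y) = y"
    "\<And>t y. \<bar>t\<bar> < h0 \<Longrightarrow> ((\<lambda>s. \<Phi> (s, y)) has_vector_derivative V (?c (\<Phi> (t, y)))) (at t)"
    using bounded_lipschitz_flow[of "\<lambda>x. V (?c x)" "\<bar>L\<bar>" M, OF lip M[OF c]] by blast
  have "open (\<Phi> -` ball q r)" using \<Phi>(2) by (simp add: continuous_on_open_vimage open_vimage)
  moreover have "(0, q) \<in> \<Phi> -` ball q r" using \<Phi>(3) r by simp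
  ultimately obtain T D where TD: "open T" "open D" "(0, q) \<in> T \<times> D" "T \<times> D \<subseteq> \<Phi> -` ball q r"
    by (rule open_prod_elim)
  obtain h1 where h1: "0 < h1" "ball 0 h1 \<subseteq> T" using TD by (auto elim: openE)
  obtain \<delta> where \<delta>: "0 < \<delta>" "ball q \<delta> \<subseteq> D" using TD by (auto elim: openE)
  have in_ball: "\<Phi> (t, y) \<in> ball q r" if "\<bar>t\<bar> < min h0 h1" "y \<in> ball q \<delta>" for t y
  proof -
    have "t \<in> T" using that(1) h1(2) by (auto simp: dist_norm subset_iff)
    moreover have "y \<in> D" using that(2) \<delta>(2) by blast
    ultimately show ?thesis using TD(4) by auto
  qed
  show ?thesis
  proof
    show "0 < min h0 h1" "0 < \<delta>" using \<Phi>(1) h1 \<delta> by auto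
    show "continuous_on UNIV \<Phi>" "\<And>y. \<Phi> (0, y) = y" by fact+
    fix t y assume ty: "\<bar>t\<bar> < min h0 h1" "y \<in> ball q \<delta>"
    show b: "\<Phi> (t, y) \<in> ball q r" using in_ball[OF ty] .
    then have "?c (\<Phi> (t, y)) = \<Phi> (t, y)" by (intro closest_point_self) auto
    with \<Phi>(4)[of t y] ty show "((\<lambda>s. \<Phi> (s, y)) has_vector_derivative V (\<Phi> (t, y))) (at t)" by simp
  qed
qed

section \<open>Flows of derivations on the manifold\<close>

context manifold_atlas
begin

lemma coordinate_functions:
  assumes "(U, \<phi>) \<in> A" "x \<in> U"
  obtains c W where "\<And>l. c l \<in> smooth_funs A" "open W" "x \<in> W" "W \<subseteq> U" "\<And>l y. y \<in> W \<Longrightarrow> c l y = \<phi> y $ l"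
proof -
  obtain r where r: "0 < r" "ball (\<phi> x) r \<subseteq> \<phi> ` U"
    using chart_open_image[OF assms(1)] assms(2) by (meson imageI openE)
  have "\<exists>E. E \<in> smooth_funs A \<and> (\<forall>y\<in>U. dist (\<phi> x) (\<phi> y) \<le> r / 4 \<longrightarrow> E y = \<phi> y $ l)" for l
  proof -
    have "smooth_on (ball (\<phi> x) r) (\<lambda>q. q $ l)"
      by (intro smooth_on_bounded_linear open_ball bounded_linear_vec_nth)
    from smooth_extension[OF assms(1) r this] show ?thesis by metis
  qed
  then obtain c where c: "\<And>l. c l \<in> smooth_funs A"
    "\<And>l y. y \<in> U \<Longrightarrow> dist (\<phi> x) (\<phi> y) \<le> r / 4 \<Longrightarrow> c l y = \<phi> y $ l" by metis
  show ?thesis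
    by (rule that[of c "U \<inter> \<phi> -` ball (\<phi> x) (r / 4)"])
      (use c r assms in \<open>auto intro: chart_open_vimage\<close>)
qed

text \<open>The field with components X (c l) is integrated on the chart image and its flow carried
  back. Trajectories stay in the image of \<open>W\<close>, where the \<open>c l\<close> are the
  chart coordinates, so \<open>vector_field_in_chart\<close> identifies the derivative of f along
  them with X f.\<close>

lemma vector_field_flow:
  assumes X: "smooth_vector_field A X"
  obtains h N \<Psi> where "0 < h" "open N" "x \<in> N"
    "continuous_on ({- h<..<h} \<times> N) (\<lambda>z. \<Psi> (fst z) (snd z))" "\<And>y. y \<in> N \<Longrightarrow> \<Psi> 0 y = y"
    "\<And>t y f. t \<in> {- h<..<h} \<Longrightarrow> y \<in> N \<Longrightarrow> f \<in> smooth_funs A \<Longrightarrow>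
      ((\<lambda>s. f (\<Psi> s y)) has_real_derivative X f (\<Psi> t y)) (at t)"
proof -
  obtain U \<phi> where U: "(U, \<phi>) \<in> A" "x \<in> U" using chart_at .
  obtain c W where c: "\<And>l. c l \<in> smooth_funs A" "open W" "x \<in> W" "W \<subseteq> U" "\<And>l y. y \<in> W \<Longrightarrow> c l y = \<phi> y $ l"
    using coordinate_functions[OF U] by blast
  let ?inv = "inv_into U \<phi>"
  have imW: "open (\<phi> ` W)" using chart_open_map[OF U(1) c(2)] c(4) by (simp add: Int_absorb1)
  obtain r where r: "0 < r" "cball (\<phi> x) r \<subseteq> \<phi> ` W"
    using imW c(3) open_contains_cball by (metis imageI)
  then have rU: "cball (\<phi> x) r \<subseteq> \<phi> ` U" using c(4) by auto
  define V where "V q = (\<Sum>l\<in>UNIV. X (c l) (?inv q) *\<^sub>R axis l (1::real))" for q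
  have "smooth_on (\<phi> ` U) V"
  proof -
    have "smooth_on (\<phi> ` U) (\<lambda>q. X (c l) (?inv q) *\<^sub>R (axis l 1 :: real^'n))" for l
      by (rule smooth_on_compose[OF chart_open_image[OF U(1)] open_UNIV
          smooth_on_bounded_linear[OF open_UNIV bounded_linear_scaleR_left]
          smooth_fun_on_chart[OF vector_field_smooth[OF X c(1)] U(1)]]) simp
    then show ?thesis unfolding V_def by (intro smooth_on_sum chart_open_image[OF U(1)])
  qed
  then obtain h \<delta> \<Phi> where \<Phi>: "0 < h" "0 < \<delta>" "continuous_on UNIV \<Phi>" "\<And>y. \<Phi> (0, y) = y"
    "\<And>t y. \<bar>t\<bar> < h \<Longrightarrow> y \<in> ball (\<phi> x) \<delta> \<Longrightarrow> \<Phi> (t, y) \<in> ball (\<phi> x) r"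
    "\<And>t y. \<bar>t\<bar> < h \<Longrightarrow> y \<in> ball (\<phi> x) \<delta> \<Longrightarrow> ((\<lambda>s. \<Phi> (s, y)) has_vector_derivative V (\<Phi> (t, y))) (at t)"
    using local_flow[OF _ chart_open_image[OF U(1)] rU r(1), of V] by blast
  define \<Psi> where "\<Psi> t y = ?inv (\<Phi> (t, \<phi> y))" for t y
  define N where "N = U \<inter> \<phi> -` ball (\<phi> x) \<delta>"
  have in_r: "\<Phi> (t, \<phi> y) \<in> ball (\<phi> x) r" if "t \<in> {- h<..<h}" "y \<in> N" for t y
    using that by (intro \<Phi>(5)) (auto simp: N_def)
  show ?thesis
  proof
    show "0 < h" by fact
    show "open N" unfolding N_def by (intro chart_open_vimage U open_ball)
    show "x \<in> N" using U \<Phi> by (simp add: N_def)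
    show "\<Psi> 0 y = y" if "y \<in> N" for y
      using that chart_inv[OF U(1)] by (simp add: \<Psi>_def \<Phi>(4) N_def)
    have "continuous_on ({- h<..<h} \<times> N) (\<lambda>z. \<Phi> (fst z, \<phi> (snd z)))"
      by (intro continuous_on_compose2[OF \<Phi>(3)] continuous_intros
          continuous_on_compose2[OF chart_continuous_on[OF U(1)]]) (auto simp: N_def)
    then show "continuous_on ({- h<..<h} \<times> N) (\<lambda>z. \<Psi> (fst z) (snd z))"
      unfolding \<Psi>_def
      by (rule continuous_on_compose2[OF chart_inv_continuous_on[OF U(1)]])
        (use in_r rU in fastforce)
    fix t y f assume ty: "t \<in> {- h<..<h}" "y \<in> N" and f: "f \<in> smooth_funs A"
    let ?q = "\<Phi> (t, \<phi> y)"
    have "?q \<in> \<phi> ` W" using in_r[OF ty] r(2) by auto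
    then obtain p where p: "p \<in> W" "?q = \<phi> p" by auto
    have pU: "p \<in> U" using p c(4) by blast
    have \<Psi>p: "\<Psi> t y = p" using p pU chart_inv[OF U(1)] by (simp add: \<Psi>_def)
    let ?D = "frechet_derivative (\<lambda>q. f (?inv q)) (at ?q)"
    have D: "((\<lambda>q. f (?inv q)) has_derivative ?D) (at ?q)"
      using smooth_on_has_derivative[OF smooth_fun_on_chart[OF f U(1)] chart_open_image[OF U(1)]] p(2) pU by auto
    interpret D: bounded_linear ?D using D by (rule has_derivative_bounded_linear)
    have "((\<lambda>s. \<Phi> (s, \<phi> y)) has_derivative (\<lambda>s. s *\<^sub>R V ?q)) (at t)"
      using \<Phi>(6)[of t "\<phi> y"] ty by (auto simp: N_def has_vector_derivative_def abs_less_iff)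
    from has_derivative_compose[OF this D]
    have "((\<lambda>s. f (\<Psi> s y)) has_derivative (\<lambda>s. s * ?D (V ?q))) (at t)"
      unfolding \<Psi>_def by (simp add: D.scaleR)
    then have "((\<lambda>s. f (\<Psi> s y)) has_real_derivative ?D (V ?q)) (at t)"
      unfolding has_field_derivative_def by (rule has_derivative_eq_rhs) (simp add: fun_eq_iff mult.commute)
    moreover have "?D (V ?q) = X f (\<Psi> t y)"
    proof -
      have "?D (V ?q) = (\<Sum>l\<in>UNIV. ?D (axis l 1) * X (c l) p)"
        unfolding V_def D.sum D.scaleR using p chart_inv[OF U(1) pU] by (simp add: mult.commute)
      also have "\<dots> = X f p"
        unfolding p(2) by (rule vector_field_in_chart[OF X U(1) pU f c(1,2) p(1) c(4,5), symmetric])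
      finally show ?thesis by (simp add: \<Psi>p)
    qed
    ultimately show "((\<lambda>s. f (\<Psi> s y)) has_real_derivative X f (\<Psi> t y)) (at t)" by simp
  qed
qed

end

section \<open>Noncommutative power series\<close>

text \<open>The grading by word length plays the role of the powers of the time parameter \<open>t\<close>.\<close>

typedef 'k ncps = "UNIV :: ('k list \<Rightarrow> real) set" morphisms coef Ncps ..

lemma coef_Ncps [simp]: "coef (Ncps f) = f"
  by (simp add: Ncps_inverse)

lemma ncps_eqI: "(\<And>w. coef a w = coef b w) \<Longrightarrow> a = b"
  by (metis coef_inverse ext)

instantiation ncps :: (type) ring_1
begin
definition "0 = Ncps (\<lambda>w. 0)"
definition "1 = Ncps (\<lambda>w. if w = [] then 1 else 0)"
definition "a + b = Ncps (\<lambda>w. coef a w + coef b w)"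
definition "- a = Ncps (\<lambda>w. - coef a w)"
definition "a - b = Ncps (\<lambda>w. coef a w - coef b w)"
definition "a * b = Ncps (\<lambda>w. \<Sum>i\<le>length w. coef a (take i w) * coef b (drop i w))"

instance
proof
  fix a b c :: "'a ncps"
  show "a * b * c = a * (b * c)"
  proof (rule ncps_eqI)
    fix w :: "'a list"
    \<comment> \<open>Both bracketings sum over the ways to cut \<open>w\<close> into three
      consecutive pieces, of lengths i, j and the rest; the exchange of sums is the one known from
      commutative power series.\<close>
    define F where "F i j k = coef a (take i w) * coef b (take j (drop i w)) * coef c (drop (i + j) w)" for i j k :: nat
    have "coef (a * b * c) w = (\<Sum>j=0..length w. \<Sum>i=0..j. F i (j - i) (length w - j))"
      unfolding times_ncps_def F_def coef_Ncps sum_distrib_right atLeast0AtMost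
      by (auto intro!: sum.cong simp: drop_take min_def)
    also have "\<dots> = (\<Sum>j=0..length w. \<Sum>i=0..length w - j. F j i (length w - j - i))"
      by (rule fps_mult_assoc_lemma)
    also have "\<dots> = coef (a * (b * c)) w"
      by (simp add: times_ncps_def F_def sum_distrib_left atLeast0AtMost add.commute mult.assoc)
    finally show "coef (a * b * c) w = coef (a * (b * c)) w" .
  qed
  show "1 * a = a"
  proof (rule ncps_eqI)
    fix w :: "'a list"
    have "coef (1 * a) w = (\<Sum>i\<le>length w. if i = 0 then coef a w else 0)"
      unfolding times_ncps_def one_ncps_def coef_Ncps by (intro sum.cong) auto
    then show "coef (1 * a) w = coef a w" by simp
  qed
  show "a * 1 = a"
  proof (rule ncps_eqI)
    fix w :: "'a list"
    have "coef (a * 1) w = (\<Sum>i\<le>length w. if i = length w then coef a w else 0)"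
      unfolding times_ncps_def one_ncps_def coef_Ncps by (intro sum.cong) auto
    then show "coef (a * 1) w = coef a w" by simp
  qed
  show "(0::'a ncps) \<noteq> 1"
  proof
    assume "(0::'a ncps) = 1"
    then have "coef (0::'a ncps) [] = coef 1 []" by simp
    then show False by (simp add: zero_ncps_def one_ncps_def)
  qed
qed (auto intro!: ncps_eqI simp: zero_ncps_def plus_ncps_def uminus_ncps_def minus_ncps_def times_ncps_def
    sum.distrib algebra_simps)
end

lemma
  shows coef_0 [simp]: "coef 0 w = 0"
    and coef_1: "coef 1 w = (if w = [] then 1 else 0)"
    and coef_add [simp]: "coef (a + b) w = coef a w + coef b w"
    and coef_minus [simp]: "coef (- a) w = - coef a w"
    and coef_diff [simp]: "coef (a - b) w = coef a w - coef b w"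
    and coef_mult: "coef (a * b) w = (\<Sum>i\<le>length w. coef a (take i w) * coef b (drop i w))"
  by (simp_all add: zero_ncps_def one_ncps_def plus_ncps_def uminus_ncps_def minus_ncps_def times_ncps_def)

text \<open>The order filtration: once each variable is scaled by t, this says that the series is
  O(t^n).\<close>

definition ord_ge :: "nat \<Rightarrow> 'k ncps \<Rightarrow> bool" where
  "ord_ge n a \<longleftrightarrow> (\<forall>w. length w < n \<longrightarrow> coef a w = 0)"

definition homogeneous :: "nat \<Rightarrow> 'k ncps \<Rightarrow> bool" where
  "homogeneous n a \<longleftrightarrow> (\<forall>w. length w \<noteq> n \<longrightarrow> coef a w = 0)"

lemma homogeneous_imp_ord_ge: "homogeneous n a \<Longrightarrow> ord_ge n a"
  by (simp add: homogeneous_def ord_ge_def)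

lemma ord_ge_add: "ord_ge n a \<Longrightarrow> ord_ge n b \<Longrightarrow> ord_ge n (a + b)"
  by (simp add: ord_ge_def)

lemma ord_ge_minus: "ord_ge n a \<Longrightarrow> ord_ge n (- a)"
  by (simp add: ord_ge_def)

lemma ord_ge_diff: "ord_ge n a \<Longrightarrow> ord_ge n b \<Longrightarrow> ord_ge n (a - b)"
  by (simp add: ord_ge_def)

lemma ord_ge_mono: "ord_ge n a \<Longrightarrow> m \<le> n \<Longrightarrow> ord_ge m a"
  by (simp add: ord_ge_def)

lemma ord_ge_mult:
  assumes "ord_ge m a" "ord_ge n b" "k \<le> m + n" shows "ord_ge k (a * b)"
  unfolding ord_ge_def coef_mult
proof (intro allI impI sum.neutral ballI)
  fix w :: "'a list" and i assume w: "length w < k" and i: "i \<in> {..length w}"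
  show "coef a (take i w) * coef b (drop i w) = 0"
  proof (cases "i < m")
    case True
    then show ?thesis using assms(1) i by (simp add: ord_ge_def)
  next
    case False
    then have "length (drop i w) < n" using w i assms(3) by auto
    then show ?thesis using assms(2) by (simp add: ord_ge_def)
  qed
qed

lemma homogeneous_mult:
  assumes "homogeneous m a" "homogeneous n b" shows "homogeneous (m + n) (a * b)"
  unfolding homogeneous_def coef_mult
proof (intro allI impI sum.neutral ballI)
  fix w :: "'a list" and i assume w: "length w \<noteq> m + n" and i: "i \<in> {..length w}"
  show "coef a (take i w) * coef b (drop i w) = 0"
  proof (cases "i = m")
    case False
    then show ?thesis using assms(1) i by (simp add: homogeneous_def)
  next
    case True
    then have "length (drop i w) \<noteq> n" using w i by auto
    then show ?thesis using assms(2) by (simp add: homogeneous_def)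
  qed
qed

definition nvar :: "'k \<Rightarrow> 'k ncps" where
  "nvar i = Ncps (\<lambda>w. if w = [i] then 1 else 0)"

text \<open>The exponential of c times the variable \<open>i\<close>, the formal counterpart of
  running the flow of the \<open>i\<close>-th field for time c t.\<close>

definition nexp :: "'k \<Rightarrow> real \<Rightarrow> 'k ncps" where
  "nexp i c = Ncps (\<lambda>w. if w = replicate (length w) i then c ^ length w / fact (length w) else 0)"

lemma homogeneous_nvar: "homogeneous 1 (nvar i)"
  by (auto simp: homogeneous_def nvar_def)

lemma nexp_inverse: "nexp i c * nexp i (- c) = 1"
proof (rule ncps_eqI)
  fix w
  show "coef (nexp i c * nexp i (- c)) w = coef 1 w"
  proof (cases "w = replicate (length w) i")
    case True
    define n where "n = length w"
    have w: "w = replicate n i" using True n_def by simp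
    have "coef (nexp i c * nexp i (- c)) w = (\<Sum>j\<le>n. c ^ j / fact j * ((- c) ^ (n - j) / fact (n - j)))"
      unfolding w by (simp add: coef_mult nexp_def min_def)
    also have "\<dots> = (\<Sum>j\<le>n. of_nat (n choose j) * c ^ j * (- c) ^ (n - j)) / fact n"
      by (simp add: sum_divide_distrib binomial_fact field_simps)
    also have "\<dots> = (c + - c) ^ n / fact n" by (simp only: binomial_ring)
    also have "\<dots> = coef 1 w" by (cases n) (auto simp: coef_1 w)
    finally show ?thesis .
  next
    case False
    have 0: "coef (nexp i c) (take j w) * coef (nexp i (- c)) (drop j w) = 0" for j
    proof (rule ccontr)
      assume "\<not> ?thesis"
      then have "take j w = replicate (length (take j w)) i" "drop j w = replicate (length (drop j w)) i"
        by (auto simp: nexp_def split: if_splits)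
      then have "w = replicate (length (take j w)) i @ replicate (length (drop j w)) i"
        by (metis append_take_drop_id)
      then show False using False by (metis length_append length_replicate replicate_add)
    qed
    show ?thesis using False unfolding coef_mult 0 by (auto simp: coef_1)
  qed
qed

lemma nexp_expansion: "ord_ge 2 (nexp i 1 - 1 - nvar i)"
  unfolding ord_ge_def
proof (intro allI impI)
  fix w :: "'a list" assume "length w < 2"
  then consider "w = []" | j where "w = [j]" by (cases w) auto
  then show "coef (nexp i 1 - 1 - nvar i) w = 0"
    by cases (auto simp: nexp_def nvar_def coef_1)
qed

primrec word_exp :: "('k \<times> real) list \<Rightarrow> 'k ncps" where
  "word_exp [] = 1"
| "word_exp (p # l) = nexp (fst p) (snd p) * word_exp l"

lemma word_exp_append: "word_exp (l @ l') = word_exp l * word_exp l'"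
  by (induction l) (auto simp: mult.assoc)

definition word_inverse :: "('k \<times> real) list \<Rightarrow> ('k \<times> real) list" where
  "word_inverse l = rev (map (\<lambda>p. (fst p, - snd p)) l)"

lemma word_exp_inverse:
  "word_exp l * word_exp (word_inverse l) = 1" "word_exp (word_inverse l) * word_exp l = 1"
proof (induction l)
  case (Cons p l)
  let ?e = "nexp (fst p) (snd p)" and ?e' = "nexp (fst p) (- snd p)"
  have e: "?e * ?e' = 1" "?e' * ?e = 1"
    using nexp_inverse[of "fst p" "snd p"] nexp_inverse[of "fst p" "- snd p"] by auto
  have inv: "word_exp (word_inverse (p # l)) = word_exp (word_inverse l) * ?e'"
    by (simp add: word_inverse_def word_exp_append)
  have "?e * word_exp l * (word_exp (word_inverse l) * ?e') = ?e * (word_exp l * word_exp (word_inverse l)) * ?e'"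
    by (simp only: mult.assoc)
  then show "word_exp (p # l) * word_exp (word_inverse (p # l)) = 1"
    unfolding inv by (simp add: Cons e)
  have "word_exp (word_inverse l) * ?e' * (?e * word_exp l) = word_exp (word_inverse l) * (?e' * ?e) * word_exp l"
    by (simp only: mult.assoc)
  then show "word_exp (word_inverse (p # l)) * word_exp (p # l) = 1"
    unfolding inv by (simp add: Cons e)
qed (auto simp: word_inverse_def)

lemma word_exp_minus_1: "ord_ge 1 (word_exp l - 1)"
proof -
  have "coef (word_exp l) [] = 1"
    by (induction l) (auto simp: coef_1 coef_mult nexp_def)
  then show ?thesis by (simp add: ord_ge_def coef_1)
qed

text \<open>Left-normed brackets: each new generator enters on the right. The index is the degree,
  hence the power of t in the corresponding motion.\<close>

inductive iterated_bracket :: "nat \<Rightarrow> 'k ncps \<Rightarrow> bool" where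
  var: "iterated_bracket 1 (nvar i)"
| bracket: "iterated_bracket n B \<Longrightarrow> iterated_bracket (Suc n) (B * nvar i - nvar i * B)"

lemma iterated_bracket_homogeneous: "iterated_bracket n B \<Longrightarrow> homogeneous n B"
proof (induction rule: iterated_bracket.induct)
  case (bracket n B i)
  have "homogeneous (n + 1) (B * nvar i)" "homogeneous (1 + n) (nvar i * B)"
    by (intro homogeneous_mult homogeneous_nvar bracket.IH)+
  then show ?case by (simp add: homogeneous_def)
qed (rule homogeneous_nvar)

lemma iterated_bracket_pos: "iterated_bracket n B \<Longrightarrow> 0 < n"
  by (induction rule: iterated_bracket.induct) auto

text \<open>The group commutator of \<open>P = 1 + B + \<dots>\<close> and \<open>Q = 1 + x + \<dots>\<close> has leading part \<open>B x - x B\<close>, because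
  \<open>P Q P\<^sup>-\<^sup>1 Q\<^sup>-\<^sup>1 - 1 = ((P - 1) (Q - 1) - (Q - 1) (P - 1)) P\<^sup>-\<^sup>1 Q\<^sup>-\<^sup>1\<close>.\<close>

lemma iterated_bracket_word:
  assumes "iterated_bracket n B"
  shows "\<exists>l. ord_ge (Suc n) (word_exp l - 1 - B)"
  using assms
proof (induction rule: iterated_bracket.induct)
  case (var i)
  have "ord_ge (Suc 1) (word_exp [(i, 1)] - 1 - nvar i)"
    using nexp_expansion[of i] by (simp add: numeral_2_eq_2)
  then show ?case by blast
next
  case (bracket n B i)
  then obtain l where l: "ord_ge (Suc n) (word_exp l - 1 - B)" by blast
  have B: "ord_ge n B" using bracket.hyps iterated_bracket_homogeneous homogeneous_imp_ord_ge by blast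
  have x: "ord_ge 1 (nvar i)" by (intro homogeneous_imp_ord_ge homogeneous_nvar)
  have n: "0 < n" using bracket.hyps by (rule iterated_bracket_pos)
  let ?P = "word_exp l" and ?P' = "word_exp (word_inverse l)"
  let ?Q = "nexp i 1" and ?Q' = "nexp i (- 1)"
  have P: "?P * ?P' = 1" by (rule word_exp_inverse)
  have Q: "?Q * ?Q' = 1" by (rule nexp_inverse)
  define p where "p = ?P - 1 - B"
  define q where "q = ?Q - 1 - nvar i"
  define \<sigma> where "\<sigma> = ?P' * ?Q' - 1"
  \<comment> \<open>What P Q - Q P contains beyond the bracket of the leading parts, after the terms
    with the unit cancel. Since p has order n + 1 and q has order 2, every product here has order at
    least n + 2.\<close>
  define \<rho> where "\<rho> = (B * q + p * nvar i + p * q) - (q * B + nvar i * p + q * p)"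
  have p: "ord_ge (Suc n) p" and q: "ord_ge 2 q"
    unfolding p_def q_def by (rule l, rule nexp_expansion)
  have \<sigma>: "ord_ge 1 \<sigma>"
    using word_exp_minus_1[of "word_inverse l @ [(i, - 1)]"] by (simp add: \<sigma>_def word_exp_append)
  have \<rho>: "ord_ge (Suc (Suc n)) \<rho>"
    unfolding \<rho>_def
    by (intro ord_ge_add ord_ge_diff ord_ge_mult[OF B q] ord_ge_mult[OF p x] ord_ge_mult[OF p q]
        ord_ge_mult[OF q B] ord_ge_mult[OF x p] ord_ge_mult[OF q p]) auto
  have Pp: "?P = 1 + B + p" and Qq: "?Q = 1 + nvar i + q" and S: "?P' * ?Q' = 1 + \<sigma>"
    by (simp_all add: p_def q_def \<sigma>_def)
  have R: "?P * ?Q - ?Q * ?P = (B * nvar i - nvar i * B) + \<rho>"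
    unfolding Pp Qq \<rho>_def by (simp add: algebra_simps)
  have "?P * ?Q * ?P' * ?Q' - 1 = ?P * ?Q * (?P' * ?Q') - ?Q * (?P * ?P') * ?Q'"
    by (simp add: P Q mult.assoc)
  also have "\<dots> = (?P * ?Q - ?Q * ?P) * (?P' * ?Q')" by (simp add: algebra_simps)
  finally have C: "?P * ?Q * ?P' * ?Q' - 1 - (B * nvar i - nvar i * B) =
      \<rho> + ((B * nvar i - nvar i * B) + \<rho>) * \<sigma>"
    unfolding R S by (simp add: algebra_simps)
  have R1: "ord_ge (Suc n) ((B * nvar i - nvar i * B) + \<rho>)"
    by (intro ord_ge_add ord_ge_diff ord_ge_mult[OF B x] ord_ge_mult[OF x B] ord_ge_mono[OF \<rho>]) auto
  have "ord_ge (Suc (Suc n)) (?P * ?Q * ?P' * ?Q' - 1 - (B * nvar i - nvar i * B))"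
    unfolding C by (rule ord_ge_add[OF \<rho> ord_ge_mult[OF R1 \<sigma>]]) simp
  moreover have "word_exp (l @ [(i, 1)] @ word_inverse l @ [(i, - 1)]) = ?P * ?Q * ?P' * ?Q'"
    by (simp add: word_exp_append mult.assoc)
  ultimately show ?case by metis
qed

text \<open>The inverse word has leading part -B, because P' - 1 = -(P - 1) P' and P' is 1 up to
  higher order. Both signs are provided since the factor t^n alone moves in one direction only when
  n is even.\<close>

lemma iterated_bracket_words:
  assumes "iterated_bracket n B"
  obtains l l' where "ord_ge (Suc n) (word_exp l - 1 - B)" "ord_ge (Suc n) (word_exp l' - 1 + B)"
proof -
  obtain l where l: "ord_ge (Suc n) (word_exp l - 1 - B)"
    using iterated_bracket_word[OF assms] by blast
  let ?P = "word_exp l" and ?P' = "word_exp (word_inverse l)"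
  have B: "ord_ge n B" using assms iterated_bracket_homogeneous homogeneous_imp_ord_ge by blast
  have "?P' - 1 = - ((?P - 1) * ?P')" by (simp add: algebra_simps word_exp_inverse)
  then have "?P' - 1 + B = - ((?P - 1 - B) * ?P') - B * (?P' - 1)"
    by (simp add: algebra_simps)
  moreover have "ord_ge (Suc n) ((?P - 1 - B) * ?P')"
    by (rule ord_ge_mult[OF l, of 0]) (auto simp: ord_ge_def)
  moreover have "ord_ge (Suc n) (B * (?P' - 1))"
    by (rule ord_ge_mult[OF B word_exp_minus_1]) auto
  ultimately have "ord_ge (Suc n) (?P' - 1 + B)"
    by (simp add: ord_ge_diff ord_ge_minus)
  with l show ?thesis using that by blast
qed

section \<open>Taylor expansions along words of flows\<close>

lemma finite_words: "finite {w :: 'k::finite list. length w < N}"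
  by (rule finite_subset[OF _ finite_lists_length_le[of UNIV N]]) auto

text \<open>Every word is cut at every position. The suffix is the outer index because in a
  composite expansion the letters contributed by the motion run last act on the function
  first.\<close>

lemma sum_coef_mult:
  fixes a b :: "'k::finite ncps" and h :: "'k list \<Rightarrow> real"
  shows "(\<Sum>w\<in>{w. length w < N}. coef (b * a) w * h w) =
    (\<Sum>v\<in>{v. length v < N}. \<Sum>u\<in>{u. length u < N - length v}. coef b u * coef a v * h (u @ v))"
proof -
  have "(\<Sum>w\<in>{w. length w < N}. coef (b * a) w * h w) =
      (\<Sum>w\<in>{w. length w < N}. \<Sum>i\<le>length w. coef b (take i w) * coef a (drop i w) * h w)"
    by (simp add: coef_mult sum_distrib_right)
  also have "\<dots> = (\<Sum>(w, i)\<in>(SIGMA w:{w. length w < N}. {..length w}). coef b (take i w) * coef a (drop i w) * h w)"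
    by (rule sum.Sigma) (auto simp: finite_words)
  also have "\<dots> = (\<Sum>(v, u)\<in>(SIGMA v:{v. length v < N}. {u. length u < N - length v}). coef b u * coef a v * h (u @ v))"
    by (rule sum.reindex_bij_witness[where i = "\<lambda>(v, u). (u @ v, length u)" and j = "\<lambda>(w, i). (drop i w, take i w)"])
      (auto simp: min_def)
  also have "\<dots> = (\<Sum>v\<in>{v. length v < N}. \<Sum>u\<in>{u. length u < N - length v}. coef b u * coef a v * h (u @ v))"
    by (rule sum.Sigma[symmetric]) (auto simp: finite_words)
  finally show ?thesis .
qed

locale control_system = manifold_atlas A
  for A :: "('a::topological_space set \<times> ('a \<Rightarrow> real^'n)) set" +
  fixes X :: "'k::finite \<Rightarrow> 'a vfield"
  assumes vector_fields: "\<And>i. smooth_vector_field A (X i)"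
begin

primrec word_op :: "'k list \<Rightarrow> 'a vfield" where
  "word_op [] = (\<lambda>f. f)"
| "word_op (i # w) = (\<lambda>f. X i (word_op w f))"

lemma word_op_append: "word_op (u @ v) f = word_op u (word_op v f)"
  by (induction u) auto

lemma word_op_smooth: "f \<in> smooth_funs A \<Longrightarrow> word_op w f \<in> smooth_funs A"
  by (induction w) (auto intro: vector_field_smooth vector_fields)

definition trunc :: "'k ncps \<Rightarrow> nat \<Rightarrow> real \<Rightarrow> ('a \<Rightarrow> real) \<Rightarrow> 'a \<Rightarrow> real" where
  "trunc a N t f y = (\<Sum>w\<in>{w. length w < N}. coef a w * (t ^ length w * word_op w f y))"

text \<open>Working with the filter \<open>nhds (0, x)\<close> makes the remainder estimate uniform in the starting point.\<close>

definition has_expansion :: "'a \<Rightarrow> (real \<Rightarrow> 'a \<Rightarrow> 'a) \<Rightarrow> 'k ncps \<Rightarrow> bool" where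
  "has_expansion x \<Phi> a \<longleftrightarrow> (\<forall>f\<in>smooth_funs A. \<forall>N>0. \<exists>C. \<forall>\<^sub>F z in nhds (0, x).
     \<bar>f (\<Phi> (fst z) (snd z)) - trunc a N (fst z) f (snd z)\<bar> \<le> C * \<bar>fst z\<bar> ^ N)"

lemma trunc_1: "0 < N \<Longrightarrow> trunc 1 N t f y = f y"
proof -
  assume "0 < N"
  then have "trunc 1 N t f y = (\<Sum>w\<in>{w :: 'k list. length w < N}. if w = [] then f y else 0)"
    unfolding trunc_def by (intro sum.cong) (auto simp: coef_1)
  then show ?thesis using \<open>0 < N\<close> by (simp add: finite_words)
qed

lemma has_expansion_id: "has_expansion x (\<lambda>t y. y) 1"
  unfolding has_expansion_def by (auto simp: trunc_1 intro!: exI[of _ 0])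

text \<open>First f is expanded along \<Phi> at the moving point \<open>\<Psi> t y\<close>, which
  uniformity in the starting point permits; then each \<open>word_op v f\<close>, already carrying
  \<open>t ^ length v\<close>, is expanded along \<Psi> to the remaining order. The motion run first
  thus stands on the left of the product.\<close>

lemma has_expansion_compose:
  assumes \<Phi>: "has_expansion x \<Phi> a" and \<Psi>: "has_expansion x \<Psi> b"
    and lim: "filterlim (\<lambda>z. \<Psi> (fst z) (snd z)) (nhds x) (nhds (0, x))"
  shows "has_expansion x (\<lambda>t y. \<Phi> t (\<Psi> t y)) (b * a)"
  unfolding has_expansion_def
proof (intro ballI allI impI)
  fix f and N :: nat assume f: "f \<in> smooth_funs A" and N: "0 < N"
  let ?W = "{v :: 'k list. length v < N}"
  obtain C where C: "\<forall>\<^sub>F z in nhds (0, x). \<bar>f (\<Phi> (fst z) (snd z)) - trunc a N (fst z) f (snd z)\<bar> \<le> C * \<bar>fst z\<bar> ^ N"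
    using \<Phi> f N unfolding has_expansion_def by blast
  have "filterlim (\<lambda>z. (fst z, \<Psi> (fst z) (snd z))) (nhds (0, x)) (nhds (0, x))"
    using filterlim_Pair[OF tendsto_fst[OF filterlim_ident] lim] by (simp add: nhds_prod)
  from eventually_compose_filterlim[OF C this] have 1: "\<forall>\<^sub>F z in nhds (0, x). \<bar>f (\<Phi> (fst z) (\<Psi> (fst z) (snd z)))
      - trunc a N (fst z) f (\<Psi> (fst z) (snd z))\<bar> \<le> C * \<bar>fst z\<bar> ^ N"
    by simp
  have "\<forall>v\<in>?W. \<exists>K. \<forall>\<^sub>F z in nhds (0, x). \<bar>word_op v f (\<Psi> (fst z) (snd z)) - trunc b (N - length v) (fst z) (word_op v f) (snd z)\<bar>
      \<le> K * \<bar>fst z\<bar> ^ (N - length v)"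
    using \<Psi> word_op_smooth[OF f] unfolding has_expansion_def by auto
  from bchoice[OF this] obtain K where K: "\<forall>v\<in>?W. \<forall>\<^sub>F z in nhds (0, x).
      \<bar>word_op v f (\<Psi> (fst z) (snd z)) - trunc b (N - length v) (fst z) (word_op v f) (snd z)\<bar>
      \<le> K v * \<bar>fst z\<bar> ^ (N - length v)"
    by blast
  have 2: "\<forall>\<^sub>F z in nhds (0, x). \<forall>v\<in>?W.
      \<bar>word_op v f (\<Psi> (fst z) (snd z)) - trunc b (N - length v) (fst z) (word_op v f) (snd z)\<bar>
      \<le> K v * \<bar>fst z\<bar> ^ (N - length v)"
    by (rule eventually_ball_finite[OF finite_words K])
  have "\<forall>\<^sub>F z in nhds (0, x). \<bar>f (\<Phi> (fst z) (\<Psi> (fst z) (snd z))) - trunc (b * a) N (fst z) f (snd z)\<bar>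
      \<le> (C + (\<Sum>v\<in>?W. \<bar>coef a v\<bar> * K v)) * \<bar>fst z\<bar> ^ N"
    using 1 2
  proof eventually_elim
    case (elim z)
    define t y where "t = fst z" and "y = snd z"
    note elim = elim[folded t_def y_def]
    have "trunc (b * a) N t f y = (\<Sum>v\<in>?W. \<Sum>u\<in>{u. length u < N - length v}.
        coef b u * coef a v * (t ^ length (u @ v) * word_op (u @ v) f y))"
      unfolding trunc_def by (rule sum_coef_mult)
    also have "\<dots> = (\<Sum>v\<in>?W. coef a v * t ^ length v * trunc b (N - length v) t (word_op v f) y)"
      unfolding trunc_def sum_distrib_left
      by (intro sum.cong refl) (simp add: word_op_append power_add algebra_simps)
    finally have "trunc a N t f (\<Psi> t y) - trunc (b * a) N t f y =
        (\<Sum>v\<in>?W. coef a v * t ^ length v * (word_op v f (\<Psi> t y) - trunc b (N - length v) t (word_op v f) y))"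
      unfolding trunc_def[of a] by (simp add: sum_subtractf algebra_simps)
    also have "\<bar>\<dots>\<bar> \<le> (\<Sum>v\<in>?W. \<bar>coef a v\<bar> * K v * \<bar>t\<bar> ^ N)"
    proof (rule order_trans[OF sum_abs sum_mono])
      fix v assume v: "v \<in> ?W"
      have "\<bar>coef a v * t ^ length v * (word_op v f (\<Psi> t y) - trunc b (N - length v) t (word_op v f) y)\<bar>
          \<le> \<bar>coef a v\<bar> * \<bar>t\<bar> ^ length v * (K v * \<bar>t\<bar> ^ (N - length v))"
        unfolding abs_mult power_abs using elim(2) v by (intro mult_left_mono) auto
      also have "\<dots> = \<bar>coef a v\<bar> * K v * (\<bar>t\<bar> ^ length v * \<bar>t\<bar> ^ (N - length v))" by simp
      also have "\<bar>t\<bar> ^ length v * \<bar>t\<bar> ^ (N - length v) = \<bar>t\<bar> ^ N"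
        using v by (simp add: power_add[symmetric])
      finally show "\<bar>coef a v * t ^ length v * (word_op v f (\<Psi> t y) - trunc b (N - length v) t (word_op v f) y)\<bar>
          \<le> \<bar>coef a v\<bar> * K v * \<bar>t\<bar> ^ N" .
    qed
    finally have "\<bar>trunc a N t f (\<Psi> t y) - trunc (b * a) N t f y\<bar> \<le> (\<Sum>v\<in>?W. \<bar>coef a v\<bar> * K v) * \<bar>t\<bar> ^ N"
      by (simp add: sum_distrib_right)
    with elim(1) show ?case
      unfolding t_def[symmetric] y_def[symmetric] distrib_right by linarith
  qed
  then show "\<exists>C. \<forall>\<^sub>F z in nhds (0, x). \<bar>f (\<Phi> (fst z) (\<Psi> (fst z) (snd z))) - trunc (b * a) N (fst z) f (snd z)\<bar>
      \<le> C * \<bar>fst z\<bar> ^ N" by blast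
qed

lemma trunc_nexp:
  "trunc (nexp i c) N t f y = (\<Sum>m<N. word_op (replicate m i) f y / fact m * (c * t) ^ m)"
proof -
  let ?F = "\<lambda>w. coef (nexp i c) w * (t ^ length w * word_op w f y)"
  have "trunc (nexp i c) N t f y = sum ?F ((\<lambda>m. replicate m i) ` {..<N})"
    unfolding trunc_def
  proof (rule sum.mono_neutral_right[OF finite_words])
    show "\<forall>w\<in>{w. length w < N} - (\<lambda>m. replicate m i) ` {..<N}. ?F w = 0"
    proof
      fix w :: "'k list" assume w: "w \<in> {w. length w < N} - (\<lambda>m. replicate m i) ` {..<N}"
      then have "w \<noteq> replicate (length w) i" by (metis DiffD1 DiffD2 imageI lessThan_iff mem_Collect_eq)
      then show "?F w = 0" by (simp add: nexp_def)
    qed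
  qed auto
  also have "\<dots> = (\<Sum>m<N. ?F (replicate m i))"
    by (rule sum.reindex[unfolded o_def]) (auto intro: inj_onI dest: arg_cong[where f = length])
  also have "\<dots> = (\<Sum>m<N. word_op (replicate m i) f y / fact m * (c * t) ^ m)"
    by (simp add: nexp_def power_mult_distrib mult_ac)
  finally show ?thesis .
qed

text \<open>Each derivative of f along the flow line applies \<open>X i\<close> once more, so this
  is Maclaurin's formula. The constant is uniform in the starting point because the M-th derivative
  is continuous in time and point together and therefore bounded by \<open>K\<close> near (0,
  x).\<close>

lemma flow_has_expansion:
  assumes h: "0 < h" and N: "open N" "x \<in> N"
    and cont: "continuous_on ({- h<..<h} \<times> N) (\<lambda>z. \<Psi> (fst z) (snd z))" and \<Psi>0: "\<And>y. y \<in> N \<Longrightarrow> \<Psi> 0 y = y"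
    and der: "\<And>t y f. t \<in> {- h<..<h} \<Longrightarrow> y \<in> N \<Longrightarrow> f \<in> smooth_funs A \<Longrightarrow>
      ((\<lambda>s. f (\<Psi> s y)) has_real_derivative X i f (\<Psi> t y)) (at t)"
  shows "has_expansion x (\<lambda>t. \<Psi> (c * t)) (nexp i c)"
  unfolding has_expansion_def
proof (intro ballI allI impI)
  fix f and M :: nat assume f: "f \<in> smooth_funs A" and M: "0 < M"
  define D where "D m = word_op (replicate m i) f" for m
  have D: "D m \<in> smooth_funs A" for m unfolding D_def by (rule word_op_smooth[OF f])
  define K where "K = \<bar>D M x\<bar> + 1"
  let ?g = "\<lambda>z. D M (\<Psi> (fst z) (snd z))"
  have contg: "continuous_on ({- h<..<h} \<times> N) ?g"
    by (rule continuous_on_compose2[OF smooth_funs_continuous_on[OF D] cont]) auto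
  have "open (({- h<..<h} \<times> N) \<inter> ?g -` {- K<..<K})"
    by (rule continuous_open_preimage[OF contg]) (auto intro: open_Times N)
  moreover have "(0, x) \<in> ({- h<..<h} \<times> N) \<inter> ?g -` {- K<..<K}"
    using h N(2) \<Psi>0 by (auto simp: K_def)
  ultimately obtain T B where TB: "open T" "open B" "(0, x) \<in> T \<times> B" "T \<times> B \<subseteq> ({- h<..<h} \<times> N) \<inter> ?g -` {- K<..<K}"
    by (rule open_prod_elim)
  obtain \<delta> where \<delta>: "0 < \<delta>" "ball 0 \<delta> \<subseteq> T" using TB by (auto elim: openE)
  have bound: "\<bar>D M (\<Psi> \<theta> y)\<bar> \<le> K" "\<theta> \<in> {- h<..<h}" "y \<in> N" if "\<bar>\<theta>\<bar> < \<delta>" "y \<in> B" for \<theta> y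
  proof -
    have "\<theta> \<in> T" using that(1) \<delta>(2) by (auto simp: dist_norm subset_iff)
    then have "(\<theta>, y) \<in> ({- h<..<h} \<times> N) \<inter> ?g -` {- K<..<K}" using that(2) TB(4) by blast
    then show "\<bar>D M (\<Psi> \<theta> y)\<bar> \<le> K" "\<theta> \<in> {- h<..<h}" "y \<in> N" by auto
  qed
  have "\<forall>\<^sub>F z in nhds (0, x). \<bar>c * fst z\<bar> < \<delta> \<and> snd z \<in> B"
  proof (rule eventually_conj)
    have "((\<lambda>z::real \<times> 'a. \<bar>c * fst z\<bar>) \<longlongrightarrow> \<bar>c * fst (0::real, x)\<bar>) (nhds (0, x))"
      by (intro tendsto_intros filterlim_ident)
    then show "\<forall>\<^sub>F z in nhds (0, x). \<bar>c * fst z\<bar> < \<delta>"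
      using \<delta>(1) by (intro order_tendstoD) auto
    have "open (UNIV \<times> B :: (real \<times> 'a) set)" using TB by (auto intro: open_Times)
    then have "\<forall>\<^sub>F z in nhds (0::real, x). z \<in> UNIV \<times> B" using TB by (intro eventually_nhds_in_open) auto
    then show "\<forall>\<^sub>F z in nhds (0::real, x). snd z \<in> B" by eventually_elim auto
  qed
  then have "\<forall>\<^sub>F z in nhds (0, x). \<bar>f (\<Psi> (c * fst z) (snd z)) - trunc (nexp i c) M (fst z) f (snd z)\<bar>
      \<le> (K * \<bar>c\<bar> ^ M) * \<bar>fst z\<bar> ^ M"
  proof eventually_elim
    case (elim z)
    define t y where "t = fst z" and "y = snd z"
    have ty: "\<bar>c * t\<bar> < \<delta>" "y \<in> B" using elim by (auto simp: t_def y_def)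
    have "\<exists>\<theta>. \<bar>\<theta>\<bar> \<le> \<bar>c * t\<bar> \<and> f (\<Psi> (c * t) y) =
        (\<Sum>m<M. D m (\<Psi> 0 y) / fact m * (c * t) ^ m) + D M (\<Psi> \<theta> y) / fact M * (c * t) ^ M"
    proof (rule Maclaurin_bi_le)
      show "(\<lambda>s. D 0 (\<Psi> s y)) = (\<lambda>s. f (\<Psi> s y))" by (simp add: D_def)
      show "\<forall>m s. m < M \<and> \<bar>s\<bar> \<le> \<bar>c * t\<bar> \<longrightarrow> ((\<lambda>s. D m (\<Psi> s y)) has_real_derivative D (Suc m) (\<Psi> s y)) (at s)"
      proof (intro allI impI)
        fix m s assume "m < M \<and> \<bar>s\<bar> \<le> \<bar>c * t\<bar>"
        then have "\<bar>s\<bar> < \<delta>" using ty by linarith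
        from der[OF bound(2,3)[OF this ty(2)] D[of m]]
        show "((\<lambda>s. D m (\<Psi> s y)) has_real_derivative D (Suc m) (\<Psi> s y)) (at s)" by (simp add: D_def)
      qed
    qed
    then obtain \<theta> where \<theta>: "\<bar>\<theta>\<bar> \<le> \<bar>c * t\<bar>" "f (\<Psi> (c * t) y) =
        (\<Sum>m<M. D m (\<Psi> 0 y) / fact m * (c * t) ^ m) + D M (\<Psi> \<theta> y) / fact M * (c * t) ^ M" by blast
    have \<theta>\<delta>: "\<bar>\<theta>\<bar> < \<delta>" using \<theta>(1) ty by linarith
    have "f (\<Psi> (c * t) y) - trunc (nexp i c) M t f y = D M (\<Psi> \<theta> y) / fact M * (c * t) ^ M"
      using \<theta>(2) \<Psi>0[OF bound(3)[OF \<theta>\<delta> ty(2)]] by (simp add: trunc_nexp D_def)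
    moreover have "\<bar>D M (\<Psi> \<theta> y) / fact M * (c * t) ^ M\<bar> \<le> K * (\<bar>c\<bar> ^ M * \<bar>t\<bar> ^ M)"
    proof -
      have "\<bar>D M (\<Psi> \<theta> y)\<bar> / fact M \<le> \<bar>D M (\<Psi> \<theta> y)\<bar> / 1"
        by (intro divide_left_mono) (auto simp: fact_ge_1)
      also have "\<dots> \<le> K" using bound(1)[OF \<theta>\<delta> ty(2)] by simp
      finally show ?thesis
        unfolding abs_mult abs_divide power_abs power_mult_distrib by (intro mult_right_mono) auto
    qed
    ultimately show ?case unfolding t_def[symmetric] y_def[symmetric] by (simp add: mult.assoc)
  qed
  then show "\<exists>C. \<forall>\<^sub>F z in nhds (0, x). \<bar>f (\<Psi> (c * fst z) (snd z)) - trunc (nexp i c) M (fst z) f (snd z)\<bar>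
      \<le> C * \<bar>fst z\<bar> ^ M" by blast
qed

text \<open>Substitution of the fields for the variables. For \<open>B\<close> homogeneous of degree
  n only words of length exactly n count; the range of summation is that of \<open>trunc\<close> at
  order n + 1.\<close>

definition homogeneous_op :: "nat \<Rightarrow> 'k ncps \<Rightarrow> 'a vfield" where
  "homogeneous_op n B f y = (\<Sum>w\<in>{w. length w < Suc n}. coef B w * word_op w f y)"

text \<open>Truncation at order n + 1 sees of the series only 1 + B.\<close>

lemma expansion_leading_term:
  assumes \<Phi>: "has_expansion x \<Phi> a" and B: "ord_ge (Suc n) (a - 1 - B)" "homogeneous n B" and f: "f \<in> smooth_funs A"
  shows "\<exists>C. \<forall>\<^sub>F z in nhds (0, x).
    \<bar>f (\<Phi> (fst z) (snd z)) - f (snd z) - fst z ^ n * homogeneous_op n B f (snd z)\<bar> \<le> C * \<bar>fst z\<bar> ^ Suc n"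
proof -
  have "trunc a (Suc n) t f y = f y + t ^ n * homogeneous_op n B f y" for t y
  proof -
    have "trunc a (Suc n) t f y = trunc 1 (Suc n) t f y
        + (\<Sum>w\<in>{w. length w < Suc n}. coef B w * (t ^ length w * word_op w f y))"
      unfolding trunc_def sum.distrib[symmetric]
    proof (rule sum.cong[OF refl])
      fix w :: "'k list" assume "w \<in> {w. length w < Suc n}"
      then have "coef (a - 1 - B) w = 0" using B(1) by (simp add: ord_ge_def)
      then have "coef a w = coef 1 w + coef B w" by simp
      then show "coef a w * (t ^ length w * word_op w f y) =
          coef 1 w * (t ^ length w * word_op w f y) + coef B w * (t ^ length w * word_op w f y)"
        by (simp add: distrib_right)
    qed
    also have "(\<Sum>w\<in>{w. length w < Suc n}. coef B w * (t ^ length w * word_op w f y)) = t ^ n * homogeneous_op n B f y"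
      unfolding homogeneous_op_def sum_distrib_left
      using B(2) by (intro sum.cong) (auto simp: homogeneous_def)
    finally show ?thesis by (simp add: trunc_1)
  qed
  moreover have "\<exists>C. \<forall>\<^sub>F z in nhds (0, x). \<bar>f (\<Phi> (fst z) (snd z)) - trunc a (Suc n) (fst z) f (snd z)\<bar> \<le> C * \<bar>fst z\<bar> ^ Suc n"
    using \<Phi> f unfolding has_expansion_def by blast
  ultimately show ?thesis by (simp add: diff_diff_eq)
qed

end

section \<open>The Lie triple system and iterated brackets\<close>

context control_system
begin

text \<open>Products of vector fields are not derivations, but bracket computations with their
  combinations need only linearity on smooth functions and smooth results.\<close>

definition linear_op :: "'a vfield \<Rightarrow> bool" where
  "linear_op Y \<longleftrightarrow> (\<forall>f\<in>smooth_funs A. Y f \<in> smooth_funs A) \<and>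
     (\<forall>f\<in>smooth_funs A. \<forall>g\<in>smooth_funs A. Y (\<lambda>x. f x + g x) = (\<lambda>x. Y f x + Y g x)) \<and>
     (\<forall>f\<in>smooth_funs A. \<forall>c. Y (\<lambda>x. c * f x) = (\<lambda>x. c * Y f x))"

lemma
  assumes "linear_op Y"
  shows linear_op_smooth: "f \<in> smooth_funs A \<Longrightarrow> Y f \<in> smooth_funs A"
    and linear_op_add: "f \<in> smooth_funs A \<Longrightarrow> g \<in> smooth_funs A \<Longrightarrow> Y (\<lambda>x. f x + g x) = (\<lambda>x. Y f x + Y g x)"
    and linear_op_scale: "f \<in> smooth_funs A \<Longrightarrow> Y (\<lambda>x. c * f x) = (\<lambda>x. c * Y f x)"
  using assms by (auto simp: linear_op_def)

lemma linear_op_zero: "linear_op Y \<Longrightarrow> Y (\<lambda>x. 0) = (\<lambda>x. 0)"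
  using linear_op_scale[OF _ smooth_funs_const, of Y 0 0] by simp

lemma linear_op_X: "linear_op (X i)"
  using vector_fields[of i] by (simp add: linear_op_def smooth_vector_field_def)

lemma linear_op_word_op: "linear_op (word_op w)"
proof (induction w)
  case (Cons i w)
  then show ?case
    unfolding linear_op_def
    by (auto simp: linear_op_add[OF Cons] linear_op_scale[OF Cons] linear_op_add[OF linear_op_X]
        linear_op_scale[OF linear_op_X] linear_op_smooth[OF Cons] linear_op_smooth[OF linear_op_X])
qed (simp add: linear_op_def)

lemma linear_op_opspan:
  assumes "Y \<in> opspan G" "\<And>Z. Z \<in> G \<Longrightarrow> linear_op Z"
  shows "linear_op Y"
  using assms(1)
proof induction
  case (add Y Z)
  then show ?case
    unfolding linear_op_def by (auto simp: smooth_funs_add algebra_simps)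
next
  case (scale Y c)
  then show ?case
    unfolding linear_op_def by (auto simp: smooth_funs_scale algebra_simps)
qed (auto simp: linear_op_def[of "\<lambda>f x. 0"] smooth_funs_const assms(2))

lemma linear_op_homogeneous_op: "linear_op (homogeneous_op n B)"
  unfolding linear_op_def homogeneous_op_def[abs_def]
  by (auto simp: linear_op_add[OF linear_op_word_op] linear_op_scale[OF linear_op_word_op] sum.distrib
      sum_distrib_left algebra_simps intro!: smooth_funs_sum smooth_funs_scale word_op_smooth)

text \<open>The last letter of an operator word acts first, so a variable multiplied on the right
  amounts to replacing f by X i f. On the left it becomes an outer application of X i to a sum,
  which calls for linearity and hence for smooth f in the next lemma.\<close>

lemma homogeneous_op_times_nvar:
  "homogeneous_op (Suc n) (B * nvar i) f y = homogeneous_op n B (X i f) y"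
proof -
  have "homogeneous_op (Suc n) (B * nvar i) f y =
      (\<Sum>v\<in>{v. length v < Suc (Suc n)}. \<Sum>u\<in>{u. length u < Suc (Suc n) - length v}.
        coef B u * coef (nvar i) v * word_op (u @ v) f y)"
    unfolding homogeneous_op_def by (rule sum_coef_mult)
  also have "\<dots> = (\<Sum>v\<in>{v. length v < Suc (Suc n)}. if v = [i] then homogeneous_op n B (X i f) y else 0)"
    by (intro sum.cong refl) (auto simp: nvar_def homogeneous_op_def word_op_append)
  also have "\<dots> = homogeneous_op n B (X i f) y" by (simp add: finite_words)
  finally show ?thesis .
qed

lemma homogeneous_op_nvar_times:
  assumes B: "homogeneous n B" and f: "f \<in> smooth_funs A"
  shows "homogeneous_op (Suc n) (nvar i * B) f y = X i (homogeneous_op n B f) y"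
proof -
  have "homogeneous_op (Suc n) (nvar i * B) f y =
      (\<Sum>v\<in>{v. length v < Suc (Suc n)}. \<Sum>u\<in>{u. length u < Suc (Suc n) - length v}.
        coef (nvar i) u * coef B v * word_op (u @ v) f y)"
    unfolding homogeneous_op_def by (rule sum_coef_mult)
  also have "\<dots> = (\<Sum>v\<in>{v. length v < Suc (Suc n)}. coef B v * X i (word_op v f) y)"
  proof (intro sum.cong refl)
    fix v :: "'k list" assume v: "v \<in> {v. length v < Suc (Suc n)}"
    show "(\<Sum>u\<in>{u. length u < Suc (Suc n) - length v}. coef (nvar i) u * coef B v * word_op (u @ v) f y) =
        coef B v * X i (word_op v f) y"
    proof (cases "length v = n")
      case True
      have "(\<Sum>u\<in>{u. length u < Suc (Suc n) - length v}. coef (nvar i) u * coef B v * word_op (u @ v) f y) =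
          (\<Sum>u\<in>{u. length u < Suc (Suc n) - length v}. if u = [i] then coef B v * X i (word_op v f) y else 0)"
        by (intro sum.cong) (auto simp: nvar_def)
      then show ?thesis using True by (simp add: finite_words)
    next
      case False
      then show ?thesis using B by (simp add: homogeneous_def)
    qed
  qed
  also have "\<dots> = (\<Sum>v\<in>{v. length v < Suc n}. coef B v * X i (word_op v f) y)"
    using B by (intro sum.mono_neutral_right finite_words) (auto simp: homogeneous_def)
  also have "\<dots> = X i (homogeneous_op n B f) y"
    unfolding homogeneous_op_def[abs_def]
    by (subst vector_field_sum[OF vector_fields])
      (simp_all add: smooth_funs_scale word_op_smooth[OF f] vector_field_scale[OF vector_fields])
  finally show ?thesis .
qed

lemma homogeneous_op_bracket:
  assumes "homogeneous n B" "f \<in> smooth_funs A"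
  shows "homogeneous_op (Suc n) (B * nvar i - nvar i * B) f = lie_bracket (homogeneous_op n B) (X i) f"
proof
  fix y
  have "homogeneous_op (Suc n) (B * nvar i - nvar i * B) f y =
      homogeneous_op (Suc n) (B * nvar i) f y - homogeneous_op (Suc n) (nvar i * B) f y"
    by (simp add: homogeneous_op_def sum_subtractf left_diff_distrib)
  then show "homogeneous_op (Suc n) (B * nvar i - nvar i * B) f y = lie_bracket (homogeneous_op n B) (X i) f y"
    unfolding lie_bracket_def homogeneous_op_times_nvar homogeneous_op_nvar_times[OF assms] .
qed

section \<open>The span of the iterated brackets\<close>

definition bracket_ops :: "'a vfield set" where
  "bracket_ops = {homogeneous_op n B | n B. iterated_bracket n B}"

text \<open>Equality is demanded on smooth functions only, since a \<open>vfield\<close> is a map on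
  all real functions and its values on the others are unconstrained.\<close>

definition in_bracket_span :: "'a vfield \<Rightarrow> bool" where
  "in_bracket_span Y \<longleftrightarrow> (\<exists>Y'\<in>opspan bracket_ops. \<forall>f\<in>smooth_funs A. Y f = Y' f)"

lemma linear_op_bracket_span: "Y \<in> opspan bracket_ops \<Longrightarrow> linear_op Y"
  by (erule linear_op_opspan) (auto simp: bracket_ops_def linear_op_homogeneous_op)

lemma in_bracket_span_zero: "(\<And>f. f \<in> smooth_funs A \<Longrightarrow> Y f = (\<lambda>x. 0)) \<Longrightarrow> in_bracket_span Y"
  unfolding in_bracket_span_def by (rule bexI[OF _ opspan.zero]) simp

lemma in_bracket_span_add:
  assumes "in_bracket_span Y" "in_bracket_span Z" "\<And>f. f \<in> smooth_funs A \<Longrightarrow> W f = (\<lambda>x. Y f x + Z f x)"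
  shows "in_bracket_span W"
proof -
  obtain Y' Z' where YZ: "Y' \<in> opspan bracket_ops" "Z' \<in> opspan bracket_ops"
    "\<forall>f\<in>smooth_funs A. Y f = Y' f" "\<forall>f\<in>smooth_funs A. Z f = Z' f"
    using assms(1,2) unfolding in_bracket_span_def by blast
  show ?thesis
    unfolding in_bracket_span_def by (rule bexI[OF _ opspan.add[OF YZ(1,2)]]) (simp add: assms(3) YZ)
qed

lemma in_bracket_span_scale:
  assumes "in_bracket_span Y" "\<And>f. f \<in> smooth_funs A \<Longrightarrow> W f = (\<lambda>x. c * Y f x)"
  shows "in_bracket_span W"
proof -
  obtain Y' where Y: "Y' \<in> opspan bracket_ops" "\<forall>f\<in>smooth_funs A. Y f = Y' f"
    using assms(1) unfolding in_bracket_span_def by blast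
  show ?thesis
    unfolding in_bracket_span_def by (rule bexI[OF _ opspan.scale[OF Y(1), of c]]) (simp add: assms(2) Y)
qed

lemma in_bracket_span_opspan:
  assumes "Y \<in> opspan G" "\<And>Z. Z \<in> G \<Longrightarrow> in_bracket_span Z"
  shows "in_bracket_span Y"
  using assms(1)
proof induction
  case (add Y Z)
  show ?case by (rule in_bracket_span_add[OF add.IH]) simp
next
  case (scale Y c)
  show ?case by (rule in_bracket_span_scale[OF scale.IH, of _ c]) simp
next
  case zero
  show ?case by (rule in_bracket_span_zero) simp
qed (rule assms(2))

lemma in_bracket_span_X: "in_bracket_span (X i)"
proof -
  have "homogeneous_op 1 (nvar i) f y = X i f y" for f y
  proof -
    have "homogeneous_op 1 (nvar i) f y = (\<Sum>w\<in>{w. length w < Suc 1}. if w = [i] then X i f y else 0)"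
      unfolding homogeneous_op_def by (intro sum.cong refl) (auto simp: nvar_def)
    then show ?thesis by (simp add: finite_words)
  qed
  then have "X i = homogeneous_op 1 (nvar i)" by (intro ext) simp
  moreover have "homogeneous_op 1 (nvar i) \<in> opspan bracket_ops"
    by (rule opspan.gen, unfold bracket_ops_def) (blast intro: iterated_bracket.var)
  ultimately show ?thesis unfolding in_bracket_span_def by metis
qed

text \<open>For a single iterated bracket this is the rule \<open>iterated_bracket.bracket\<close>,
  read as operators; linearity of the Lie bracket in \<open>Y\<close> extends it to the
  span.\<close>

lemma in_bracket_span_lie_bracket_X:
  assumes "Y \<in> opspan bracket_ops" shows "in_bracket_span (lie_bracket Y (X i))"
  using assms
proof induction
  case zero
  then show ?case
    by (rule in_bracket_span_zero) (simp add: lie_bracket_def linear_op_zero[OF linear_op_X])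
next
  case (gen Y)
  then obtain n B where B: "iterated_bracket n B" "Y = homogeneous_op n B" by (auto simp: bracket_ops_def)
  have "homogeneous_op (Suc n) (B * nvar i - nvar i * B) \<in> opspan bracket_ops"
    by (rule opspan.gen, unfold bracket_ops_def) (blast intro: iterated_bracket.bracket B(1))
  then show ?case
    unfolding in_bracket_span_def
    using homogeneous_op_bracket[OF iterated_bracket_homogeneous[OF B(1)]] B(2) by metis
next
  case (add Y Z)
  note lin = linear_op_bracket_span[OF add.hyps(1)] linear_op_bracket_span[OF add.hyps(2)]
  show ?case
    by (rule in_bracket_span_add[OF add.IH])
      (simp add: lie_bracket_def linear_op_add[OF linear_op_X] lin[THEN linear_op_smooth] fun_eq_iff)
next
  case (scale Y c)
  note lin = linear_op_bracket_span[OF scale.hyps(1)]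
  show ?case
    by (rule in_bracket_span_scale[OF scale.IH, of _ c])
      (simp add: lie_bracket_def linear_op_scale[OF linear_op_X] lin[THEN linear_op_smooth] fun_eq_iff algebra_simps)
qed

lemma in_bracket_span_lie_bracket:
  assumes Y: "in_bracket_span Y" and C: "C \<in> opspan (range X)"
  shows "in_bracket_span (lie_bracket Y C)"
proof -
  obtain Y' where Y': "Y' \<in> opspan bracket_ops" "\<And>f. f \<in> smooth_funs A \<Longrightarrow> Y f = Y' f"
    using Y unfolding in_bracket_span_def by blast
  note linY = linear_op_bracket_span[OF Y'(1)]
  have linC: "linear_op C" if "C \<in> opspan (range X)" for C
    using that by (rule linear_op_opspan) (auto simp: linear_op_X)
  have "in_bracket_span (lie_bracket Y' C)" using C
  proof induction
    case zero
    then show ?case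
      by (rule in_bracket_span_zero) (simp add: lie_bracket_def linear_op_zero[OF linY])
  next
    case (gen C)
    then show ?case using in_bracket_span_lie_bracket_X[OF Y'(1)] by auto
  next
    case (add C D)
    note lin = linC[OF add.hyps(1)] linC[OF add.hyps(2)]
    show ?case
      by (rule in_bracket_span_add[OF add.IH])
        (simp add: lie_bracket_def linear_op_add[OF linY] lin[THEN linear_op_smooth] fun_eq_iff)
  next
    case (scale C c)
    note lin = linC[OF scale.hyps(1)]
    show ?case
      by (rule in_bracket_span_scale[OF scale.IH, of _ c])
        (simp add: lie_bracket_def linear_op_scale[OF linY] lin[THEN linear_op_smooth] fun_eq_iff algebra_simps)
  qed
  \<comment> \<open>The factor 1 merely transfers membership from the bracket with Y' to the one
    with Y: the two agree on smooth functions because C maps these to smooth functions.\<close>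
  then show ?thesis
    by (rule in_bracket_span_scale[of _ _ 1])
      (simp add: lie_bracket_def Y'(2) linear_op_smooth[OF linC[OF C]])
qed

text \<open>Antisymmetry, [[A, B], C] = -[[B, A], C], brings the deep factor B to the left;
  bracketing with A and then with C extends left-normed brackets twice. This is the origin of the
  scale factor -1.\<close>

lemma Theta_in_bracket_span: "Y \<in> Theta X (Suc p) \<Longrightarrow> in_bracket_span Y"
proof (induction p arbitrary: Y)
  case 0
  then show ?case by (auto intro: in_bracket_span_opspan in_bracket_span_X)
next
  case (Suc p)
  then obtain P Q where PQ: "Y = (\<lambda>f x. P f x + Q f x)" "P \<in> Theta X (Suc p)"
    "Q \<in> opspan {lie_bracket (lie_bracket A B) C | A B C.
        A \<in> Theta X (Suc 0) \<and> B \<in> Theta X (Suc p) \<and> C \<in> Theta X (Suc 0)}"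
    by auto
  have "in_bracket_span Q"
  proof (rule in_bracket_span_opspan[OF PQ(3)])
    fix Z assume "Z \<in> {lie_bracket (lie_bracket A B) C | A B C.
        A \<in> Theta X (Suc 0) \<and> B \<in> Theta X (Suc p) \<and> C \<in> Theta X (Suc 0)}"
    then obtain A' B' C' where Z: "Z = lie_bracket (lie_bracket A' B') C'" "A' \<in> opspan (range X)"
      "B' \<in> Theta X (Suc p)" "C' \<in> opspan (range X)" by auto
    have "in_bracket_span (lie_bracket A' B')"
      by (rule in_bracket_span_scale[OF in_bracket_span_lie_bracket[OF Suc.IH[OF Z(3)] Z(2)], of _ "-1"])
        (simp add: lie_bracket_def)
    then show "in_bracket_span Z" unfolding Z(1) using Z(4) by (rule in_bracket_span_lie_bracket)
  qed
  with Suc.IH[OF PQ(2)] show ?case by (rule in_bracket_span_add) (simp add: PQ(1))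
qed

lemma LTS_in_bracket_span: "Y \<in> LTS X \<Longrightarrow> in_bracket_span Y"
  unfolding LTS_def using Theta_in_bracket_span by (auto simp: Suc_le_eq dest!: gr0_implies_Suc)

text \<open>By the rank condition each coordinate derivation at x is the value of some Y in
  \<open>LTS X\<close>, and evaluating Y on the coordinate functions gives a standard basis vector.
  Replacing Y by a combination of iterated brackets puts that vector into the span.\<close>

lemma bracket_values_span:
  assumes rank: "LTS_at A X x = tangent_space A x" and U: "(U, \<phi>) \<in> A" "x \<in> U"
    and c: "\<And>l. c l \<in> smooth_funs A" and W: "open W" "x \<in> W" "W \<subseteq> U" "\<And>l y. y \<in> W \<Longrightarrow> c l y = \<phi> y $ l"
  shows "span ((\<lambda>Z. \<chi> l. Z (c l) x) ` bracket_ops) = (UNIV :: (real^'n) set)"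
proof -
  let ?val = "\<lambda>Z. (\<chi> l. Z (c l) x) :: real^'n"
  have opspan: "?val Y \<in> span (?val ` bracket_ops)" if "Y \<in> opspan bracket_ops" for Y
    using that
  proof induction
    case zero
    have "?val (\<lambda>f x. 0) = 0" by (simp add: vec_eq_iff)
    then show ?case by (metis span_zero)
  next
    case (gen Y)
    then show ?case by (auto intro: span_base)
  next
    case (add Y Z)
    have "?val (\<lambda>f x. Y f x + Z f x) = ?val Y + ?val Z" by (simp add: vec_eq_iff)
    then show ?case using span_add[OF add.IH] by metis
  next
    case (scale Y a)
    have "?val (\<lambda>f x. a * Y f x) = a *\<^sub>R ?val Y" by (simp add: vec_eq_iff)
    then show ?case using span_scale[OF scale.IH] by metis
  qed
  have ax: "axis l 1 \<in> span (?val ` bracket_ops)" for l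
  proof -
    let ?D = "\<lambda>f. frechet_derivative (\<lambda>q. f (inv_into U \<phi> q)) (at (\<phi> x)) (axis l 1)"
    have "restrict ?D (smooth_funs A) \<in> LTS_at A X x"
      unfolding rank by (rule coordinate_derivation_in_tangent_space[OF U])
    then obtain Y where Y: "Y \<in> LTS X" "restrict ?D (smooth_funs A) = restrict (\<lambda>f. Y f x) (smooth_funs A)"
      unfolding LTS_at_def by blast
    have Yx: "Y f x = ?D f" if "f \<in> smooth_funs A" for f
      using fun_cong[OF Y(2), of f] that by simp
    obtain Y' where Y': "Y' \<in> opspan bracket_ops" "\<forall>f\<in>smooth_funs A. Y f = Y' f"
      using LTS_in_bracket_span[OF Y(1)] unfolding in_bracket_span_def by blast
    have imW: "open (\<phi> ` W)" using chart_open_map[OF U(1) W(1)] W(3) by (simp add: Int_absorb1)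
    have "?D (c k) = axis l 1 $ k" for k
    proof -
      have "((\<lambda>q. q $ k) has_derivative (\<lambda>q. q $ k)) (at (\<phi> x))"
        by (rule bounded_linear_imp_has_derivative[OF bounded_linear_vec_nth])
      then have "((\<lambda>q. c k (inv_into U \<phi> q)) has_derivative (\<lambda>q. q $ k)) (at (\<phi> x))"
      proof (rule has_derivative_transform_within_open[OF _ imW])
        show "\<phi> x \<in> \<phi> ` W" using W(2) by blast
        fix q assume "q \<in> \<phi> ` W"
        then obtain y where "y \<in> W" "q = \<phi> y" by blast
        then show "q $ k = c k (inv_into U \<phi> q)" using W(3,4) chart_inv[OF U(1)] by auto
      qed
      then show ?thesis by (simp add: frechet_derivative_eqI)
    qed
    then have "?val Y' = axis l 1" using Y'(2) Yx[OF c] c by (simp add: vec_eq_iff)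
    with opspan[OF Y'(1)] show ?thesis by simp
  qed
  have "v \<in> span (?val ` bracket_ops)" for v :: "real^'n"
  proof -
    have "v = (\<Sum>l\<in>UNIV. v $ l *\<^sub>R axis l 1)"
      using basis_expansion[of v] by (simp add: scalar_mult_eq_scaleR)
    also have "\<dots> \<in> span (?val ` bracket_ops)" by (intro span_sum span_scale ax)
    finally show ?thesis .
  qed
  then show ?thesis by blast
qed

end

section \<open>Reachability\<close>

lemma measurable_on_piecewise:
  fixes f g :: "'b::euclidean_space \<Rightarrow> real"
  assumes "f measurable_on S" "g measurable_on T" "S \<inter> T = {}"
  shows "(\<lambda>x. if x \<in> S then f x else g x) measurable_on (S \<union> T)"
proof -
  have "(\<lambda>x. (if x \<in> S then f x else 0) + (if x \<in> T then g x else 0)) measurable_on UNIV"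
    using assms(1,2) by (intro measurable_on_add) (simp_all add: measurable_on_UNIV)
  moreover have "(\<lambda>x. (if x \<in> S then f x else 0) + (if x \<in> T then g x else 0)) =
      (\<lambda>x. if x \<in> S \<union> T then (if x \<in> S then f x else g x) else 0)"
    using assms(3) by (auto simp: fun_eq_iff)
  ultimately show ?thesis by (simp only: measurable_on_UNIV)
qed

lemma has_integral_piecewise:
  fixes f g :: "real \<Rightarrow> real"
  assumes "(f has_integral I) {a..b}" "(g has_integral J) {b..c}" "a \<le> b" "b \<le> c"
  shows "((\<lambda>s. if s \<le> b then f s else g s) has_integral (I + J)) {a..c}"
proof (rule has_integral_combine[OF assms(3,4)])
  show "((\<lambda>s. if s \<le> b then f s else g s) has_integral I) {a..b}"
    using assms(1) by (rule has_integral_eq[rotated]) auto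
  \<comment> \<open>At the common endpoint \<open>b\<close> the combined function takes the value of
    \<open>f\<close>; one point does not affect the integral.\<close>
  show "((\<lambda>s. if s \<le> b then f s else g s) has_integral J) {b..c}"
    using assms(2) by (rule has_integral_spike_finite[of "{b}", rotated 2]) auto
qed

lemma L2_control_append:
  assumes u: "L2_control tf u" and "0 \<le> tf" "0 \<le> T"
  shows "L2_control (tf + T) (\<lambda>s. if s \<le> tf then u s else e)"
  unfolding L2_control_def
proof (intro allI conjI)
  fix i
  have "(\<lambda>s. if s \<in> {0..tf} then u s $ i else e $ i) measurable_on ({0..tf} \<union> {tf<..tf + T})"
    using u by (intro measurable_on_piecewise) (auto simp: L2_control_def)
  moreover have "{0..tf} \<union> {tf<..tf + T} = {0..tf + T}" using assms by auto
  ultimately have "(\<lambda>s. if s \<in> {0..tf} then u s $ i else e $ i) measurable_on {0..tf + T}" by simp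
  then show "(\<lambda>s. (if s \<le> tf then u s else e) $ i) measurable_on {0..tf + T}"
    by (rule measurable_on_spike[OF _ negligible_empty]) auto
  have "(\<lambda>s. (u s $ i)\<^sup>2) integrable_on {0..tf}" using u by (simp add: L2_control_def)
  then obtain I where I: "((\<lambda>s. (u s $ i)\<^sup>2) has_integral I) {0..tf}" by blast
  have "((\<lambda>s. (e $ i)\<^sup>2) has_integral (T * (e $ i)\<^sup>2)) {tf..tf + T}"
    using has_integral_const_real[of "(e $ i)\<^sup>2" tf "tf + T"] assms by simp
  from has_integral_piecewise[OF I this] assms
  have "(\<lambda>s. if s \<le> tf then (u s $ i)\<^sup>2 else (e $ i)\<^sup>2) integrable_on {0..tf + T}"
    by (auto simp: integrable_on_def)
  moreover have "(\<lambda>s. ((if s \<le> tf then u s else e) $ i)\<^sup>2) = (\<lambda>s. if s \<le> tf then (u s $ i)\<^sup>2 else (e $ i)\<^sup>2)"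
    by auto
  ultimately show "(\<lambda>s. ((if s \<le> tf then u s else e) $ i)\<^sup>2) integrable_on {0..tf + T}" by simp
qed

section \<open>Extending trajectories by constant controls\<close>

context control_system
begin

lemma reachable_set_refl: "x \<in> reachable_set A X x"
proof -
  have "L2_control 0 (\<lambda>s. 0 :: real^'k)" by (auto simp: L2_control_def intro: integrable_0)
  moreover have "is_solution A X (\<lambda>s. 0) 0 x (\<lambda>s. x)" by (auto simp: is_solution_def)
  ultimately show ?thesis unfolding reachable_set_def by blast
qed

text \<open>The given trajectory has merely an integrable right-hand side, so its integral identity
  is kept as it stands; on the appended piece, driven by the constant control \<open>e\<close>, the
  identity comes from the fundamental theorem of calculus. Splitting at the switching time joins the
  two.\<close>

lemma reachable_set_append:
  assumes y: "y \<in> reachable_set A X y0" and T: "0 \<le> T" and \<beta>0: "\<beta> 0 = y" and cont: "continuous_on {0..T} \<beta>"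
    and der: "\<And>f s. f \<in> smooth_funs A \<Longrightarrow> s \<in> {0..T} \<Longrightarrow>
      ((\<lambda>s. f (\<beta> s)) has_real_derivative (\<Sum>j\<in>UNIV. e $ j * X j f (\<beta> s))) (at s within {0..T})"
  shows "\<beta> T \<in> reachable_set A X y0"
proof -
  obtain tf u \<gamma> where tf: "0 \<le> tf" and u: "L2_control tf u" and sol: "is_solution A X u tf y0 \<gamma>" and end': "\<gamma> tf = y"
    using y unfolding reachable_set_def by blast
  define u' where "u' s = (if s \<le> tf then u s else e)" for s
  define \<gamma>' where "\<gamma>' s = (if s \<le> tf then \<gamma> s else \<beta> (s - tf))" for s
  have "is_solution A X u' (tf + T) y0 \<gamma>'"
    unfolding is_solution_def
  proof (intro conjI ballI)
    show "\<gamma>' 0 = y0" using sol tf by (simp add: \<gamma>'_def is_solution_def)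
    have "continuous_on ({0..tf} \<union> {tf..tf + T}) (\<lambda>s. if s \<le> tf then \<gamma> s else \<beta> (s - tf))"
    proof (rule continuous_on_cases)
      show "continuous_on {0..tf} \<gamma>" using sol by (simp add: is_solution_def)
      show "continuous_on {tf..tf + T} (\<lambda>s. \<beta> (s - tf))"
        by (rule continuous_on_compose2[OF cont]) (auto intro!: continuous_intros)
    qed (auto simp: end' \<beta>0)
    moreover have "{0..tf} \<union> {tf..tf + T} = {0..tf + T}" using tf T by auto
    ultimately show "continuous_on {0..tf + T} \<gamma>'" by (simp add: \<gamma>'_def[abs_def])
    fix f t assume f: "f \<in> smooth_funs A" and t: "t \<in> {0..tf + T}"
    have int: "((\<lambda>s. \<Sum>i\<in>UNIV. u s $ i * X i f (\<gamma> s)) has_integral (f (\<gamma> r) - f y0)) {0..r}" if "r \<in> {0..tf}" for r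
      using sol f that by (simp add: is_solution_def)
    show "((\<lambda>s. \<Sum>i\<in>UNIV. u' s $ i * X i f (\<gamma>' s)) has_integral (f (\<gamma>' t) - f y0)) {0..t}"
    proof (cases "t \<le> tf")
      case True
      have "((\<lambda>s. \<Sum>i\<in>UNIV. u' s $ i * X i f (\<gamma>' s)) has_integral (f (\<gamma> t) - f y0)) {0..t}"
        by (rule has_integral_eq[OF _ int[of t]]) (use True t in \<open>auto simp: u'_def \<gamma>'_def\<close>)
      then show ?thesis using True by (simp add: \<gamma>'_def)
    next
      case False
      have "((\<lambda>s. \<Sum>j\<in>UNIV. e $ j * X j f (\<beta> (s - tf))) has_integral (f (\<beta> (t - tf)) - f (\<beta> (tf - tf)))) {tf..t}"
      proof (rule fundamental_theorem_of_calculus)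
        fix s assume s: "s \<in> {tf..t}"
        have 1: "((\<lambda>s. s - tf) has_real_derivative 1) (at s within {tf..t})"
          by (auto intro!: derivative_eq_intros)
        have sub: "(\<lambda>s. s - tf) ` {tf..t} \<subseteq> {0..T}" using t by auto
        have "((\<lambda>s. f (\<beta> s)) has_real_derivative (\<Sum>j\<in>UNIV. e $ j * X j f (\<beta> (s - tf))))
            (at (s - tf) within (\<lambda>s. s - tf) ` {tf..t})"
          by (rule DERIV_subset[OF der[OF f] sub]) (use s t in auto)
        from DERIV_image_chain[OF this 1]
        show "((\<lambda>s. f (\<beta> (s - tf))) has_vector_derivative (\<Sum>j\<in>UNIV. e $ j * X j f (\<beta> (s - tf)))) (at s within {tf..t})"
          by (simp add: has_real_derivative_iff_has_vector_derivative o_def)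
      qed (use False in simp)
      from has_integral_piecewise[OF int[of tf] this] tf False
      have "((\<lambda>s. if s \<le> tf then \<Sum>i\<in>UNIV. u s $ i * X i f (\<gamma> s) else \<Sum>j\<in>UNIV. e $ j * X j f (\<beta> (s - tf)))
          has_integral (f (\<beta> (t - tf)) - f y0)) {0..t}"
        by (simp add: end' \<beta>0)
      then have "((\<lambda>s. \<Sum>i\<in>UNIV. u' s $ i * X i f (\<gamma>' s)) has_integral (f (\<beta> (t - tf)) - f y0)) {0..t}"
        by (rule has_integral_eq[rotated]) (auto simp: u'_def \<gamma>'_def)
      then show ?thesis using False by (simp add: \<gamma>'_def)
    qed
  qed
  moreover have "L2_control (tf + T) u'"
    unfolding u'_def by (rule L2_control_append[OF u tf T])
  moreover have "\<gamma>' (tf + T) = \<beta> T" using T end' \<beta>0 by (auto simp: \<gamma>'_def)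
  ultimately show ?thesis
    unfolding reachable_set_def using tf T by (metis (mono_tags, lifting) add_nonneg_nonneg mem_Collect_eq)
qed

text \<open>Controls may be negative, so a flow can be run backwards: time t is reached after
  duration |t| under the control with entry \<epsilon> = 1 or -1 in position
  \<open>i\<close>.\<close>

lemma reachable_set_flow:
  assumes y: "y \<in> reachable_set A X y0" and t: "t \<in> {- h<..<h}" and \<Psi>0: "\<Psi> 0 = y"
    and cont: "continuous_on {- h<..<h} \<Psi>"
    and der: "\<And>t f. t \<in> {- h<..<h} \<Longrightarrow> f \<in> smooth_funs A \<Longrightarrow>
      ((\<lambda>s. f (\<Psi> s)) has_real_derivative X i f (\<Psi> t)) (at t)"
  shows "\<Psi> t \<in> reachable_set A X y0"
proof -
  define \<epsilon> :: real where "\<epsilon> = (if t \<ge> 0 then 1 else - 1)"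
  have in_h: "\<epsilon> * s \<in> {- h<..<h}" if "s \<in> {0..\<bar>t\<bar>}" for s
    using that t by (auto simp: \<epsilon>_def split: if_splits)
  have "(\<lambda>s. \<Psi> (\<epsilon> * s)) \<bar>t\<bar> \<in> reachable_set A X y0"
  proof (rule reachable_set_append[OF y, where e = "axis i \<epsilon>" and \<beta> = "\<lambda>s. \<Psi> (\<epsilon> * s)" and T = "\<bar>t\<bar>"])
    show "continuous_on {0..\<bar>t\<bar>} (\<lambda>s. \<Psi> (\<epsilon> * s))"
      by (rule continuous_on_compose2[OF cont]) (use in_h in \<open>auto intro!: continuous_intros\<close>)
    fix f s assume f: "f \<in> smooth_funs A" and s: "s \<in> {0..\<bar>t\<bar>}"
    have "((\<lambda>s. \<epsilon> * s) has_real_derivative \<epsilon>) (at s)" by (auto intro!: derivative_eq_intros)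
    from DERIV_chain2[OF der[OF in_h[OF s] f] this]
    have "((\<lambda>s. f (\<Psi> (\<epsilon> * s))) has_real_derivative \<epsilon> * X i f (\<Psi> (\<epsilon> * s))) (at s)" by (simp add: mult.commute)
    moreover have "(\<Sum>j\<in>UNIV. axis i \<epsilon> $ j * X j f (\<Psi> (\<epsilon> * s))) = \<epsilon> * X i f (\<Psi> (\<epsilon> * s))"
      by (subst sum.mono_neutral_cong_right[of UNIV "{i}" _ "\<lambda>j. axis i \<epsilon> $ j * X j f (\<Psi> (\<epsilon> * s))"])
        (auto simp: axis_def)
    ultimately show "((\<lambda>s. f (\<Psi> (\<epsilon> * s))) has_real_derivative
        (\<Sum>j\<in>UNIV. axis i \<epsilon> $ j * X j f (\<Psi> (\<epsilon> * s)))) (at s within {0..\<bar>t\<bar>})"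
      by (simp add: has_field_derivative_at_within)
  qed (auto simp: \<Psi>0)
  moreover have "\<epsilon> * \<bar>t\<bar> = t" by (simp add: \<epsilon>_def)
  ultimately show ?thesis by simp
qed

end

section \<open>Continuous families of motions that preserve reachability\<close>

context control_system
begin

text \<open>The parameter is a time for single motions and a vector of parameters for the final map.
  Mapping each reachable set into itself, instead of reaching \<open>\<Phi> p y\<close> from
  \<open>y\<close>, makes the property compose without a separate transitivity of
  reachability.\<close>

definition admissible :: "'p::topological_space \<Rightarrow> 'a \<Rightarrow> ('p \<Rightarrow> 'a \<Rightarrow> 'a) \<Rightarrow> bool" where
  "admissible p0 x \<Phi> \<longleftrightarrow> (\<exists>W. open W \<and> (p0, x) \<in> W \<and> continuous_on W (\<lambda>z. \<Phi> (fst z) (snd z)) \<and>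
     (\<forall>y. (p0, y) \<in> W \<longrightarrow> \<Phi> p0 y = y) \<and>
     (\<forall>p y y0. (p, y) \<in> W \<longrightarrow> y \<in> reachable_set A X y0 \<longrightarrow> \<Phi> p y \<in> reachable_set A X y0))"

lemma admissibleE:
  assumes "admissible p0 x \<Phi>"
  obtains W where "open W" "(p0, x) \<in> W" "continuous_on W (\<lambda>z. \<Phi> (fst z) (snd z))"
    "\<And>y. (p0, y) \<in> W \<Longrightarrow> \<Phi> p0 y = y"
    "\<And>p y y0. (p, y) \<in> W \<Longrightarrow> y \<in> reachable_set A X y0 \<Longrightarrow> \<Phi> p y \<in> reachable_set A X y0"
  using assms unfolding admissible_def by blast

lemma admissible_id: "admissible p0 x (\<lambda>p y. y)"
  unfolding admissible_def by (intro exI[of _ UNIV]) (auto intro: continuous_intros)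

lemma admissible_compose:
  assumes "admissible p0 x \<Phi>" "admissible p0 x \<Psi>"
  shows "admissible p0 x (\<lambda>p y. \<Phi> p (\<Psi> p y))"
proof -
  obtain V where V: "open V" "(p0, x) \<in> V" "continuous_on V (\<lambda>z. \<Phi> (fst z) (snd z))"
    "\<And>y. (p0, y) \<in> V \<Longrightarrow> \<Phi> p0 y = y"
    "\<And>p y y0. (p, y) \<in> V \<Longrightarrow> y \<in> reachable_set A X y0 \<Longrightarrow> \<Phi> p y \<in> reachable_set A X y0"
    using assms(1) by (rule admissibleE) blast
  obtain W where W: "open W" "(p0, x) \<in> W" "continuous_on W (\<lambda>z. \<Psi> (fst z) (snd z))"
    "\<And>y. (p0, y) \<in> W \<Longrightarrow> \<Psi> p0 y = y"
    "\<And>p y y0. (p, y) \<in> W \<Longrightarrow> y \<in> reachable_set A X y0 \<Longrightarrow> \<Psi> p y \<in> reachable_set A X y0"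
    using assms(2) by (rule admissibleE) blast
  let ?g = "\<lambda>z. (fst z, \<Psi> (fst z) (snd z))"
  have g: "continuous_on W ?g" by (intro continuous_intros W)
  show ?thesis
    unfolding admissible_def
  proof (intro exI[of _ "W \<inter> ?g -` V"] conjI allI impI)
    show "open (W \<inter> ?g -` V)" by (rule continuous_open_preimage[OF g W(1) V(1)])
    show "(p0, x) \<in> W \<inter> ?g -` V" using W V by auto
    show "continuous_on (W \<inter> ?g -` V) (\<lambda>z. \<Phi> (fst z) (\<Psi> (fst z) (snd z)))"
      using continuous_on_compose2[OF V(3) continuous_on_subset[OF g], of "W \<inter> ?g -` V"] by auto
    show "\<Phi> p0 (\<Psi> p0 y) = y" if "(p0, y) \<in> W \<inter> ?g -` V" for y
      using that W(4)[of y] V(4)[of y] by auto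
    show "\<Phi> p (\<Psi> p y) \<in> reachable_set A X y0"
      if "(p, y) \<in> W \<inter> ?g -` V" "y \<in> reachable_set A X y0" for p y y0
      using that W(5)[of p y y0] V(5)[of p "\<Psi> p y" y0] by auto
  qed
qed

lemma admissible_reparam:
  assumes "admissible p0 x \<Phi>" and g: "continuous_on UNIV g" "g q0 = p0"
  shows "admissible q0 x (\<lambda>q. \<Phi> (g q))"
proof -
  obtain W where W: "open W" "(p0, x) \<in> W" "continuous_on W (\<lambda>z. \<Phi> (fst z) (snd z))"
    "\<And>y. (p0, y) \<in> W \<Longrightarrow> \<Phi> p0 y = y"
    "\<And>p y y0. (p, y) \<in> W \<Longrightarrow> y \<in> reachable_set A X y0 \<Longrightarrow> \<Phi> p y \<in> reachable_set A X y0"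
    using assms(1) by (rule admissibleE) blast
  let ?g = "\<lambda>z. (g (fst z), snd z)"
  have cg: "continuous_on S ?g" for S
    by (intro continuous_intros continuous_on_compose2[OF g(1)]) auto
  show ?thesis
    unfolding admissible_def
  proof (intro exI[of _ "?g -` W"] conjI allI impI)
    show "open (?g -` W)" using cg W(1) by (intro open_vimage)
    show "(q0, x) \<in> ?g -` W" using W g by auto
    show "continuous_on (?g -` W) (\<lambda>z. \<Phi> (g (fst z)) (snd z))"
      using continuous_on_compose2[OF W(3) cg, of "?g -` W"] by auto
    show "\<Phi> (g q0) y = y" if "(q0, y) \<in> ?g -` W" for y
      using that W(4)[of y] g(2) by auto
    show "\<Phi> (g q) y \<in> reachable_set A X y0"
      if "(q, y) \<in> ?g -` W" "y \<in> reachable_set A X y0" for q y y0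
      using that W(5)[of "g q" y y0] by auto
  qed
qed

lemma admissible_tendsto:
  assumes "admissible p0 x \<Phi>"
  shows "filterlim (\<lambda>z. \<Phi> (fst z) (snd z)) (nhds x) (nhds (p0, x))"
proof -
  obtain W where W: "open W" "(p0, x) \<in> W" "continuous_on W (\<lambda>z. \<Phi> (fst z) (snd z))"
    "\<And>y. (p0, y) \<in> W \<Longrightarrow> \<Phi> p0 y = y"
    using assms by (rule admissibleE) blast
  show ?thesis
  proof (rule topological_tendstoI)
    fix S assume S: "open S" "x \<in> S"
    have "open (W \<inter> (\<lambda>z. \<Phi> (fst z) (snd z)) -` S)"
      by (rule continuous_open_preimage[OF W(3,1) S(1)])
    then have "\<forall>\<^sub>F z in nhds (p0, x). z \<in> W \<inter> (\<lambda>z. \<Phi> (fst z) (snd z)) -` S"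
      by (rule eventually_nhds_in_open) (use W(2) W(4)[OF W(2)] S(2) in auto)
    then show "\<forall>\<^sub>F z in nhds (p0, x). \<Phi> (fst z) (snd z) \<in> S" by eventually_elim auto
  qed
qed

lemma admissible_base:
  assumes "admissible p0 x \<Phi>" shows "\<forall>\<^sub>F y in nhds x. \<Phi> p0 y = y"
proof -
  obtain W where W: "open W" "(p0, x) \<in> W" "\<And>y. (p0, y) \<in> W \<Longrightarrow> \<Phi> p0 y = y"
    using assms by (rule admissibleE) blast
  have "open (Pair p0 -` W)" using W(1) by (intro open_vimage continuous_intros)
  then have "\<forall>\<^sub>F y in nhds x. y \<in> Pair p0 -` W" by (rule eventually_nhds_in_open) (use W in auto)
  then show ?thesis by eventually_elim (use W in auto)
qed

lemma flow_family_exists: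
  "\<exists>\<Psi>. admissible 0 x \<Psi> \<and> (\<forall>c. has_expansion x (\<lambda>t. \<Psi> (c * t)) (nexp i c))"
proof -
  obtain h N \<Psi> where \<Psi>: "0 < h" "open N" "x \<in> N"
    "continuous_on ({- h<..<h} \<times> N) (\<lambda>z. \<Psi> (fst z) (snd z))" "\<And>y. y \<in> N \<Longrightarrow> \<Psi> 0 y = y"
    "\<And>t y f. t \<in> {- h<..<h} \<Longrightarrow> y \<in> N \<Longrightarrow> f \<in> smooth_funs A \<Longrightarrow>
      ((\<lambda>s. f (\<Psi> s y)) has_real_derivative X i f (\<Psi> t y)) (at t)"
    using vector_field_flow[OF vector_fields[of i], of x] by blast
  have "admissible 0 x \<Psi>"
    unfolding admissible_def
  proof (intro exI[of _ "{- h<..<h} \<times> N"] conjI allI impI)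
    show "open ({- h<..<h} \<times> N)" by (intro open_Times \<Psi>) auto
    fix t y y0 assume ty: "(t, y) \<in> {- h<..<h} \<times> N" and y: "y \<in> reachable_set A X y0"
    have "continuous_on {- h<..<h} (\<lambda>t. (t, y))" by (intro continuous_intros)
    from continuous_on_compose2[OF \<Psi>(4) this] ty
    have "continuous_on {- h<..<h} (\<lambda>t. \<Psi> t y)" by (simp add: image_subset_iff)
    then show "\<Psi> t y \<in> reachable_set A X y0"
      using ty by (intro reachable_set_flow[OF y, where \<Psi> = "\<lambda>t. \<Psi> t y" and h = h and i = i]) (auto intro: \<Psi>)
  qed (use \<Psi> in auto)
  moreover have "has_expansion x (\<lambda>t. \<Psi> (c * t)) (nexp i c)" for c
    by (rule flow_has_expansion[OF \<Psi>]) auto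
  ultimately show ?thesis by blast
qed

text \<open>The head of the word is run first, matching its place at the left of the product in
  \<open>has_expansion_compose\<close>.\<close>

lemma word_family_exists:
  "\<exists>\<Phi>. admissible 0 x \<Phi> \<and> has_expansion x \<Phi> (word_exp l)"
proof (induction l)
  case Nil
  have "has_expansion x (\<lambda>t y. y) (word_exp [])" by (simp add: has_expansion_id)
  then show ?case using admissible_id by blast
next
  case (Cons p l)
  then obtain \<Phi> where \<Phi>: "admissible 0 x \<Phi>" "has_expansion x \<Phi> (word_exp l)" by blast
  obtain \<Psi> where \<Psi>: "admissible 0 x \<Psi>" "has_expansion x (\<lambda>t. \<Psi> (snd p * t)) (nexp (fst p) (snd p))"
    using flow_family_exists by blast
  have \<Psi>': "admissible 0 x (\<lambda>t. \<Psi> (snd p * t))"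
    by (rule admissible_reparam[OF \<Psi>(1)]) (auto intro!: continuous_intros)
  have "has_expansion x (\<lambda>t y. \<Phi> t (\<Psi> (snd p * t) y)) (word_exp (p # l))"
    using has_expansion_compose[OF \<Phi>(2) \<Psi>(2) admissible_tendsto[OF \<Psi>']] by simp
  with admissible_compose[OF \<Phi>(1) \<Psi>'] show ?case by blast
qed

text \<open>What remains of an expansion once the time is replaced by a root: displacement s Z with
  an error o(|s|), still uniform in the starting point.\<close>

definition first_order :: "'a \<Rightarrow> (real \<Rightarrow> 'a \<Rightarrow> 'a) \<Rightarrow> 'a vfield \<Rightarrow> bool" where
  "first_order x F Z \<longleftrightarrow> (\<forall>f\<in>smooth_funs A. \<forall>\<epsilon>>0. \<forall>\<^sub>F z in nhds (0, x).
     \<bar>f (F (fst z) (snd z)) - f (snd z) - fst z * Z f (snd z)\<bar> \<le> \<epsilon> * \<bar>fst z\<bar>)"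

text \<open>Taking the n-th root of |s| as time turns a leading term of degree n into one linear in
  s. The remainder has degree n + 1 in the root, so it is a constant times the root times |s|, and
  the root tends to 0.\<close>

lemma bracket_family_exists:
  assumes B: "iterated_bracket n B"
  shows "\<exists>F. admissible 0 x F \<and> first_order x F (homogeneous_op n B)"
proof -
  have n: "0 < n" and hom: "homogeneous n B"
    using B by (rule iterated_bracket_pos, rule iterated_bracket_homogeneous)
  obtain l l' where l: "ord_ge (Suc n) (word_exp l - 1 - B)" "ord_ge (Suc n) (word_exp l' - 1 + B)"
    using iterated_bracket_words[OF B] by blast
  obtain \<Phi> where \<Phi>: "admissible 0 x \<Phi>" "has_expansion x \<Phi> (word_exp l)" using word_family_exists by blast
  obtain \<Psi> where \<Psi>: "admissible 0 x \<Psi>" "has_expansion x \<Psi> (word_exp l')" using word_family_exists by blast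
  define p q where "p s = root n (max s 0)" and "q s = root n (max (- s) 0)" for s
  have cont_pq: "continuous_on UNIV p" "continuous_on UNIV q"
    unfolding p_def q_def by (intro continuous_intros)+
  have pq0: "p 0 = 0" "q 0 = 0" by (auto simp: p_def q_def)
  \<comment> \<open>One of \<open>p s\<close>, \<open>q s\<close> is \<open>0\<close>, so \<open>F s\<close> runs \<open>\<Phi>\<close> for \<open>s \<ge> 0\<close> and \<open>\<Psi>\<close> for \<open>s \<le> 0\<close>.\<close>
  define F where "F s y = \<Phi> (p s) (\<Psi> (q s) y)" for s y
  have \<Psi>q: "admissible 0 x (\<lambda>s. \<Psi> (q s))"
    by (rule admissible_reparam[OF \<Psi>(1) cont_pq(2) pq0(2)])
  have adm: "admissible 0 x F"
    unfolding F_def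
    by (intro admissible_compose[OF admissible_reparam[OF \<Phi>(1) cont_pq(1) pq0(1)] \<Psi>q])
  have lim_p: "filterlim (\<lambda>z. p (fst z)) (nhds 0) (nhds (0::real, x))"
    and lim_q: "filterlim (\<lambda>z. q (fst z)) (nhds 0) (nhds (0::real, x))"
  proof -
    have "isCont p 0" "isCont q 0" using cont_pq by (auto simp: continuous_on_eq_continuous_at)
    then have "filterlim p (nhds 0) (nhds 0)" "filterlim q (nhds 0) (nhds 0)"
      using pq0 tendsto_at_iff_tendsto_nhds[of p 0] tendsto_at_iff_tendsto_nhds[of q 0]
      by (simp_all add: isCont_def)
    moreover have "filterlim fst (nhds 0) (nhds (0::real, x))" using tendsto_fst[OF filterlim_ident] by fastforce
    ultimately show "filterlim (\<lambda>z. p (fst z)) (nhds 0) (nhds (0::real, x))"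
      "filterlim (\<lambda>z. q (fst z)) (nhds 0) (nhds (0::real, x))"
      using filterlim_compose by blast+
  qed
  have lim_snd: "filterlim snd (nhds x) (nhds (0::real, x))" using tendsto_snd[OF filterlim_ident] by fastforce
  have "first_order x F (homogeneous_op n B)"
    unfolding first_order_def
  proof (intro ballI allI impI)
    fix f and \<epsilon> :: real assume f: "f \<in> smooth_funs A" and \<epsilon>: "0 < \<epsilon>"
    define Z where "Z = homogeneous_op n B f"
    have neg: "homogeneous_op n (- B) f y = - Z y" for y
      by (simp add: homogeneous_op_def Z_def sum_negf)
    obtain C where C: "\<forall>\<^sub>F z in nhds (0, x). \<bar>f (\<Phi> (fst z) (snd z)) - f (snd z) - fst z ^ n * Z (snd z)\<bar> \<le> C * \<bar>fst z\<bar> ^ Suc n"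
      using expansion_leading_term[OF \<Phi>(2) l(1) hom f] unfolding Z_def by blast
    have "ord_ge (Suc n) (word_exp l' - 1 - - B)" "homogeneous n (- B)"
      using l(2) hom by (simp_all add: homogeneous_def)
    from expansion_leading_term[OF \<Psi>(2) this f]
    obtain D where D: "\<forall>\<^sub>F z in nhds (0, x). \<bar>f (\<Psi> (fst z) (snd z)) - f (snd z) - fst z ^ n * - Z (snd z)\<bar> \<le> D * \<bar>fst z\<bar> ^ Suc n"
      unfolding neg by blast
    have pair_p: "filterlim (\<lambda>z. (p (fst z), snd z)) (nhds (0, x)) (nhds (0::real, x))"
      and pair_q: "filterlim (\<lambda>z. (q (fst z), snd z)) (nhds (0, x)) (nhds (0::real, x))"
      using filterlim_Pair[OF lim_p lim_snd] filterlim_Pair[OF lim_q lim_snd] by (simp_all add: nhds_prod)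
    note 1 = eventually_compose_filterlim[OF C pair_p, simplified]
    note 2 = eventually_compose_filterlim[OF D pair_q, simplified]
    note 3 = eventually_compose_filterlim[OF admissible_base[OF \<Psi>(1)] lim_snd]
    note 4 = eventually_compose_filterlim[OF admissible_base[OF \<Phi>(1)] admissible_tendsto[OF \<Psi>q]]
    have "((\<lambda>z. C * p (fst z)) \<longlongrightarrow> C * 0) (nhds (0::real, x))" "((\<lambda>z. D * q (fst z)) \<longlongrightarrow> D * 0) (nhds (0::real, x))"
      by (intro tendsto_intros lim_p lim_q)+
    then have 5: "\<forall>\<^sub>F z in nhds (0, x). C * p (fst z) < \<epsilon>" and 6: "\<forall>\<^sub>F z in nhds (0, x). D * q (fst z) < \<epsilon>"
      using \<epsilon> by (auto intro: order_tendstoD)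
    show "\<forall>\<^sub>F z in nhds (0, x). \<bar>f (F (fst z) (snd z)) - f (snd z) - fst z * homogeneous_op n B f (snd z)\<bar> \<le> \<epsilon> * \<bar>fst z\<bar>"
      unfolding Z_def[symmetric]
      using 1 2 3 4 5 6
    proof eventually_elim
      case (elim z)
      define s y where "s = fst z" and "y = snd z"
      note elim = elim[folded s_def y_def]
      show ?case
      proof (cases "0 \<le> s")
        case True
        have p: "p s ^ n = s" "0 \<le> p s" using True n by (auto simp: p_def max_def)
        have "q s = 0" using True by (simp add: q_def)
        then have "F s y = \<Phi> (p s) y" using elim(3) by (simp add: F_def)
        then have "\<bar>f (F s y) - f y - s * Z y\<bar> \<le> C * p s * \<bar>s\<bar>"
          using elim(1) p True by (simp add: mult.assoc)
        also have "\<dots> \<le> \<epsilon> * \<bar>s\<bar>" using elim(5) by (intro mult_right_mono) auto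
        finally show ?thesis by (simp add: s_def y_def)
      next
        case False
        have q: "q s ^ n = - s" "0 \<le> q s" using False n by (auto simp: q_def max_def)
        have "p s = 0" using False by (simp add: p_def)
        then have "F s y = \<Psi> (q s) y" using elim(4) by (simp add: F_def)
        then have "\<bar>f (F s y) - f y - s * Z y\<bar> \<le> D * q s * \<bar>s\<bar>"
          using elim(2) q False by (simp add: mult.assoc)
        also have "\<dots> \<le> \<epsilon> * \<bar>s\<bar>" using elim(6) by (intro mult_right_mono) auto
        finally show ?thesis by (simp add: s_def y_def)
      qed
    qed
  qed
  with adm show ?thesis by blast
qed

text \<open>Motions are added one index at a time, the new one being run first. Three errors receive
  \<epsilon>/3 each: that of the earlier composite at the displaced point, that of the new motion,
  and the passage from Z j f at y to its value at x, which is small by continuity.\<close>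

lemma multi_family_exists:
  fixes Z :: "'j::finite \<Rightarrow> 'a vfield"
  assumes F: "\<And>j. admissible 0 x (F j)" "\<And>j. first_order x (F j) (Z j)"
    and Z: "\<And>j f. f \<in> smooth_funs A \<Longrightarrow> Z j f \<in> smooth_funs A" and "distinct js"
  shows "\<exists>G. admissible (0 :: real^'j) x G \<and> (\<forall>f\<in>smooth_funs A. \<forall>\<epsilon>>0. \<forall>\<^sub>F z in nhds (0, x).
    \<bar>f (G (fst z) (snd z)) - f (snd z) - (\<Sum>j\<in>set js. fst z $ j * Z j f x)\<bar> \<le> \<epsilon> * norm (fst z))"
  using assms(4)
proof (induction js)
  case Nil
  show ?case by (rule exI[of _ "\<lambda>p y. y"]) (simp add: admissible_id)
next
  case (Cons j js)
  then obtain G where G: "admissible (0 :: real^'j) x G"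
    "\<And>f \<epsilon>. f \<in> smooth_funs A \<Longrightarrow> 0 < \<epsilon> \<Longrightarrow> \<forall>\<^sub>F z in nhds (0, x).
      \<bar>f (G (fst z) (snd z)) - f (snd z) - (\<Sum>j\<in>set js. fst z $ j * Z j f x)\<bar> \<le> \<epsilon> * norm (fst z)"
    by auto
  have Fj: "admissible (0 :: real^'j) x (\<lambda>s. F j (s $ j))"
    by (rule admissible_reparam[OF F(1)]) (auto intro!: continuous_intros)
  have lim_snd: "filterlim snd (nhds x) (nhds (0::real^'j, x))" using tendsto_snd[OF filterlim_ident] by fastforce
  have lim_fst: "filterlim fst (nhds 0) (nhds (0::real^'j, x))" using tendsto_fst[OF filterlim_ident] by fastforce
  have lim_j: "filterlim (\<lambda>z. (fst z $ j, snd z)) (nhds (0, x)) (nhds (0::real^'j, x))"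
    using filterlim_Pair[OF tendsto_vec_nth[OF lim_fst] lim_snd] by (simp add: nhds_prod)
  have lim_F: "filterlim (\<lambda>z. (fst z, F j (fst z $ j) (snd z))) (nhds (0, x)) (nhds (0::real^'j, x))"
    using filterlim_Pair[OF lim_fst admissible_tendsto[OF Fj]] by (simp add: nhds_prod)
  show ?case
  proof (intro exI[of _ "\<lambda>s y. G s (F j (s $ j) y)"] conjI ballI allI impI)
    show "admissible 0 x (\<lambda>s y. G s (F j (s $ j) y))" by (rule admissible_compose[OF G(1) Fj])
    fix f and \<epsilon> :: real assume f: "f \<in> smooth_funs A" and \<epsilon>: "0 < \<epsilon>"
    then have \<epsilon>3: "0 < \<epsilon> / 3" by simp
    note 1 = eventually_compose_filterlim[OF G(2)[OF f \<epsilon>3] lim_F, simplified]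
    have "\<forall>\<^sub>F z in nhds (0, x). \<bar>f (F j (fst z) (snd z)) - f (snd z) - fst z * Z j f (snd z)\<bar> \<le> \<epsilon> / 3 * \<bar>fst z\<bar>"
      using F(2)[of j] f \<epsilon>3 unfolding first_order_def by blast
    note 2 = eventually_compose_filterlim[OF this lim_j, simplified]
    have "(Z j f \<longlongrightarrow> Z j f x) (nhds x)"
      using smooth_funs_continuous_on[OF Z[OF f]] by (simp add: continuous_on_def tendsto_at_iff_tendsto_nhds)
    from filterlim_compose[OF this lim_snd]
    have 3: "\<forall>\<^sub>F z in nhds (0::real^'j, x). \<bar>Z j f (snd z) - Z j f x\<bar> < \<epsilon> / 3"
      using tendstoD[OF _ \<epsilon>3] by (fastforce simp: dist_real_def)
    show "\<forall>\<^sub>F z in nhds (0, x). \<bar>f (G (fst z) (F j (fst z $ j) (snd z))) - f (snd z)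
        - (\<Sum>j\<in>set (j # js). fst z $ j * Z j f x)\<bar> \<le> \<epsilon> * norm (fst z)"
      using 1 2 3
    proof eventually_elim
      case (elim z)
      define s y where "s = fst z" and "y = snd z"
      note elim = elim[folded s_def y_def]
      have s: "\<bar>s $ j\<bar> \<le> norm s" by (rule component_le_norm_cart)
      have "\<epsilon> * \<bar>s $ j\<bar> \<le> \<epsilon> * norm s" using mult_left_mono[OF s, of \<epsilon>] \<epsilon> by simp
      then have a2: "\<bar>f (F j (s $ j) y) - f y - s $ j * Z j f y\<bar> \<le> \<epsilon> / 3 * norm s" using elim(2) by simp
      have "\<bar>s $ j * (Z j f y - Z j f x)\<bar> \<le> norm s * (\<epsilon> / 3)"
        unfolding abs_mult using s elim(3) by (intro mult_mono) auto
      then have a3: "\<bar>s $ j * (Z j f y - Z j f x)\<bar> \<le> \<epsilon> / 3 * norm s" by (simp only: mult.commute)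
      have a1: "\<bar>f (G s (F j (s $ j) y)) - f (F j (s $ j) y) - (\<Sum>j\<in>set js. s $ j * Z j f x)\<bar> \<le> \<epsilon> / 3 * norm s"
        using elim(1) by simp
      have "f (G s (F j (s $ j) y)) - f y - (\<Sum>j\<in>set (j # js). s $ j * Z j f x) =
          (f (G s (F j (s $ j) y)) - f (F j (s $ j) y) - (\<Sum>j\<in>set js. s $ j * Z j f x))
          + (f (F j (s $ j) y) - f y - s $ j * Z j f y) + s $ j * (Z j f y - Z j f x)"
        using Cons.prems by (simp add: algebra_simps)
      also have "\<bar>\<dots>\<bar> \<le> \<epsilon> / 3 * norm s + \<epsilon> / 3 * norm s + \<epsilon> / 3 * norm s"
        by (intro order_trans[OF abs_triangle_ineq] add_mono a1 a2 a3)
      also have "\<dots> = \<epsilon> * norm s" by simp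
      finally show ?case unfolding s_def y_def .
    qed
  qed
qed

section \<open>The open mapping argument at a point\<close>

theorem reachable_set_neighbourhood:
  assumes rank: "LTS_at A X x = tangent_space A x"
  shows "x \<in> interior (reachable_set A X x)"
proof -
  obtain U \<phi> where U: "(U, \<phi>) \<in> A" "x \<in> U" using chart_at .
  obtain c W where c: "\<And>l. c l \<in> smooth_funs A" "open W" "x \<in> W" "W \<subseteq> U" "\<And>l y. y \<in> W \<Longrightarrow> c l y = \<phi> y $ l"
    using coordinate_functions[OF U] by blast
  let ?val = "\<lambda>Z. (\<chi> l. Z (c l) x) :: real^'n"
  have span: "span (?val ` bracket_ops) = UNIV"
    by (rule bracket_values_span[OF rank U c])
  obtain S where S: "S \<subseteq> ?val ` bracket_ops" "independent S" "?val ` bracket_ops \<subseteq> span S"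
    using maximal_independent_subset by blast
  have "span S = UNIV" using S(3) span span_minimal subspace_span by (metis top.extremum_uniqueI)
  then have "card S = DIM(real^'n)" using S(2) by (metis dim_UNIV dim_span_eq_card_independent)
  moreover have "finite S" using S(2) by (rule independent_imp_finite)
  \<comment> \<open>Indexing the basis of bracket values by \<open>'n\<close> gives the parameters
    of the composite motion the same type as the chart coordinates.\<close>
  ultimately obtain g :: "'n \<Rightarrow> real^'n" where g: "bij_betw g UNIV S"
    using finite_same_card_bij[of "UNIV :: 'n set" S] by auto
  have "\<forall>j. \<exists>Z. g j = ?val Z \<and> Z \<in> bracket_ops"
  proof
    fix j
    have "g j \<in> S" using bij_betwE[OF g] by blast
    from subsetD[OF S(1) this] show "\<exists>Z. g j = ?val Z \<and> Z \<in> bracket_ops" unfolding image_iff by blast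
  qed
  from choice[OF this] obtain Z where "\<forall>j. g j = ?val (Z j) \<and> Z j \<in> bracket_ops" ..
  then have Z: "\<And>j. Z j \<in> bracket_ops" "\<And>j. ?val (Z j) = g j" by simp_all
  have Z_smooth: "Z j f \<in> smooth_funs A" if "f \<in> smooth_funs A" for j f
    using linear_op_smooth[OF linear_op_bracket_span[OF opspan.gen[OF Z(1)]] that] .
  have "\<forall>j. \<exists>F. admissible 0 x F \<and> first_order x F (Z j)"
  proof
    fix j
    obtain n B where "iterated_bracket n B" "Z j = homogeneous_op n B" using Z(1)[of j] by (auto simp: bracket_ops_def)
    then show "\<exists>F. admissible 0 x F \<and> first_order x F (Z j)" using bracket_family_exists by simp
  qed
  from choice[OF this] obtain F where "\<forall>j. admissible 0 x (F j) \<and> first_order x (F j) (Z j)" ..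
  then have F: "\<And>j. admissible 0 x (F j)" "\<And>j. first_order x (F j) (Z j)" by simp_all
  obtain js :: "'n list" where js: "set js = UNIV" "distinct js"
    using finite_distinct_list[of "UNIV :: 'n set"] by auto
  from multi_family_exists[OF F Z_smooth js(2), unfolded js(1)]
  obtain G where G': "admissible (0 :: real^'n) x G \<and> (\<forall>f\<in>smooth_funs A. \<forall>\<epsilon>>0. \<forall>\<^sub>F z in nhds (0, x).
      \<bar>f (G (fst z) (snd z)) - f (snd z) - (\<Sum>j\<in>UNIV. fst z $ j * Z j f x)\<bar> \<le> \<epsilon> * norm (fst z))" ..
  have G: "admissible (0 :: real^'n) x G" "\<And>f \<epsilon>. f \<in> smooth_funs A \<Longrightarrow> 0 < \<epsilon> \<Longrightarrow> \<forall>\<^sub>F z in nhds (0, x).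
      \<bar>f (G (fst z) (snd z)) - f (snd z) - (\<Sum>j\<in>UNIV. fst z $ j * Z j f x)\<bar> \<le> \<epsilon> * norm (fst z)"
    by (rule conjunct1[OF G'], rule conjunct2[OF G', rule_format])
  obtain V where V: "open V" "(0, x) \<in> V" "continuous_on V (\<lambda>z. G (fst z) (snd z))"
    "\<And>y. (0, y) \<in> V \<Longrightarrow> G 0 y = y"
    "\<And>p y y0. (p, y) \<in> V \<Longrightarrow> y \<in> reachable_set A X y0 \<Longrightarrow> G p y \<in> reachable_set A X y0"
    using G(1) by (rule admissibleE) blast
  have G0: "G 0 x = x" by (rule V(4)[OF V(2)])
  define D where "D = {s. (s, x) \<in> V}"
  have "open ((\<lambda>s. (s, x)) -` V)" using V(1) by (intro open_vimage continuous_intros)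
  then have D: "open D" "0 \<in> D" using V(2) by (auto simp: D_def vimage_def)
  have contG: "continuous_on D (\<lambda>s. G s x)"
  proof -
    have "continuous_on D (\<lambda>s. (s, x))" by (intro continuous_intros)
    from continuous_on_compose2[OF V(3) this] show ?thesis by (simp add: image_subset_iff D_def)
  qed
  \<comment> \<open>Coordinates are read through the global functions \<open>c l\<close>, which
    coincide with the chart on \<open>W\<close>; T keeps the parameters whose end point lies
    there.\<close>
  define T where "T = D \<inter> (\<lambda>s. G s x) -` W"
  have T: "open T" "0 \<in> T" "T \<subseteq> D"
    unfolding T_def using continuous_open_preimage[OF contG D(1) c(2)] D(2) G0 c(3) by auto
  define H where "H s = (\<chi> l. c l (G s x))" for s
  define H' where "H' s = (\<Sum>j\<in>UNIV. s $ j *\<^sub>R g j)" for s :: "real^'n"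
  have lin: "linear H'"
    unfolding H'_def by (intro linearI) (simp_all add: scaleR_left_distrib sum.distrib scaleR_sum_right)
  have contH: "continuous_on D H"
    unfolding H_def
    by (intro continuous_on_vec_lambda continuous_on_compose2[OF smooth_funs_continuous_on[OF c(1)] contG]) auto
  have derH: "(H has_derivative H') (at 0)"
  proof (subst has_derivative_componentwise_within, rule ballI)
    fix b :: "real^'n" assume "b \<in> Basis"
    then obtain l where b: "b = axis l 1" by (auto simp: Basis_vec_def)
    have "((\<lambda>s. c l (G s x)) has_derivative (\<lambda>s. \<Sum>j\<in>UNIV. s $ j * Z j (c l) x)) (at 0)"
      unfolding has_derivative_at_alt
    proof (intro conjI allI impI)
      show "bounded_linear (\<lambda>s::real^'n. \<Sum>j\<in>UNIV. s $ j * Z j (c l) x)"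
        by (intro bounded_linear_sum bounded_linear_mult_const bounded_linear_vec_nth)
      fix e :: real assume "0 < e"
      have "filterlim (\<lambda>s. (s, x)) (nhds (0, x)) (nhds (0::real^'n))"
        using filterlim_Pair[OF filterlim_ident tendsto_const] by (simp add: nhds_prod)
      from eventually_compose_filterlim[OF G(2)[OF c(1) \<open>0 < e\<close>] this]
      obtain d where "0 < d" "\<And>s. dist s 0 < d \<Longrightarrow>
          \<bar>c l (G s x) - c l x - (\<Sum>j\<in>UNIV. s $ j * Z j (c l) x)\<bar> \<le> e * norm s"
        unfolding eventually_nhds_metric by auto
      then show "\<exists>d>0. \<forall>s. norm (s - 0) < d \<longrightarrow>
          norm (c l (G s x) - c l (G 0 x) - (\<Sum>j\<in>UNIV. (s - 0) $ j * Z j (c l) x)) \<le> e * norm (s - 0)"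
        using G0 by auto
    qed
    moreover have "g j $ l = Z j (c l) x" for j unfolding Z(2)[symmetric] by simp
    ultimately show "((\<lambda>s. H s \<bullet> b) has_derivative (\<lambda>s. H' s \<bullet> b)) (at 0)"
      by (simp add: b inner_axis H_def H'_def sum_component)
  qed
  obtain K where K: "linear K" "H' \<circ> K = id"
  proof -
    have "surj H'"
    proof
      show "UNIV \<subseteq> range H'"
      proof
        fix v :: "real^'n"
        have "v \<in> span S" using \<open>span S = UNIV\<close> by simp
        then obtain u where "v = (\<Sum>b\<in>S. u b *\<^sub>R b)"
          unfolding span_finite[OF \<open>finite S\<close>] by auto
        also have "\<dots> = (\<Sum>j\<in>UNIV. u (g j) *\<^sub>R g j)"
          by (rule sum.reindex_bij_betw[OF g, symmetric])
        also have "\<dots> = H' (\<chi> j. u (g j))" by (simp add: H'_def)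
        finally show "v \<in> range H'" by blast
      qed
    qed simp
    then show ?thesis using linear_surjective_right_inverse[OF lin] that by blast
  qed
  have "bounded_linear K" using K(1) by (simp add: linear_conv_bounded_linear)
  moreover have "0 \<in> interior T" using T by (simp add: interior_open)
  ultimately have "H 0 \<in> interior (H ` T)"
    by (rule sussmann_open_mapping[OF D(1) contH D(2) derH _ K(2) T(3)])
  moreover have HT: "H s = \<phi> (G s x)" if "s \<in> T" for s
    using that c(5) by (simp add: H_def T_def vec_eq_iff)
  moreover have "G s x \<in> W \<inter> reachable_set A X x" if "s \<in> T" for s
    using that V(5)[OF _ reachable_set_refl] by (auto simp: T_def D_def)
  ultimately have in_int: "\<phi> x \<in> interior (\<phi> ` (W \<inter> reachable_set A X x))"
    using HT[OF T(2)] G0 interior_mono[of "H ` T" "\<phi> ` (W \<inter> reachable_set A X x)"] by auto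
  \<comment> \<open>Back from coordinates to the manifold: a point of \<open>U\<close> whose
    coordinates lie in the interior shares them with a reachable point of \<open>W\<close>, and
    injectivity of the chart makes the two equal.\<close>
  show ?thesis
  proof (rule interiorI)
    show "open (U \<inter> \<phi> -` interior (\<phi> ` (W \<inter> reachable_set A X x)))"
      by (intro chart_open_vimage U open_interior)
    show "x \<in> U \<inter> \<phi> -` interior (\<phi> ` (W \<inter> reachable_set A X x))" using in_int U by auto
    show "U \<inter> \<phi> -` interior (\<phi> ` (W \<inter> reachable_set A X x)) \<subseteq> reachable_set A X x"
    proof
      fix y assume y: "y \<in> U \<inter> \<phi> -` interior (\<phi> ` (W \<inter> reachable_set A X x))"
      then obtain y' where "y' \<in> W" "y' \<in> reachable_set A X x" "\<phi> y = \<phi> y'"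
        using interior_subset by blast
      moreover from this have "y = y'" using y c(4) inj_onD[OF chart_inj_on[OF U(1)]] by blast
      ultimately show "y \<in> reachable_set A X x" by simp
    qed
  qed
qed

end

theorem mainTheorem2:
  fixes A :: "('a::topological_space set \<times> ('a \<Rightarrow> real^'n)) set"
    and m :: "'a \<Rightarrow> 'a \<Rightarrow> 'a"
    and X :: "'k::finite \<Rightarrow> 'a vfield"
  assumes "symmetric_space A m"
    and "\<And>i. smooth_vector_field A (X i)"
    and "\<And>x. LTS_at A X x = tangent_space A x"
  shows "\<forall>x. x \<in> interior (reachable_set A X x)"
proof
  fix x
  interpret control_system A X
    using assms(1,2) by unfold_locales (auto simp: symmetric_space_def)
  show "x \<in> interior (reachable_set A X x)"
    by (rule reachable_set_neighbourhood[OF assms(3)])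
qed

end
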